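(* Let $\xi>-1$ be real. Given $a,b\in\mathbb{R}$ and $c\in\mathbb{C}$, define $$L=(cz^2+az+\overline{c})\frac{d}{dz}+\big((\xi+2)cz+b\big)$$ as an operator in $\mathcal{A}_\xi^2$ with domain $\mathcal{D}(L)=P(\mathbb{D})$. Then $L$ is symmetric, and there exist $d\in\mathbb{R}$ and $X\in\mathfrak{su}(1,1)$ such that $L$ is the restriction to $P(\mathbb{D})$ of the operator $S=i\pi_\xi(X)+d$ with domain $\mathcal{D}(S)=H_\xi^\infty$. Moreover, $\overline{L}=i\overline{\pi}_\xi(X)+d$, and this operator is self-adjoint.
   Context: $\mathbb{D}=\{z\in\mathbb{C}:|z|<1\}$, $H(\mathbb{D})$ is the space of holomorphic functions on $\mathbb{D}$, and $dz$ denotes the Euclidean (area) measure on $\mathbb{C}$. For $\xi>-1$ let $d\nu_\xi(z)=\frac{\xi+1}{\pi}(1-|z|^2)^\xi\,dz$, a probability measure on $\mathbb{D}$. The weighted Bergman space $\mathcal{A}_\xi^2$ is the Hilbert space of $f\in H(\mathbb{D})$ with $\|f\|_\xi^2=\int_{\mathbb{D}}|f|^2\,d\nu_\xi<\infty$, with inner product $\langle f,g\rangle_\xi=\int_{\mathbb{D}}f\overline{g}\,d\nu_\xi$. $P(\mathbb{D})\subseteq\mathcal{A}_\xi^2$ is the space of polynomials in $z$. The closure of a closable operator $A$ is denoted $\overline{A}$. $\mathrm{SU}(1,1)$ is the group of matrices $\begin{bmatrix}\alpha&\beta\\ \overline\beta&\overline\alpha\end{bmatrix}$ with $\alpha,\beta\in\mathbb{C}$,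 $|\alpha|^2-|\beta|^2=1$; its Lie algebra $\mathfrak{su}(1,1)$ consists of the matrices $\begin{bmatrix}is&u\\ \overline u&-is\end{bmatrix}$, $s\in\mathbb{R}$, $u\in\mathbb{C}$. The discrete series representation $\pi_\xi$ on $\mathcal{A}_\xi^2$ is given by $$\pi_\xi(x)f(z)=\frac{1}{(-\overline\beta z+\alpha)^{\xi+2}}f\!\left(\frac{\overline\alpha z-\beta}{-\overline\beta z+\alpha}\right),\qquad x=\begin{bmatrix}\alpha&\beta\\ \overline\beta&\overline\alpha\end{bmatrix}.$$ It is unitary for integers $\xi>-1$, and for every real $\xi>-1$ it defines a unitary representation of the universal covering group (along a one-parameter group $t\mapsto\exp(tX)$ one uses the continuous branch of the power that equals $1$ at $t=0$). Its space of smooth vectors is $$H_\xi^\infty=\Big\{f=\sum_{k\ge0}a_kz^k\in H(\mathbb{D}):\ \sum_{k=0}^\infty|a_k|^2\|z^k\|_\xi^2\,(\xi(\xi+2)+2k)^{2m}<\infty\text{ for all }m\in\mathbb{N}\Big\}.$$ For $X\in\mathfrak{su}(1,1)$, $\pi_\xi(X)$ is the operator with domain $H_\xi^\infty$ given by $\pi_\xi(X)v=\frac{d}{dt}\big|_{t=0}\pi_\xi(\exp(tX))v$; explicitly, for $X=\begin{bmatrix}is&u\\ \overline u&-is\end{bmatrix}$, $$\pi_\xi(X)f(z)=(\overline u z^2-2isz-u)f'(z)+(\xi+2)(\overline u z-is)f(z).$$ The operator $\pi_\xi(X)$ is closable, and its closure is denoted $\overline{\pi}_\xi(X)$. *)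

theory Defs
  imports "HOL-Analysis.Analysis" "HOL-Computational_Algebra.Polynomial"
begin

abbreviation unit_disc :: "complex set" where
  "unit_disc \<equiv> ball 0 1"

text \<open>
  Functions on the unit disc are represented by total functions that vanish outside the disc,
  so that equality of functions on the disc is HOL equality.
\<close>

definition on_disc :: "(complex \<Rightarrow> complex) \<Rightarrow> complex \<Rightarrow> complex" where
  "on_disc f = (\<lambda>z. if z \<in> unit_disc then f z else 0)"

definition hol_disc :: "(complex \<Rightarrow> complex) set" where
  "hol_disc = {f. f holomorphic_on unit_disc \<and> (\<forall>z. z \<notin> unit_disc \<longrightarrow> f z = 0)}"

definition disc_measure :: "real \<Rightarrow> complex measure" where
  "disc_measure \<xi> =
     density (restrict_space lborel unit_disc)
       (\<lambda>z. ennreal ((\<xi> + 1) / pi * (1 - (cmod z)\<^sup>2) powr \<xi>))"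

definition bergman :: "real \<Rightarrow> (complex \<Rightarrow> complex) set" where
  "bergman \<xi> = {f \<in> hol_disc. integrable (disc_measure \<xi>) (\<lambda>z. (cmod (f z))\<^sup>2)}"

definition bergman_inner ::
    "real \<Rightarrow> (complex \<Rightarrow> complex) \<Rightarrow> (complex \<Rightarrow> complex) \<Rightarrow> complex" where
  "bergman_inner \<xi> f g = (LINT z|disc_measure \<xi>. f z * cnj (g z))"

definition bergman_norm :: "real \<Rightarrow> (complex \<Rightarrow> complex) \<Rightarrow> real" where
  "bergman_norm \<xi> f = sqrt (LINT z|disc_measure \<xi>. (cmod (f z))\<^sup>2)"

text \<open>
  The membership conditions are essential: the Bochner integral of a non-integrable function
  is 0, so the convergence of \<^const>\<open>bergman_norm\<close> alone would not express norm convergence.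
\<close>

definition bergman_tendsto ::
    "real \<Rightarrow> ('t \<Rightarrow> complex \<Rightarrow> complex) \<Rightarrow> (complex \<Rightarrow> complex) \<Rightarrow> 't filter \<Rightarrow> bool" where
  "bergman_tendsto \<xi> v w F \<longleftrightarrow>
     w \<in> bergman \<xi> \<and> (\<forall>\<^sub>F t in F. v t \<in> bergman \<xi>) \<and>
     ((\<lambda>t. bergman_norm \<xi> (\<lambda>z. v t z - w z)) \<longlongrightarrow> 0) F"

definition poly_disc :: "(complex \<Rightarrow> complex) set" where
  "poly_disc = {on_disc (poly p) | p. True}"

text \<open>
  An operator is represented by its graph; its domain is the \<^const>\<open>Domain\<close> of the graph.
\<close>

type_synonym operator = "((complex \<Rightarrow> complex) \<times> (complex \<Rightarrow> complex)) set"

definition linear_operator :: "real \<Rightarrow> operator \<Rightarrow> bool" where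
  "linear_operator \<xi> A \<longleftrightarrow>
     A \<subseteq> bergman \<xi> \<times> bergman \<xi> \<and> single_valued A \<and>
     ((\<lambda>_. 0), (\<lambda>_. 0)) \<in> A \<and>
     (\<forall>(f, f') \<in> A. \<forall>(g, g') \<in> A. ((\<lambda>z. f z + g z), (\<lambda>z. f' z + g' z)) \<in> A) \<and>
     (\<forall>(f, f') \<in> A. \<forall>r. ((\<lambda>z. r * f z), (\<lambda>z. r * f' z)) \<in> A)"

definition densely_defined :: "real \<Rightarrow> operator \<Rightarrow> bool" where
  "densely_defined \<xi> A \<longleftrightarrow>
     (\<forall>f \<in> bergman \<xi>. \<exists>v. (\<forall>n::nat. v n \<in> Domain A) \<and> bergman_tendsto \<xi> v f sequentially)"

definition symmetric_operator :: "real \<Rightarrow> operator \<Rightarrow> bool" where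
  "symmetric_operator \<xi> A \<longleftrightarrow>
     linear_operator \<xi> A \<and> densely_defined \<xi> A \<and>
     (\<forall>(f, f') \<in> A. \<forall>(g, g') \<in> A. bergman_inner \<xi> f' g = bergman_inner \<xi> f g')"

definition adjoint_operator :: "real \<Rightarrow> operator \<Rightarrow> operator" where
  "adjoint_operator \<xi> A =
     {(g, h). g \<in> bergman \<xi> \<and> h \<in> bergman \<xi> \<and>
        (\<forall>(f, f') \<in> A. bergman_inner \<xi> f' g = bergman_inner \<xi> f h)}"

definition self_adjoint_operator :: "real \<Rightarrow> operator \<Rightarrow> bool" where
  "self_adjoint_operator \<xi> A \<longleftrightarrow>
     linear_operator \<xi> A \<and> densely_defined \<xi> A \<and> adjoint_operator \<xi> A = A"

text \<open>
  The closure of the graph. It is the graph of an operator, i.e. single-valued, exactly when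
  the linear operator \<open>A\<close> is closable.
\<close>

definition closure_operator :: "real \<Rightarrow> operator \<Rightarrow> operator" where
  "closure_operator \<xi> A =
     {(f, g). \<exists>v w. (\<forall>n::nat. (v n, w n) \<in> A) \<and>
        bergman_tendsto \<xi> v f sequentially \<and> bergman_tendsto \<xi> w g sequentially}"

definition restrict_operator :: "operator \<Rightarrow> (complex \<Rightarrow> complex) set \<Rightarrow> operator" where
  "restrict_operator A D = {(f, g) \<in> A. f \<in> D}"

definition i_times_plus :: "operator \<Rightarrow> real \<Rightarrow> operator" where
  "i_times_plus A d = {(f, (\<lambda>z. \<i> * g z + of_real d * f z)) | f g. (f, g) \<in> A}"

definition su11 :: "(complex^2^2) set" where
  "su11 = {vector [vector [\<i> * of_real s, u], vector [cnj u, - (\<i> * of_real s)]]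
           | (s::real) (u::complex). True}"

text \<open>
  The exponential of the library is not available for matrices, which do not form an
  instance of its type class; this is the power series for the matrix product.
\<close>

definition matrix_exp :: "complex^'n^'n \<Rightarrow> complex^'n^'n" where
  "matrix_exp A = (\<Sum>k. (1 / fact k) *\<^sub>R (((**) A) ^^ k) (mat 1))"

definition mobius_denom :: "complex^2^2 \<Rightarrow> complex \<Rightarrow> complex" where
  "mobius_denom x z = - cnj (x $ 1 $ 2) * z + x $ 1 $ 1"

definition mobius :: "complex^2^2 \<Rightarrow> complex \<Rightarrow> complex" where
  "mobius x z = (cnj (x $ 1 $ 1) * z - x $ 1 $ 2) / mobius_denom x z"

text \<open>
  The continuous branch, vanishing at \<open>0\<close>, of the logarithm of a continuous zero-free
  function \<open>\<gamma>\<close> on the real line with \<open>\<gamma> 0 = 1\<close>; it exists and is unique for such \<open>\<gamma>\<close>.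
\<close>

definition continuous_log :: "(real \<Rightarrow> complex) \<Rightarrow> real \<Rightarrow> complex" where
  "continuous_log \<gamma> =
     (THE l. continuous_on UNIV l \<and> l 0 = 0 \<and> (\<forall>t. exp (l t) = \<gamma> t))"

text \<open>
  The representation along the one-parameter group of \<open>X\<close>, i.e. \<open>\<pi>\<^sub>\<xi> (exp (t X)) f\<close>, with
  the power \<open>- (\<xi> + 2)\<close> of the denominator given by the branch that is continuous in \<open>t\<close>
  and equal to 1 at \<open>t = 0\<close>.
\<close>

definition discrete_series ::
    "real \<Rightarrow> complex^2^2 \<Rightarrow> real \<Rightarrow> (complex \<Rightarrow> complex) \<Rightarrow> complex \<Rightarrow> complex" where
  "discrete_series \<xi> X t f = on_disc (\<lambda>z.
     exp (- of_real (\<xi> + 2) * continuous_log (\<lambda>s. mobius_denom (matrix_exp (s *\<^sub>R X)) z) t) *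
     f (mobius (matrix_exp (t *\<^sub>R X)) z))"

definition smooth_vectors :: "real \<Rightarrow> (complex \<Rightarrow> complex) set" where
  "smooth_vectors \<xi> =
     {f \<in> hol_disc. \<exists>a :: nat \<Rightarrow> complex.
        (\<forall>z \<in> unit_disc. (\<lambda>k. a k * z ^ k) sums f z) \<and>
        (\<forall>m::nat. summable (\<lambda>k. (cmod (a k))\<^sup>2 * (bergman_norm \<xi> (on_disc (\<lambda>z. z ^ k)))\<^sup>2 *
                                  (\<xi> * (\<xi> + 2) + 2 * real k) ^ (2 * m)))}"

text \<open>
  The operator \<open>v \<mapsto> d/dt \<pi>\<^sub>\<xi> (exp (t X)) v\<close> at \<open>t = 0\<close> on the smooth vectors, the derivative
  being taken in the norm of the Bergman space.
\<close>

definition derived_rep :: "real \<Rightarrow> complex^2^2 \<Rightarrow> operator" where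
  "derived_rep \<xi> X =
     {(v, w). v \<in> smooth_vectors \<xi> \<and>
        bergman_tendsto \<xi>
          (\<lambda>(t::real) z. (discrete_series \<xi> X t v z - v z) / of_real t) w (at 0)}"

definition diff_op :: "real \<Rightarrow> real \<Rightarrow> real \<Rightarrow> complex \<Rightarrow> operator" where
  "diff_op \<xi> a b c =
     {(f, on_disc (\<lambda>z. (c * z\<^sup>2 + of_real a * z + cnj c) * deriv f z
                       + (of_real (\<xi> + 2) * c * z + of_real b) * f z)) | f. f \<in> poly_disc}"

end

theory Submission
  imports Defs "HOL-Complex_Analysis.Complex_Analysis"
begin

text \<open>
  The monomials are orthogonal in the Bergman space and their squared norms \<open>w\<^sub>k\<close> satisfy
  \<open>(k + \<xi> + 2) w\<^sub>k\<^sub>+\<^sub>1 = (k + 1) w\<^sub>k\<close>. By Parseval's identity (\<open>parseval\<close>) the Bergman space is a weighted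
  sequence space of Taylor coefficients, and there the differential operator is a tridiagonal matrix
  with real diagonal (\<open>taylor_diff_expr\<close>). The recursion for \<open>w\<^sub>k\<close> says exactly that this matrix is
  symmetric for the weighted inner product (\<open>jacobi_symmetric\<close>).

  Let \<open>M\<close> be the maximal operator of the matrix. Testing against monomials shows that the adjoint of \<open>L\<close> is
  contained in \<open>M\<close>. The off-diagonal entries grow only linearly, and therefore \<open>M\<close> is also
  contained in the closure of \<open>L\<close> (\<open>max_op_approx\<close>): if the coefficients of a vector in the domain of \<open>M\<close> are
  multiplied by Fejer's weights \<open>1 - k / (n + 1)\<close>, the commutator with the matrix has entries of size
  \<open>O(k)\<close> times \<open>1 / (n + 1)\<close> with \<open>k \<le> n\<close>. These are bounded, so by dominated convergence the truncated
  vectors converge in the graph norm. As \<open>M\<close> is closed, it is the closure of \<open>L\<close>; it is symmetric as a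
  limit of \<open>L\<close>, and its adjoint is contained in the adjoint of \<open>L\<close>, hence in \<open>M\<close>. So \<open>M\<close> is self-adjoint.

  It remains to identify the operator \<open>S = \<i>\<pi>(X) + d\<close>. The coefficients of a smooth vector decay faster than any
  power of \<open>k\<close>, so the vector and its derivative extend continuously to the closed disc. By
  compactness the difference quotients of the representation converge uniformly on the disc
  (\<open>discrete_series_uniform_derivative\<close>), hence in norm, and \<open>\<pi>(X)\<close> acts on smooth vectors by its explicit
  differential expression. For \<open>s = a / 2\<close>, \<open>u\<close> equal to \<open>\<i>\<close> times the conjugate of \<open>c\<close>, and \<open>d = b - (\<xi> + 2)s\<close>
  the expression for \<open>S\<close> is that of \<open>L\<close>. Then \<open>L \<subseteq> S \<subseteq> M\<close>, and since \<open>M\<close> is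
  the closure of \<open>L\<close>, it is the closure of \<open>S\<close> as well.
\<close>

section \<open>Rotation invariance and radial integrals\<close>

text \<open>
  Both sides agree on boxes. Rotations of the plane are handled in real coordinates, where Fubini
  and affine substitutions are available.
\<close>

lemma lborel_complex_eq:
  "(lborel :: complex measure) = distr (lborel \<Otimes>\<^sub>M lborel) borel (\<lambda>(x, y). Complex x y)"
proof (rule lborel_eqI)
  have [measurable]: "(\<lambda>(x, y). Complex x y) \<in> borel_measurable (lborel \<Otimes>\<^sub>M lborel)"
    unfolding Complex_eq split_beta' by measurable
  fix l u :: complex assume le: "\<And>b. b \<in> Basis \<Longrightarrow> l \<bullet> b \<le> u \<bullet> b"
  have "Re l \<le> Re u" "Im l \<le> Im u" using le[of 1] le[of \<i>] by (auto simp: Basis_complex_def)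
  moreover have "(\<lambda>(x, y). Complex x y) -` box l u = {Re l<..<Re u} \<times> {Im l<..<Im u}"
    by (auto simp: box_def Basis_complex_def)
  ultimately show "emeasure (distr (lborel \<Otimes>\<^sub>M lborel) borel (\<lambda>(x, y). Complex x y)) (box l u)
      = ennreal (\<Prod>b\<in>Basis. (u - l) \<bullet> b)"
    by (simp add: emeasure_distr space_pair_measure lborel.emeasure_pair_measure_Times
        Basis_complex_def ennreal_mult)
qed simp

text \<open>
  For \<open>\<zeta> = p + \<i>q\<close> with \<open>p \<noteq> 0\<close>, the rotation factors into two maps that each change only one
  real coordinate, by an affine map: \<open>y \<mapsto> q x + p y\<close> scales Lebesgue measure by \<open>\<bar>p\<bar>\<close>, and the remaining
  change of \<open>x\<close> scales it by \<open>1 / \<bar>p\<bar>\<close> because \<open>p\<^sup>2 + q\<^sup>2 = 1\<close>. Orthogonality of monomials only uses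
  rotations by small angles, so the purely imaginary \<open>\<zeta>\<close> may be left out.
\<close>

lemma distr_lborel_rotation:
  assumes \<zeta>: "cmod \<zeta> = 1" "Re \<zeta> \<noteq> 0"
  shows "distr lborel borel (\<lambda>z. \<zeta> * z) = lborel"
proof (rule measure_eqI)
  define p q where "p = Re \<zeta>" and "q = Im \<zeta>"
  have pq: "p\<^sup>2 + q\<^sup>2 = 1" and p: "p \<noteq> 0"
    using \<zeta> by (auto simp: p_def q_def cmod_def)
  have [measurable]: "(\<lambda>x. Complex (f x) (g x)) \<in> borel_measurable M"
    if [measurable]: "f \<in> borel_measurable M" "g \<in> borel_measurable M" for f g and M :: "'a measure"
    unfolding Complex_eq by measurable
  have eq: "(\<integral>\<^sup>+z. f (\<zeta> * z) \<partial>lborel) = (\<integral>\<^sup>+z. f z \<partial>lborel)"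
    if [measurable]: "f \<in> borel_measurable borel" for f :: "complex \<Rightarrow> ennreal"
  proof -
    have iter: "(\<integral>\<^sup>+z. g z \<partial>lborel) = (\<integral>\<^sup>+x. \<integral>\<^sup>+y. g (Complex x y) \<partial>lborel \<partial>lborel)"
      if [measurable]: "g \<in> borel_measurable borel" for g :: "complex \<Rightarrow> ennreal"
      by (subst lborel_complex_eq)
        (simp add: nn_integral_distr split_beta' lborel.nn_integral_fst[symmetric])
    have "(\<integral>\<^sup>+z. f (\<zeta> * z) \<partial>lborel)
        = (\<integral>\<^sup>+x. \<integral>\<^sup>+y. f (Complex (p * x - q * y) (q * x + p * y)) \<partial>lborel \<partial>lborel)"
      by (subst iter) (auto intro!: nn_integral_cong arg_cong[where f=f]
          simp: p_def q_def complex_eq_iff algebra_simps)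
    also have "\<dots> = (\<integral>\<^sup>+x. \<integral>\<^sup>+v. ennreal \<bar>1 / p\<bar> * f (Complex (x / p - q / p * v) v) \<partial>lborel \<partial>lborel)"
    proof (rule nn_integral_cong)
      fix x :: real
      have e: "p * x - q * (- q * x / p + 1 / p * v) = x / p - q / p * v" for v
      proof -
        have "p * (p * x - q * (- q * x / p + 1 / p * v)) = (p\<^sup>2 + q\<^sup>2) * x - q * v"
          using p by (simp add: field_simps power2_eq_square)
        also have "\<dots> = p * (x / p - q / p * v)"
          using p by (simp add: pq right_diff_distrib)
        finally show ?thesis using p by simp
      qed
      have e': "q * x + p * (- q * x / p + 1 / p * v) = v" for v
        using p by (simp add: field_simps)
      have "(\<integral>\<^sup>+y. f (Complex (p * x - q * y) (q * x + p * y)) \<partial>lborel)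
        = ennreal \<bar>1 / p\<bar> * (\<integral>\<^sup>+v. f (Complex (x / p - q / p * v) v) \<partial>lborel)"
        using p by (subst nn_integral_real_affine[where c="1/p" and t="- q * x / p"])
          (simp_all only: e e', simp_all)
      then show "(\<integral>\<^sup>+y. f (Complex (p * x - q * y) (q * x + p * y)) \<partial>lborel)
        = (\<integral>\<^sup>+v. ennreal \<bar>1 / p\<bar> * f (Complex (x / p - q / p * v) v) \<partial>lborel)"
        by (simp add: nn_integral_cmult)
    qed
    also have "\<dots> = (\<integral>\<^sup>+v. \<integral>\<^sup>+x. ennreal \<bar>1 / p\<bar> * f (Complex (x / p - q / p * v) v) \<partial>lborel \<partial>lborel)"
      by (rule lborel_pair.Fubini') measurable
    also have "\<dots> = (\<integral>\<^sup>+v. \<integral>\<^sup>+u. f (Complex u v) \<partial>lborel \<partial>lborel)"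
    proof (rule nn_integral_cong)
      fix v :: real
      have e: "- q / p * v + 1 / p * x = x / p - q / p * v" for x
        by simp
      have "(\<integral>\<^sup>+u. f (Complex u v) \<partial>lborel)
        = ennreal \<bar>1 / p\<bar> * (\<integral>\<^sup>+x. f (Complex (x / p - q / p * v) v) \<partial>lborel)"
        using p by (subst nn_integral_real_affine[where c="1/p" and t="- q / p * v"])
          (simp_all only: e, simp_all)
      then show "(\<integral>\<^sup>+x. ennreal \<bar>1 / p\<bar> * f (Complex (x / p - q / p * v) v) \<partial>lborel)
        = (\<integral>\<^sup>+u. f (Complex u v) \<partial>lborel)"
        by (simp add: nn_integral_cmult)
    qed
    also have "\<dots> = (\<integral>\<^sup>+u. \<integral>\<^sup>+v. f (Complex u v) \<partial>lborel \<partial>lborel)"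
      by (rule lborel_pair.Fubini') measurable
    also have "\<dots> = (\<integral>\<^sup>+z. f z \<partial>lborel)"
      by (rule iter[symmetric]) fact
    finally show ?thesis .
  qed
  fix A :: "complex set" assume "A \<in> sets (distr lborel borel (\<lambda>z. \<zeta> * z))"
  then have A[measurable]: "A \<in> sets borel" by simp
  show "emeasure (distr lborel borel (\<lambda>z. \<zeta> * z)) A = emeasure lborel A"
    using eq[of "indicator A"] A by (simp add: nn_integral_distr flip: nn_integral_indicator)
qed simp

text \<open>
  The disc of squared radius \<open>t\<close> has area \<open>\<pi>t\<close>, so under \<open>z \<mapsto> \<bar>z\<bar>\<^sup>2\<close> area on the disc becomes \<open>\<pi>\<close> times
  length on the unit interval. This replaces polar coordinates for radial integrands.
\<close>

lemma distr_norm_square_disc: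
  "distr (restrict_space lborel unit_disc) borel (\<lambda>z. (cmod z)\<^sup>2)
     = density lborel (\<lambda>x. ennreal pi * indicator {0..<1} x)"
proof -
  have m[measurable]: "(\<lambda>z. (cmod z)\<^sup>2) \<in> borel_measurable (restrict_space lborel unit_disc)"
    by (intro borel_measurable_continuous_on_restrict measurable_restrict_space1) auto
  have pi2: "ennreal (pi * x) = ennreal pi * ennreal x" for x
    by (rule ennreal_mult') simp
  have B: "sets (borel :: real measure) = sigma_sets UNIV (range atMost)"
    unfolding borel_eq_atMost by (rule sets_measure_of) simp
  show ?thesis
  proof (rule measure_eqI_generator_eq[where E="range (atMost :: real \<Rightarrow> real set)" and \<Omega>=UNIV
        and A="\<lambda>n. {..real n}"])
    show "Int_stable (range (atMost :: real \<Rightarrow> real set))"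
      by (auto simp: Int_stable_def)
    show "sets (distr (restrict_space lborel unit_disc) borel (\<lambda>z. (cmod z)\<^sup>2))
        = sigma_sets UNIV (range atMost)"
      by (simp only: sets_distr sets_density sets_lborel B)
    show "sets (density lborel (\<lambda>x::real. ennreal pi * indicator {0..<1} x))
        = sigma_sets UNIV (range atMost)"
      by (simp only: sets_distr sets_density sets_lborel B)
    show "(\<Union>i::nat. {..real i}) = UNIV"
      using real_arch_simple by auto
    have D: "emeasure (distr (restrict_space lborel unit_disc) borel (\<lambda>z. (cmod z)\<^sup>2)) {..t}
      = emeasure lborel ({z. (cmod z)\<^sup>2 \<le> t} \<inter> unit_disc)" for t
    proof -
      have "(\<lambda>z. (cmod z)\<^sup>2) -` {..t} \<inter> space (restrict_space lborel unit_disc)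
        = {z. (cmod z)\<^sup>2 \<le> t} \<inter> unit_disc"
        by (auto simp: space_restrict_space)
      then show ?thesis
        by (subst emeasure_distr) (auto simp: emeasure_restrict_space)
    qed
    have R: "emeasure (density lborel (\<lambda>x. ennreal pi * indicator {0..<1} x)) {..t}
      = ennreal pi * emeasure lborel ({0..<1} \<inter> {..t})" for t :: real
      by (simp add: emeasure_density mult.assoc nn_integral_cmult_indicator
          flip: indicator_inter_arith)
    show "emeasure (distr (restrict_space lborel unit_disc) borel (\<lambda>z. (cmod z)\<^sup>2)) X
      = emeasure (density lborel (\<lambda>x. ennreal pi * indicator {0..<1} x)) X"
      if X_in: "X \<in> range atMost" for X
    proof -
      obtain t where X: "X = {..t}" using X_in by auto
      consider "t < 0" | "0 \<le> t" "t < 1" | "1 \<le> t" by linarith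
      then show ?thesis
      proof cases
        case 1
        then have "{z. (cmod z)\<^sup>2 \<le> t} \<inter> unit_disc = {}" "{0..<1} \<inter> {..t} = {}"
          by (auto dest: order_trans[OF zero_le_power2])
        then show ?thesis by (simp add: X D R)
      next
        case 2
        have le: "(cmod z)\<^sup>2 \<le> t \<longleftrightarrow> cmod z \<le> sqrt t" for z
          by (metis abs_norm_cancel real_sqrt_abs real_sqrt_le_iff)
        have lt: "sqrt t < 1" using 2 by simp
        have "{z. (cmod z)\<^sup>2 \<le> t} \<inter> unit_disc = cball 0 (sqrt t)"
          by (rule set_eqI, simp only: Int_iff mem_Collect_eq mem_ball_0 mem_cball_0 le)
            (use lt in linarith)
        moreover have "{0..<1} \<inter> {..t} = {0..t}" using 2 by auto
        ultimately show ?thesis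
          using 2 by (simp add: X D R emeasure_cball unit_ball_vol_2 pi2)
      next
        case 3
        have "(cmod z)\<^sup>2 \<le> t" if "z \<in> unit_disc" for z
          using 3 that power_le_one[of "cmod z" 2] by simp
        then have "{z. (cmod z)\<^sup>2 \<le> t} \<inter> unit_disc = unit_disc"
          by blast
        moreover have "{0..<1} \<inter> {..t} = {0..<1}" using 3 by auto
        ultimately show ?thesis
          using 3 by (simp add: X D R emeasure_ball unit_ball_vol_2)
      qed
    qed
    show "emeasure (distr (restrict_space lborel unit_disc) borel (\<lambda>z. (cmod z)\<^sup>2)) {..real i} \<noteq> \<infinity>" for i
    proof -
      have "emeasure lborel ({z. (cmod z)\<^sup>2 \<le> real i} \<inter> unit_disc) \<le> emeasure lborel (unit_disc)"
        by (intro emeasure_mono) auto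
      also have "\<dots> < \<infinity>" by (simp add: emeasure_ball)
      finally show ?thesis by (simp add: D)
    qed
  qed auto
qed

section \<open>Norms and orthogonality of the monomials\<close>

text \<open>
  This is \<open>\<parallel>z\<^sup>k\<parallel>\<^sup>2\<close>; the Beta function is what the radial integral evaluates to.
\<close>

definition weight :: "real \<Rightarrow> nat \<Rightarrow> real" where
  "weight \<xi> k = (\<xi> + 1) * Beta (real k + 1) (\<xi> + 1)"

lemma weight_pos:
  assumes "\<xi> > -1"
  shows "weight \<xi> k > 0"
  using assms by (simp add: weight_def Beta_def Gamma_real_pos)

text \<open>
  This recursion is the only property of the weights that makes the differential operator symmetric.
\<close>

lemma weight_Suc:
  assumes "\<xi> > -1"
  shows "(real k + \<xi> + 2) * weight \<xi> (Suc k) = (real k + 1) * weight \<xi> k"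
proof -
  have "real k + 1 \<notin> \<int>\<^sub>\<le>\<^sub>0"
    by (auto dest: nonpos_Ints_nonpos)
  from Beta_plus1_left[OF this, of "\<xi> + 1"] show ?thesis
    by (simp add: weight_def algebra_simps)
qed

lemma measurable_disc_weight [measurable]:
  "(\<lambda>z. (\<xi> + 1) / pi * (1 - (cmod z)\<^sup>2) powr \<xi>) \<in> borel_measurable borel"
  by measurable

lemma sets_disc_measure [simp, measurable_cong]:
  "sets (disc_measure \<xi>) = sets (restrict_space borel unit_disc)"
  by (simp add: disc_measure_def sets_restrict_space_cong[OF sets_lborel])

lemma space_disc_measure [simp]: "space (disc_measure \<xi>) = unit_disc"
  by (simp add: disc_measure_def space_restrict_space)

lemma borel_measurable_disc_measure:
  "f \<in> borel_measurable borel \<Longrightarrow> f \<in> borel_measurable (disc_measure \<xi>)"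
  unfolding measurable_cong_sets[OF sets_disc_measure refl]
  by (rule measurable_restrict_space1)

lemma nn_integral_disc_measure_norm:
  assumes "\<xi> > -1" and [measurable]: "h \<in> borel_measurable borel"
  shows "(\<integral>\<^sup>+z. h ((cmod z)\<^sup>2) \<partial>disc_measure \<xi>)
    = (\<integral>\<^sup>+s. ennreal ((\<xi> + 1) * (1 - s) powr \<xi>) * h s * indicator {0<..<1} s \<partial>lborel)"
proof -
  have m[measurable]: "(\<lambda>z. (cmod z)\<^sup>2) \<in> borel_measurable (restrict_space lborel unit_disc)"
    by (intro borel_measurable_continuous_on_restrict measurable_restrict_space1) auto
  have [measurable]: "(\<lambda>z. ennreal ((\<xi> + 1) / pi * (1 - (cmod z)\<^sup>2) powr \<xi>))
      \<in> borel_measurable (restrict_space lborel unit_disc)"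
    by (rule measurable_restrict_space1) measurable
  have "(\<integral>\<^sup>+z. h ((cmod z)\<^sup>2) \<partial>disc_measure \<xi>)
     = (\<integral>\<^sup>+z. ennreal ((\<xi> + 1) / pi * (1 - (cmod z)\<^sup>2) powr \<xi>) * h ((cmod z)\<^sup>2)
          \<partial>restrict_space lborel unit_disc)"
    unfolding disc_measure_def by (subst nn_integral_density) auto
  also have "\<dots> = (\<integral>\<^sup>+s. ennreal ((\<xi> + 1) / pi * (1 - s) powr \<xi>) * h s
          \<partial>distr (restrict_space lborel unit_disc) borel (\<lambda>z. (cmod z)\<^sup>2))"
    by (subst nn_integral_distr) auto
  also have "\<dots> = (\<integral>\<^sup>+s. ennreal pi * indicator {0..<1} s *
          (ennreal ((\<xi> + 1) / pi * (1 - s) powr \<xi>) * h s) \<partial>lborel)"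
    unfolding distr_norm_square_disc by (subst nn_integral_density) auto
  also have "\<dots> = (\<integral>\<^sup>+s. ennreal ((\<xi> + 1) * (1 - s) powr \<xi>) * h s * indicator {0<..<1} s \<partial>lborel)"
  proof (rule nn_integral_cong_AE)
    have e: "ennreal pi * ennreal ((\<xi> + 1) * x powr \<xi> / pi) = ennreal ((\<xi> + 1) * x powr \<xi>)" for x
      by (subst ennreal_mult'[symmetric]) auto
    have "AE s in lborel. s \<noteq> (0 :: real)"
      by (rule AE_lborel_singleton)
    then show "AE s in lborel. ennreal pi * indicator {0..<1} s *
          (ennreal ((\<xi> + 1) / pi * (1 - s) powr \<xi>) * h s)
        = ennreal ((\<xi> + 1) * (1 - s) powr \<xi>) * h s * indicator {0<..<1} s"
      by eventually_elim (auto simp: indicator_def mult.assoc[symmetric] e)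
  qed
  finally show ?thesis .
qed

text \<open>
  With \<open>s = \<bar>z\<bar>\<^sup>2\<close> the integral becomes Euler's integral
  \<open>(\<xi> + 1) \<integral> s\<^sup>k (1 - s)\<^sup>\<xi> ds\<close>. The open interval avoids the value \<open>0 powr 0 = 0\<close> at the end point.
\<close>

lemma nn_integral_norm_power:
  assumes "\<xi> > -1"
  shows "(\<integral>\<^sup>+z. ennreal ((cmod z) ^ (2 * k)) \<partial>disc_measure \<xi>) = ennreal (weight \<xi> k)"
proof -
  have "((\<lambda>t. t powr real k * (1 - t) powr \<xi>) has_integral Beta (real k + 1) (\<xi> + 1)) {0<..<1}"
    using has_integral_Beta_real[of "real k + 1" "\<xi> + 1"] assms
    by (simp add: has_integral_Icc_iff_Ioo)
  then have "((\<lambda>t. (\<xi> + 1) * (t powr real k * (1 - t) powr \<xi>)) has_integral weight \<xi> k) {0<..<1}"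
    unfolding weight_def by (rule has_integral_mult_right)
  then have "(\<integral>\<^sup>+s. ennreal (indicator {0<..<1} s * ((\<xi> + 1) * (s powr real k * (1 - s) powr \<xi>))) \<partial>lborel)
      = ennreal (weight \<xi> k)"
    using assms by (intro nn_integral_has_integral_lebesgue) auto
  moreover have "(\<integral>\<^sup>+z. ennreal ((cmod z) ^ (2 * k)) \<partial>disc_measure \<xi>)
      = (\<integral>\<^sup>+z. ennreal (((cmod z)\<^sup>2) ^ k) \<partial>disc_measure \<xi>)"
    by (simp add: power_mult)
  moreover have "(\<integral>\<^sup>+z. ennreal (((cmod z)\<^sup>2) ^ k) \<partial>disc_measure \<xi>)
      = (\<integral>\<^sup>+s. ennreal ((\<xi> + 1) * (1 - s) powr \<xi>) * ennreal (s ^ k) * indicator {0<..<1} s \<partial>lborel)"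
    using assms by (intro nn_integral_disc_measure_norm[where h="\<lambda>s. ennreal (s ^ k)"]) auto
  moreover have "ennreal ((\<xi> + 1) * (1 - s) powr \<xi>) * ennreal (s ^ k) * indicator {0<..<1} s
      = ennreal (indicator {0<..<1} s * ((\<xi> + 1) * (s powr real k * (1 - s) powr \<xi>)))" for s
    using assms by (cases "s \<in> {0<..<1}") (auto simp: powr_realpow ennreal_mult[symmetric] mult_ac)
  ultimately show ?thesis by simp
qed

lemma emeasure_disc_measure:
  assumes "\<xi> > -1"
  shows "emeasure (disc_measure \<xi>) unit_disc = ennreal (weight \<xi> 0)"
  using nn_integral_norm_power[OF assms, of 0]  by simp

lemma finite_measure_disc_measure:
  assumes "\<xi> > -1"
  shows "finite_measure (disc_measure \<xi>)"
  by (rule finite_measureI) (simp add: emeasure_disc_measure[OF assms])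

lemma integrable_disc_measure_bounded:
  fixes f :: "complex \<Rightarrow> 'a :: {banach, second_countable_topology}"
  assumes "\<xi> > -1" "f \<in> borel_measurable borel" "\<And>z. z \<in> unit_disc \<Longrightarrow> norm (f z) \<le> C"
  shows "integrable (disc_measure \<xi>) f"
proof -
  interpret finite_measure "disc_measure \<xi>" by (rule finite_measure_disc_measure) fact
  show ?thesis
    using assms by (intro integrable_const_bound[where B=C] borel_measurable_disc_measure AE_I2) auto
qed

lemma integrable_disc_measure_bounded_ball:
  fixes h :: "complex \<Rightarrow> 'a :: {banach, second_countable_topology}"
  assumes "\<xi> > -1" and [measurable]: "h \<in> borel_measurable borel"
    and h: "\<And>z. cmod z < R \<Longrightarrow> norm (h z) \<le> C"
  shows "integrable (disc_measure \<xi>) (\<lambda>z. indicator (ball 0 R) z *\<^sub>R h z)"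
proof -
  have "norm (indicator (ball 0 R) z *\<^sub>R h z) \<le> max 0 C" for z
    using h[of z] by (cases "cmod z < R") (auto intro: max.coboundedI2)
  then show ?thesis
    using assms(1) by (intro integrable_disc_measure_bounded[where C="max 0 C"]
      borel_measurable_scaleR borel_measurable_indicator) auto
qed

lemma integral_disc_measure:
  fixes g :: "complex \<Rightarrow> 'a :: {banach, second_countable_topology}"
  assumes "\<xi> > -1" and [measurable]: "g \<in> borel_measurable borel"
  shows "(LINT z|disc_measure \<xi>. g z)
    = (LINT z|lborel. indicator unit_disc z *\<^sub>R (((\<xi> + 1) / pi * (1 - (cmod z)\<^sup>2) powr \<xi>) *\<^sub>R g z))"
proof -
  have "(LINT z|disc_measure \<xi>. g z) = (LINT z|restrict_space lborel unit_disc.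
      ((\<xi> + 1) / pi * (1 - (cmod z)\<^sup>2) powr \<xi>) *\<^sub>R g z)"
    unfolding disc_measure_def using assms(1)
    by (subst integral_density) (auto intro!: measurable_restrict_space1)
  also have "\<dots> = (LINT z|lborel. indicator unit_disc z *\<^sub>R (((\<xi> + 1) / pi * (1 - (cmod z)\<^sup>2) powr \<xi>) *\<^sub>R g z))"
    by (subst integral_restrict_space) auto
  finally show ?thesis .
qed

lemma integral_disc_measure_rotation:
  fixes g :: "complex \<Rightarrow> 'a :: {banach, second_countable_topology}"
  assumes "\<xi> > -1" and [measurable]: "g \<in> borel_measurable borel" and "cmod \<zeta> = 1" "Re \<zeta> \<noteq> 0"
  shows "(LINT z|disc_measure \<xi>. g (\<zeta> * z)) = (LINT z|disc_measure \<xi>. g z)"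
proof -
  define F where "F z = indicator unit_disc z *\<^sub>R (((\<xi> + 1) / pi * (1 - (cmod z)\<^sup>2) powr \<xi>) *\<^sub>R g z)" for z
  have [measurable]: "F \<in> borel_measurable borel"
    unfolding F_def by (intro borel_measurable_scaleR measurable_disc_weight assms(2)
        borel_measurable_indicator) auto
  have "(LINT z|disc_measure \<xi>. g (\<zeta> * z)) = (LINT z|lborel. F (\<zeta> * z))"
    using assms by (subst integral_disc_measure) (auto simp: F_def norm_mult indicator_def)
  also have "\<dots> = (LINT z|distr lborel borel (\<lambda>z. \<zeta> * z). F z)"
    by (subst integral_distr) auto
  also have "\<dots> = (LINT z|lborel. F z)"
    using assms by (subst distr_lborel_rotation) auto
  also have "\<dots> = (LINT z|disc_measure \<xi>. g z)"
    unfolding F_def using assms by (intro integral_disc_measure[symmetric])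
  finally show ?thesis .
qed

text \<open>
  The integral is multiplied by \<open>\<zeta>\<^sup>j\<^sup>-\<^sup>k\<close> under the rotation by \<open>\<zeta>\<close>, so it vanishes as soon as this
  factor is not 1.
\<close>

lemma monomials_orthogonal_ball:
  assumes "\<xi> > -1" "j \<noteq> k"
  shows "(LINT z|disc_measure \<xi>. indicator (ball 0 R) z *\<^sub>R (z ^ j * cnj (z ^ k))) = 0"
proof -
  \<comment> \<open>with this angle the factor is \<open>cis 1\<close>, and \<open>\<bar>\<theta>\<bar> \<le> 1 < \<pi>/2\<close> keeps the real part of \<open>\<zeta>\<close> positive\<close>
  define \<theta> where "\<theta> = 1 / (real j - real k)"
  define \<zeta> where "\<zeta> = cis \<theta>"
  have "\<bar>\<theta>\<bar> \<le> 1"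
    using assms(2) by (auto simp: \<theta>_def divide_le_eq_1 abs_le_iff)
  then have "cos \<theta> > 0"
    using pi_gt3 by (intro cos_gt_zero_pi) auto
  moreover have "\<zeta> ^ j * cnj (\<zeta> ^ k) = cis 1"
    using assms(2) by (simp add: \<zeta>_def Complex.DeMoivre cis_cnj cis_mult \<theta>_def diff_divide_distrib[symmetric])
  moreover have "cis 1 \<noteq> 1"
    using cos_monotone_0_pi[of 0 1] pi_gt3 by (auto simp: complex_eq_iff)
  ultimately have \<zeta>: "cmod \<zeta> = 1" "Re \<zeta> \<noteq> 0" "\<zeta> ^ j * cnj (\<zeta> ^ k) \<noteq> 1"
    by (auto simp: \<zeta>_def)
  define G where "G z = indicator (ball 0 R) z *\<^sub>R (z ^ j * cnj (z ^ k))" for z :: complex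
  have [measurable]: "G \<in> borel_measurable borel"
    unfolding G_def by (intro borel_measurable_scaleR borel_measurable_indicator
        borel_measurable_continuous_onI continuous_intros) auto
  have "(LINT z|disc_measure \<xi>. G z) = (LINT z|disc_measure \<xi>. G (\<zeta> * z))"
    using integral_disc_measure_rotation[of \<xi> G \<zeta>] assms(1) \<zeta> by simp
  also have "(\<lambda>z. G (\<zeta> * z)) = (\<lambda>z. (\<zeta> ^ j * cnj (\<zeta> ^ k)) * G z)"
    using \<zeta>(1) by (auto simp: G_def indicator_def norm_mult power_mult_distrib)
  also have "(LINT z|disc_measure \<xi>. (\<zeta> ^ j * cnj (\<zeta> ^ k)) * G z) = (\<zeta> ^ j * cnj (\<zeta> ^ k)) * (LINT z|disc_measure \<xi>. G z)"
    by simp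
  finally have "(1 - \<zeta> ^ j * cnj (\<zeta> ^ k)) * (LINT z|disc_measure \<xi>. G z) = 0"
    by (simp add: algebra_simps)
  then show ?thesis using \<zeta>(3) by (simp add: G_def)
qed

text \<open>
  On a ball of radius \<open>R < 1\<close> the partial sums of the Taylor series are bounded by
  \<open>\<Sum> \<bar>a\<^sub>k\<bar> R\<^sup>k\<close>, so the finite Pythagorean identity passes to the limit by dominated convergence.
\<close>

lemma parseval_ball:
  assumes "\<xi> > -1" "R < 1" and f: "\<And>z. z \<in> unit_disc \<Longrightarrow> (\<lambda>k. a k * z ^ k) sums f z"
    and fm[measurable]: "f \<in> borel_measurable borel"
  shows "(\<integral>\<^sup>+z. indicator (ball 0 R) z * ennreal ((cmod (f z))\<^sup>2) \<partial>disc_measure \<xi>)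
    = (\<Sum>k. ennreal ((cmod (a k))\<^sup>2) * (\<integral>\<^sup>+z. indicator (ball 0 R) z * ennreal ((cmod z) ^ (2 * k)) \<partial>disc_measure \<xi>))"
proof (cases "R > 0")
  case True
  define s where "s N z = (\<Sum>k<N. a k * z ^ k)" for N z
  define w where "w k = (LINT z|disc_measure \<xi>. indicator (ball 0 R) z *\<^sub>R (cmod z) ^ (2 * k))" for k
  note ib = integrable_disc_measure_bounded_ball[OF assms(1), where R=R]
  have le1: "cmod z ^ n \<le> 1" if "cmod z < R" for z n
    using that assms(2) by (intro power_le_one) auto
  have [measurable]: "(\<lambda>z. z ^ j * cnj (z ^ k)) \<in> borel_measurable borel" for j k
    by (intro borel_measurable_continuous_onI continuous_intros)
  have int: "integrable (disc_measure \<xi>) (\<lambda>z. c * (indicator (ball 0 R) z *\<^sub>R (z ^ j * cnj (z ^ k))))"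
    for c j k
    by (intro integrable_mult_right ib[where C=1])
      (simp_all add: norm_mult norm_power le1 mult_le_one del: complex_cnj_power)
  have wn: "(\<integral>\<^sup>+z. indicator (ball 0 R) z * ennreal ((cmod z) ^ (2 * k)) \<partial>disc_measure \<xi>) = ennreal (w k)" for k
  proof -
    have "(\<integral>\<^sup>+z. ennreal (indicator (ball 0 R) z *\<^sub>R (cmod z) ^ (2 * k)) \<partial>disc_measure \<xi>) = ennreal (w k)"
      unfolding w_def by (intro nn_integral_eq_integral ib[where C=1]) (auto simp: le1 norm_power)
    then show ?thesis by (simp add: ennreal_mult ennreal_indicator)
  qed
  have w0: "w k \<ge> 0" for k unfolding w_def by (intro integral_nonneg_AE AE_I2) auto
  have sm: "summable (\<lambda>k. norm (a k) * R ^ k)"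
  proof -
    obtain r where r: "R < r" "r < 1" using assms(2) dense by blast
    have "summable (\<lambda>k. a k * of_real r ^ k)"
      using f[of "of_real r"] r True by (auto simp: sums_iff)
    then have "summable (\<lambda>k. norm (a k * of_real R ^ k))"
      by (rule powser_insidea) (use r True in auto)
    then show ?thesis using True by (simp add: norm_mult norm_power)
  qed
  define C where "C = (\<Sum>k. norm (a k) * R ^ k)"
  have sC: "norm (s N z) \<le> C" if "cmod z < R" for N z
  proof -
    have "norm (s N z) \<le> (\<Sum>k<N. norm (a k) * R ^ k)"
      unfolding s_def using that
      by (intro sum_norm_le) (auto simp: norm_mult norm_power intro!: mult_left_mono power_mono)
    also have "\<dots> \<le> C"
      unfolding C_def using True by (intro sum_le_suminf sm) auto
    finally show ?thesis .
  qed
  have [measurable]: "s N \<in> borel_measurable borel" for N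
    unfolding s_def by (intro borel_measurable_continuous_onI continuous_intros)
  have fin: "(LINT z|disc_measure \<xi>. indicator (ball 0 R) z *\<^sub>R (cmod (s N z))\<^sup>2) = (\<Sum>k<N. (cmod (a k))\<^sup>2 * w k)" for N
  proof -
    have "complex_of_real (LINT z|disc_measure \<xi>. indicator (ball 0 R) z *\<^sub>R (cmod (s N z))\<^sup>2)
      = (LINT z|disc_measure \<xi>. complex_of_real (indicator (ball 0 R) z *\<^sub>R (cmod (s N z))\<^sup>2))"
      by (rule integral_complex_of_real[symmetric])
    also have "\<dots> = (LINT z|disc_measure \<xi>. (\<Sum>j<N. \<Sum>k<N. a j * cnj (a k) *
         (indicator (ball 0 R) z *\<^sub>R (z ^ j * cnj (z ^ k)))))"
      by (intro Bochner_Integration.integral_cong refl)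
        (auto simp: complex_norm_square s_def sum_product indicator_def mult_ac cnj_sum simp flip: of_real_power)
    also have "\<dots> = (\<Sum>j<N. \<Sum>k<N. a j * cnj (a k) *
         (LINT z|disc_measure \<xi>. (indicator (ball 0 R) z *\<^sub>R (z ^ j * cnj (z ^ k)))))"
      by (simp only: Bochner_Integration.integral_sum Bochner_Integration.integrable_sum int
          integral_mult_right_zero)
    also have "\<dots> = (\<Sum>j<N. \<Sum>k<N. if j = k then a j * cnj (a k) * of_real (w k) else 0)"
    proof (intro sum.cong refl)
      fix j k
      have sq: "z ^ k * cnj (z ^ k) = complex_of_real ((cmod z) ^ (2 * k))" for z
        by (simp only: power_mult of_real_power[of "(cmod z)\<^sup>2" k] complex_norm_square power_mult_distrib
            complex_cnj_power)
      have "(LINT z|disc_measure \<xi>. (indicator (ball 0 R) z *\<^sub>R (z ^ k * cnj (z ^ k)))) = of_real (w k)"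
        unfolding w_def integral_complex_of_real[symmetric]
        by (intro Bochner_Integration.integral_cong refl) (simp only: sq scaleR_conv_of_real of_real_mult of_real_eq_id id_apply)
      then show "a j * cnj (a k) * (LINT z|disc_measure \<xi>. (indicator (ball 0 R) z *\<^sub>R (z ^ j * cnj (z ^ k))))
         = (if j = k then a j * cnj (a k) * of_real (w k) else 0)"
        using monomials_orthogonal_ball[OF assms(1), of j k R] by auto
    qed
    also have "\<dots> = complex_of_real (\<Sum>k<N. (cmod (a k))\<^sup>2 * w k)"
      by (simp add: complex_norm_square del: of_real_power flip: of_real_power)
    finally show ?thesis by (simp only: of_real_eq_iff)
  qed
  have "(\<lambda>N. LINT z|disc_measure \<xi>. indicator (ball 0 R) z *\<^sub>R (cmod (s N z))\<^sup>2)
    \<longlonglongrightarrow> (LINT z|disc_measure \<xi>. indicator (ball 0 R) z *\<^sub>R (cmod (f z))\<^sup>2)"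
  proof (rule integral_dominated_convergence[where w="\<lambda>z. indicator (ball 0 R) z *\<^sub>R C\<^sup>2"])
    show "AE z in disc_measure \<xi>. (\<lambda>N. indicator (ball 0 R) z *\<^sub>R (cmod (s N z))\<^sup>2)
        \<longlonglongrightarrow> indicator (ball 0 R) z *\<^sub>R (cmod (f z))\<^sup>2"
      using f by (intro AE_I2 tendsto_intros) (auto simp: sums_def s_def)
    show "AE z in disc_measure \<xi>. norm (indicator (ball 0 R) z *\<^sub>R (cmod (s N z))\<^sup>2) \<le> indicator (ball 0 R) z *\<^sub>R C\<^sup>2" for N
      using sC[of _ N] by (intro AE_I2) (auto simp: indicator_def intro!: power_mono)
    show "integrable (disc_measure \<xi>) (\<lambda>z. indicator (ball 0 R) z *\<^sub>R C\<^sup>2)"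
      by (rule ib[where C="C\<^sup>2"]) auto
    show "(\<lambda>z. indicator (ball 0 R) z *\<^sub>R (cmod (f z))\<^sup>2) \<in> borel_measurable (disc_measure \<xi>)"
      "(\<lambda>z. indicator (ball 0 R) z *\<^sub>R (cmod (s N z))\<^sup>2) \<in> borel_measurable (disc_measure \<xi>)" for N
      by (intro borel_measurable_disc_measure borel_measurable_scaleR borel_measurable_indicator; simp)+
  qed
  then have sums: "(\<lambda>k. (cmod (a k))\<^sup>2 * w k) sums (LINT z|disc_measure \<xi>. indicator (ball 0 R) z *\<^sub>R (cmod (f z))\<^sup>2)"
    unfolding fin sums_def .
  have fC: "norm (f z) \<le> C" if "cmod z < R" for z
  proof (rule LIMSEQ_le_const2)
    show "(\<lambda>N. norm (s N z)) \<longlonglongrightarrow> norm (f z)"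
      using f[of z] that assms(2) by (intro tendsto_norm) (auto simp: sums_def s_def)
  qed (use sC[OF that] in auto)
  have "(\<integral>\<^sup>+z. ennreal (indicator (ball 0 R) z *\<^sub>R (cmod (f z))\<^sup>2) \<partial>disc_measure \<xi>)
     = ennreal (LINT z|disc_measure \<xi>. indicator (ball 0 R) z *\<^sub>R (cmod (f z))\<^sup>2)"
    by (intro nn_integral_eq_integral ib[where C="C\<^sup>2"]) (auto intro!: power_mono fC)
  also have "\<dots> = (\<Sum>k. ennreal ((cmod (a k))\<^sup>2 * w k))"
    using sums w0 by (simp add: suminf_ennreal2 sums_iff)
  finally show ?thesis
    by (simp add: wn ennreal_mult w0 ennreal_indicator)
next
  case False
  then have "ball 0 R = ({} :: complex set)" by simp
  then show ?thesis unfolding \<open>ball 0 R = {}\<close> by simp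
qed

text \<open>
  Monotone convergence as \<open>R\<close> tends to 1. Stating it in the extended nonnegative reals makes it
  decide membership in the Bergman space and compute the norm at the same time.
\<close>

lemma parseval:
  assumes "\<xi> > -1" and f: "\<And>z. z \<in> unit_disc \<Longrightarrow> (\<lambda>k. a k * z ^ k) sums f z"
    and fm[measurable]: "f \<in> borel_measurable borel"
  shows "(\<integral>\<^sup>+z. ennreal ((cmod (f z))\<^sup>2) \<partial>disc_measure \<xi>) = (\<Sum>k. ennreal ((cmod (a k))\<^sup>2 * weight \<xi> k))"
proof -
  define R where "R n = 1 - 1 / real (Suc n)" for n
  have R1: "R n < 1" for n by (simp add: R_def)
  have inc: "incseq (\<lambda>n z. indicator (ball 0 (R n)) z * g z)" for g :: "complex \<Rightarrow> ennreal"
    by (auto simp: incseq_def le_fun_def R_def indicator_def frac_le intro: less_le_trans)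
  have ex: "(\<integral>\<^sup>+z. g z \<partial>disc_measure \<xi>) = (SUP n. \<integral>\<^sup>+z. indicator (ball 0 (R n)) z * g z \<partial>disc_measure \<xi>)"
    if [measurable]: "g \<in> borel_measurable borel" for g :: "complex \<Rightarrow> ennreal"
  proof -
    have "(SUP n. indicator (ball 0 (R n)) z * g z) = g z" if z: "z \<in> unit_disc" for z
    proof (rule antisym)
      show "(SUP n. indicator (ball 0 (R n)) z * g z) \<le> g z"
        by (auto intro!: SUP_least simp: indicator_def)
      obtain n where "1 / real (Suc n) < 1 - cmod z"
        using nat_approx_posE[of "1 - cmod z"] z by auto
      then have "g z = indicator (ball 0 (R n)) z * g z" by (auto simp: R_def)
      then show "g z \<le> (SUP n. indicator (ball 0 (R n)) z * g z)"
        by (metis (no_types, lifting) SUP_upper UNIV_I)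
    qed
    then have "(\<integral>\<^sup>+z. g z \<partial>disc_measure \<xi>) = (\<integral>\<^sup>+z. (SUP n. indicator (ball 0 (R n)) z * g z) \<partial>disc_measure \<xi>)"
      by (intro nn_integral_cong) simp
    also have "\<dots> = (SUP n. \<integral>\<^sup>+z. indicator (ball 0 (R n)) z * g z \<partial>disc_measure \<xi>)"
      by (rule nn_integral_monotone_convergence_SUP[OF inc])
       (auto intro!: borel_measurable_disc_measure borel_measurable_times_ennreal borel_measurable_indicator)
    finally show ?thesis .
  qed
  have "(\<integral>\<^sup>+z. ennreal ((cmod (f z))\<^sup>2) \<partial>disc_measure \<xi>)
    = (SUP n. \<Sum>k. ennreal ((cmod (a k))\<^sup>2) *
         (\<integral>\<^sup>+z. indicator (ball 0 (R n)) z * ennreal ((cmod z) ^ (2 * k)) \<partial>disc_measure \<xi>))"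
    by (subst ex, measurable) (intro SUP_cong refl parseval_ball assms R1 f)
  also have "\<dots> = (\<Sum>k. SUP n. ennreal ((cmod (a k))\<^sup>2) *
         (\<integral>\<^sup>+z. indicator (ball 0 (R n)) z * ennreal ((cmod z) ^ (2 * k)) \<partial>disc_measure \<xi>))"
    by (intro ennreal_suminf_SUP_eq[symmetric] incseq_SucI mult_left_mono nn_integral_mono)
      (auto intro: le_funD[OF incseq_SucD[OF inc]])
  also have "\<dots> = (\<Sum>k. ennreal ((cmod (a k))\<^sup>2 * weight \<xi> k))"
    by (intro suminf_cong)
      (simp add: SUP_mult_left_ennreal[symmetric] ex[symmetric] nn_integral_norm_power[OF assms(1)]
         ennreal_mult weight_pos[OF assms(1)] less_imp_le)
  finally show ?thesis .
qed

section \<open>The Bergman space as a weighted sequence space\<close>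

definition taylor :: "(complex \<Rightarrow> complex) \<Rightarrow> nat \<Rightarrow> complex" where
  "taylor f k = (deriv ^^ k) f 0 / fact k"

lemma taylor_sums:
  assumes "f \<in> hol_disc" "z \<in> unit_disc"
  shows "(\<lambda>k. taylor f k * z ^ k) sums f z"
  using holomorphic_power_series[of f 0 1 z] assms by (auto simp: hol_disc_def taylor_def)

lemma hol_disc_eqI:
  assumes "f \<in> hol_disc" "g \<in> hol_disc" "\<And>k. taylor f k = taylor g k"
  shows "f = g"
proof
  fix z show "f z = g z"
  proof (cases "z \<in> unit_disc")
    case True
    then show ?thesis
      using taylor_sums[of f z] taylor_sums[of g z] assms sums_unique2 by auto
  next
    case False
    then show ?thesis using assms by (auto simp: hol_disc_def)
  qed
qed

lemma hol_disc_of_sums: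
  assumes "\<And>z. z \<in> unit_disc \<Longrightarrow> (\<lambda>k. a k * z ^ k) sums f z" "\<And>z. z \<notin> unit_disc \<Longrightarrow> f z = 0"
  shows "f \<in> hol_disc"
  using power_series_holomorphic[of 0 1 a f] assms by (auto simp: hol_disc_def)

text \<open>
  The difference of two expansions of the same function is a power series with sum zero, and a power series
  with a nonzero coefficient has isolated zeros.
\<close>

lemma taylor_unique:
  assumes sums: "\<And>z. z \<in> unit_disc \<Longrightarrow> (\<lambda>k. a k * z ^ k) sums f z" and "f \<in> hol_disc"
  shows "taylor f k = a k"
proof -
  define b where "b k = taylor f k - a k" for k
  have b: "(\<lambda>k. b k * (z - 0) ^ k) sums (\<lambda>_. 0) z" if "norm (z - 0) < 1" for z
    using sums_diff[OF taylor_sums[OF assms(2), of z] sums[of z]] that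
    by (simp add: b_def left_diff_distrib)
  have "b k = 0"
  proof (cases "k = 0")
    case True
    then show ?thesis using b[of 0] by simp
  next
    case False
    show ?thesis
    proof (rule ccontr)
      assume "b k \<noteq> 0"
      show False
      proof (rule powser_0_nonzero[of 1 0 b "\<lambda>_. 0" k])
        show "(\<lambda>n. b n * (z - 0) ^ n) sums 0" if "norm (z - 0) < 1" for z
          by (rule b) fact
        fix s :: real
        assume "0 < s" and nz: "\<And>z. z \<in> cball 0 s - {0 :: complex} \<Longrightarrow> (0 :: complex) \<noteq> 0"
        then show False using nz[of "of_real s"] by simp
      qed (use False \<open>b k \<noteq> 0\<close> in simp_all)
    qed
  qed
  then show ?thesis by (simp add: b_def)
qed

lemma hol_disc_lincomb:
  assumes "f \<in> hol_disc" "g \<in> hol_disc"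
  shows "(\<lambda>z. \<alpha> * f z + \<beta> * g z) \<in> hol_disc"
  using assms by (auto simp: hol_disc_def intro!: holomorphic_intros)

lemma taylor_lincomb:
  assumes "f \<in> hol_disc" "g \<in> hol_disc"
  shows "taylor (\<lambda>z. \<alpha> * f z + \<beta> * g z) k = \<alpha> * taylor f k + \<beta> * taylor g k"
proof (rule taylor_unique[OF _ hol_disc_lincomb[OF assms]])
  fix z assume "z \<in> unit_disc"
  from sums_add[OF sums_mult[OF taylor_sums[OF assms(1) this], of \<alpha>] sums_mult[OF taylor_sums[OF assms(2) this], of \<beta>]]
  show "(\<lambda>k. (\<alpha> * taylor f k + \<beta> * taylor g k) * z ^ k) sums (\<alpha> * f z + \<beta> * g z)"
    by (simp add: algebra_simps)
qed

lemma borel_measurable_hol_disc: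
  assumes "f \<in> hol_disc"
  shows "f \<in> borel_measurable borel"
proof -
  have "f = (\<lambda>z. indicator unit_disc z *\<^sub>R f z)"
    using assms by (auto simp: hol_disc_def indicator_def)
  moreover have "continuous_on unit_disc f"
    using assms by (auto simp: hol_disc_def intro: holomorphic_on_imp_continuous_on)
  ultimately show ?thesis
    using borel_measurable_continuous_on_indicator[of unit_disc f] by simp
qed

lemma bergman_hol_disc: "f \<in> bergman \<xi> \<Longrightarrow> f \<in> hol_disc"
  by (simp add: bergman_def)

lemma bergman_iff_summable:
  assumes "\<xi> > -1" "f \<in> hol_disc"
  shows "f \<in> bergman \<xi> \<longleftrightarrow> summable (\<lambda>k. (cmod (taylor f k))\<^sup>2 * weight \<xi> k)"
proof -
  note [measurable] = borel_measurable_hol_disc[OF assms(2)]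
  have P: "(\<integral>\<^sup>+z. ennreal ((cmod (f z))\<^sup>2) \<partial>disc_measure \<xi>)
      = (\<Sum>k. ennreal ((cmod (taylor f k))\<^sup>2 * weight \<xi> k))"
    by (intro parseval taylor_sums assms) measurable
  have "f \<in> bergman \<xi> \<longleftrightarrow> (\<integral>\<^sup>+z. ennreal ((cmod (f z))\<^sup>2) \<partial>disc_measure \<xi>) < \<infinity>"
    using assms(2) by (auto simp: bergman_def integrable_iff_bounded intro!: borel_measurable_disc_measure)
  also have "\<dots> \<longleftrightarrow> summable (\<lambda>k. (cmod (taylor f k))\<^sup>2 * weight \<xi> k)"
    unfolding P using weight_pos[OF assms(1)]
    by (auto simp: suminf_ennreal2 less_imp_le less_top intro: summable_suminf_not_top)
  finally show ?thesis .
qed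

lemma bergman_norm_sums:
  assumes "\<xi> > -1" "f \<in> bergman \<xi>"
  shows "(\<lambda>k. (cmod (taylor f k))\<^sup>2 * weight \<xi> k) sums (bergman_norm \<xi> f)\<^sup>2"
    and "(LINT z|disc_measure \<xi>. (cmod (f z))\<^sup>2) = (bergman_norm \<xi> f)\<^sup>2"
proof -
  have h: "f \<in> hol_disc" using assms(2) by (rule bergman_hol_disc)
  note [measurable] = borel_measurable_hol_disc[OF h]
  have s: "summable (\<lambda>k. (cmod (taylor f k))\<^sup>2 * weight \<xi> k)"
    using assms bergman_iff_summable[OF assms(1) h] by simp
  have nn: "0 \<le> (LINT z|disc_measure \<xi>. (cmod (f z))\<^sup>2)"
    by (intro integral_nonneg_AE AE_I2) auto
  then show N: "(LINT z|disc_measure \<xi>. (cmod (f z))\<^sup>2) = (bergman_norm \<xi> f)\<^sup>2"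
    by (simp add: bergman_norm_def)
  have "ennreal (LINT z|disc_measure \<xi>. (cmod (f z))\<^sup>2) = (\<integral>\<^sup>+z. ennreal ((cmod (f z))\<^sup>2) \<partial>disc_measure \<xi>)"
    using assms(2) by (intro nn_integral_eq_integral[symmetric]) (auto simp: bergman_def)
  also have "\<dots> = (\<Sum>k. ennreal ((cmod (taylor f k))\<^sup>2 * weight \<xi> k))"
    by (intro parseval taylor_sums assms h) measurable
  also have "\<dots> = ennreal (\<Sum>k. (cmod (taylor f k))\<^sup>2 * weight \<xi> k)"
    using s weight_pos[OF assms(1)] by (intro suminf_ennreal2) (auto simp: less_imp_le)
  finally have "(bergman_norm \<xi> f)\<^sup>2 = (\<Sum>k. (cmod (taylor f k))\<^sup>2 * weight \<xi> k)"
    using nn weight_pos[OF assms(1)] s unfolding N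
    by (subst (asm) ennreal_inj) (auto intro!: suminf_nonneg simp: less_imp_le)
  then show "(\<lambda>k. (cmod (taylor f k))\<^sup>2 * weight \<xi> k) sums (bergman_norm \<xi> f)\<^sup>2"
    using s by (simp add: summable_sums)
qed

text \<open>
  This crude substitute for the triangle inequality is linear in the squares, so it can be summed
  against the weights.
\<close>

lemma norm_lincomb_square_le:
  fixes x y :: complex
  shows "(cmod (\<alpha> * x + \<beta> * y))\<^sup>2 \<le> 2 * (cmod \<alpha>)\<^sup>2 * (cmod x)\<^sup>2 + 2 * (cmod \<beta>)\<^sup>2 * (cmod y)\<^sup>2"
proof -
  have "(cmod (\<alpha> * x + \<beta> * y))\<^sup>2 \<le> (cmod \<alpha> * cmod x + cmod \<beta> * cmod y)\<^sup>2"
    using norm_triangle_ineq[of "\<alpha> * x" "\<beta> * y"] by (intro power_mono) (auto simp: norm_mult)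
  also have "\<dots> \<le> 2 * (cmod \<alpha> * cmod x)\<^sup>2 + 2 * (cmod \<beta> * cmod y)\<^sup>2"
    using sum_squares_bound[of "cmod \<alpha> * cmod x" "cmod \<beta> * cmod y"] by (simp add: power2_sum)
  finally show ?thesis by (simp add: power_mult_distrib)
qed

lemma bergman_lincomb:
  assumes "\<xi> > -1" "f \<in> bergman \<xi>" "g \<in> bergman \<xi>"
  shows "(\<lambda>z. \<alpha> * f z + \<beta> * g z) \<in> bergman \<xi>"
    and "(bergman_norm \<xi> (\<lambda>z. \<alpha> * f z + \<beta> * g z))\<^sup>2
      \<le> 2 * (cmod \<alpha>)\<^sup>2 * (bergman_norm \<xi> f)\<^sup>2 + 2 * (cmod \<beta>)\<^sup>2 * (bergman_norm \<xi> g)\<^sup>2"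
proof -
  note h = assms(2,3)[THEN bergman_hol_disc]
  let ?b = "\<lambda>k. 2 * (cmod \<alpha>)\<^sup>2 * ((cmod (taylor f k))\<^sup>2 * weight \<xi> k) + 2 * (cmod \<beta>)\<^sup>2 * ((cmod (taylor g k))\<^sup>2 * weight \<xi> k)"
  have b: "?b sums (2 * (cmod \<alpha>)\<^sup>2 * (bergman_norm \<xi> f)\<^sup>2 + 2 * (cmod \<beta>)\<^sup>2 * (bergman_norm \<xi> g)\<^sup>2)"
    by (intro sums_add sums_mult bergman_norm_sums assms)
  have le: "(cmod (taylor (\<lambda>z. \<alpha> * f z + \<beta> * g z) k))\<^sup>2 * weight \<xi> k \<le> ?b k" for k
    unfolding taylor_lincomb[OF h]
    using mult_right_mono[OF norm_lincomb_square_le[of \<alpha> "taylor f k" \<beta> "taylor g k"] less_imp_le[OF weight_pos[OF assms(1), of k]]]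
    by (simp add: algebra_simps)
  have "summable (\<lambda>k. (cmod (taylor (\<lambda>z. \<alpha> * f z + \<beta> * g z) k))\<^sup>2 * weight \<xi> k)"
    using le weight_pos[OF assms(1)]
    by (intro summable_comparison_test'[OF sums_summable[OF b]]) (auto simp: less_imp_le)
  then show in_b: "(\<lambda>z. \<alpha> * f z + \<beta> * g z) \<in> bergman \<xi>"
    using bergman_iff_summable[OF assms(1) hol_disc_lincomb[OF h]] by simp
  show "(bergman_norm \<xi> (\<lambda>z. \<alpha> * f z + \<beta> * g z))\<^sup>2
      \<le> 2 * (cmod \<alpha>)\<^sup>2 * (bergman_norm \<xi> f)\<^sup>2 + 2 * (cmod \<beta>)\<^sup>2 * (bergman_norm \<xi> g)\<^sup>2"
    using le by (rule sums_le[OF _ bergman_norm_sums(1)[OF assms(1) in_b] b])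
qed

lemma bergman_diff:
  assumes "\<xi> > -1" "f \<in> bergman \<xi>" "g \<in> bergman \<xi>"
  shows "(\<lambda>z. f z - g z) \<in> bergman \<xi>"
    and "taylor (\<lambda>z. f z - g z) k = taylor f k - taylor g k"
  using bergman_lincomb(1)[OF assms, of 1 "-1"]
    taylor_lincomb[of f g 1 "-1" k] assms(2,3)[THEN bergman_hol_disc] by simp_all

lemma bergman_norm_ge_0 [simp]: "bergman_norm \<xi> f \<ge> 0"
  by (simp add: bergman_norm_def integral_nonneg_AE)

text \<open>
  Polarization turns the identity for norms into the one for inner products; the same four-term
  identity is applied to the function values under the integral and to the Taylor coefficients.
\<close>

lemma bergman_inner_sums:
  assumes "\<xi> > -1" "f \<in> bergman \<xi>" "g \<in> bergman \<xi>"
  shows "(\<lambda>k. taylor f k * cnj (taylor g k) * of_real (weight \<xi> k)) sums bergman_inner \<xi> f g"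
proof -
  have pol: "x * cnj y = (1 / 4) * (of_real ((cmod (1 * x + 1 * y))\<^sup>2) + (-1) * of_real ((cmod (1 * x + (-1) * y))\<^sup>2)
      + \<i> * of_real ((cmod (1 * x + \<i> * y))\<^sup>2) + (-\<i>) * of_real ((cmod (1 * x + (-\<i>) * y))\<^sup>2))" for x y :: complex
  unfolding complex_norm_square by (simp add: algebra_simps)
  note h = assms(2,3)[THEN bergman_hol_disc]
  let ?c = "\<lambda>\<epsilon> z. 1 * f z + \<epsilon> * g z"
  have b: "?c \<epsilon> \<in> bergman \<xi>" for \<epsilon>
    by (rule bergman_lincomb(1)[OF assms])
  have int: "has_bochner_integral (disc_measure \<xi>) (\<lambda>z. complex_of_real ((cmod (?c \<epsilon> z))\<^sup>2)) (of_real ((bergman_norm \<xi> (?c \<epsilon>))\<^sup>2))" for \<epsilon>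
    using b[of \<epsilon>] unfolding bergman_norm_sums(2)[OF assms(1) b, symmetric]
    by (intro has_bochner_integral_of_real has_bochner_integral_integrable) (auto simp: bergman_def)
  have "has_bochner_integral (disc_measure \<xi>) (\<lambda>z. f z * cnj (g z))
    ((1 / 4) * (of_real ((bergman_norm \<xi> (?c 1))\<^sup>2) + (-1) * of_real ((bergman_norm \<xi> (?c (-1)))\<^sup>2)
      + \<i> * of_real ((bergman_norm \<xi> (?c \<i>))\<^sup>2) + (-\<i>) * of_real ((bergman_norm \<xi> (?c (-\<i>)))\<^sup>2)))" (is "has_bochner_integral _ _ ?I")
    by (subst pol) (intro has_bochner_integral_mult_right has_bochner_integral_add int)
  then have I: "bergman_inner \<xi> f g = ?I"
    unfolding bergman_inner_def by (rule has_bochner_integral_integral_eq)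
  have s: "(\<lambda>k. complex_of_real ((cmod (1 * taylor f k + \<epsilon> * taylor g k))\<^sup>2) * of_real (weight \<xi> k)) sums of_real ((bergman_norm \<xi> (?c \<epsilon>))\<^sup>2)" for \<epsilon>
    using bergman_norm_sums(1)[OF assms(1) b[of \<epsilon>], THEN sums_of_real[where 'a=complex]]
    unfolding taylor_lincomb[OF h] by (simp only: of_real_mult)
  show ?thesis
    unfolding I by (subst pol)
      (insert sums_mult[OF sums_add[OF sums_add[OF sums_add[OF s sums_mult[OF s]] sums_mult[OF s]] sums_mult[OF s]],
        of "1/4" 1 "-1" "-1" \<i> \<i> "-\<i>" "-\<i>"], simp only: distrib_right mult.assoc)
qed

lemma bergman_tendsto_iff:
  assumes "\<xi> > -1"
  shows "bergman_tendsto \<xi> v w F \<longleftrightarrow> w \<in> bergman \<xi> \<and> (\<forall>\<^sub>F t in F. v t \<in> bergman \<xi>) \<and>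
     ((\<lambda>t. (bergman_norm \<xi> (\<lambda>z. v t z - w z))\<^sup>2) \<longlongrightarrow> 0) F"
proof -
  have "((\<lambda>t. (bergman_norm \<xi> (\<lambda>z. v t z - w z))\<^sup>2) \<longlongrightarrow> 0) F \<longleftrightarrow>
    ((\<lambda>t. bergman_norm \<xi> (\<lambda>z. v t z - w z)) \<longlongrightarrow> 0) F" (is "?l \<longleftrightarrow> ?r")
  proof
    assume ?l
    from tendsto_real_sqrt[OF this] show ?r by simp
  next
    assume ?r
    from tendsto_power[OF this, of 2] show ?l by simp
  qed
  then show ?thesis by (simp add: bergman_tendsto_def)
qed

text \<open>
  Each coefficient is controlled by the norm, since \<open>\<bar>a\<^sub>k\<bar>\<^sup>2 w\<^sub>k\<close> is one term of the series for the squared norm.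
\<close>

lemma bergman_tendsto_taylor:
  assumes "\<xi> > -1" "bergman_tendsto \<xi> v w F"
  shows "((\<lambda>t. taylor (v t) k) \<longlongrightarrow> taylor w k) F"
proof -
  have w: "w \<in> bergman \<xi>" and v: "\<forall>\<^sub>F t in F. v t \<in> bergman \<xi>"
    and l: "((\<lambda>t. (bergman_norm \<xi> (\<lambda>z. v t z - w z))\<^sup>2) \<longlongrightarrow> 0) F"
    using assms(2) unfolding bergman_tendsto_iff[OF assms(1)] by auto
  have "\<forall>\<^sub>F t in F. (cmod (taylor (v t) k - taylor w k))\<^sup>2 \<le> (bergman_norm \<xi> (\<lambda>z. v t z - w z))\<^sup>2 / weight \<xi> k"
    using v
  proof eventually_elim
    case (elim t)
    note s = bergman_norm_sums(1)[OF assms(1) bergman_diff(1)[OF assms(1) elim w]]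
    have "(cmod (taylor (v t) k - taylor w k))\<^sup>2 * weight \<xi> k \<le> (bergman_norm \<xi> (\<lambda>z. v t z - w z))\<^sup>2"
      using sum_le_suminf[OF sums_summable[OF s], of "{k}"] less_imp_le[OF weight_pos[OF assms(1)]]
      unfolding sums_unique[OF s] bergman_diff(2)[OF assms(1) elim w] by simp
    then show ?case using weight_pos[OF assms(1), of k] by (simp add: pos_le_divide_eq)
  qed
  moreover have "((\<lambda>t. (bergman_norm \<xi> (\<lambda>z. v t z - w z))\<^sup>2 / weight \<xi> k) \<longlongrightarrow> 0) F"
    using tendsto_divide[OF l tendsto_const, of "weight \<xi> k"] weight_pos[OF assms(1), of k] by simp
  ultimately have "((\<lambda>t. (cmod (taylor (v t) k - taylor w k))\<^sup>2) \<longlongrightarrow> 0) F"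
    by (rule tendsto_sandwich[OF always_eventually _ tendsto_const, rotated]) auto
  from tendsto_real_sqrt[OF this] have "((\<lambda>t. taylor (v t) k - taylor w k) \<longlongrightarrow> 0) F"
    using tendsto_norm_zero_iff by fastforce
  then show ?thesis by (rule LIM_zero_cancel)
qed

lemma bergman_tendsto_unique:
  assumes "\<xi> > -1" "F \<noteq> bot" "bergman_tendsto \<xi> v w F" "bergman_tendsto \<xi> v w' F"
  shows "w = w'"
proof (rule hol_disc_eqI)
  show "taylor w k = taylor w' k" for k
    using bergman_tendsto_taylor[OF assms(1)] assms tendsto_unique by blast
qed (use assms in \<open>auto simp: bergman_tendsto_def bergman_hol_disc\<close>)

lemma bergman_tendsto_lincomb:
  assumes "\<xi> > -1" "bergman_tendsto \<xi> v w F" "bergman_tendsto \<xi> v' w' F"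
  shows "bergman_tendsto \<xi> (\<lambda>t z. \<alpha> * v t z + \<beta> * v' t z) (\<lambda>z. \<alpha> * w z + \<beta> * w' z) F"
proof -
  have w: "w \<in> bergman \<xi>" "w' \<in> bergman \<xi>" and v: "\<forall>\<^sub>F t in F. v t \<in> bergman \<xi>" "\<forall>\<^sub>F t in F. v' t \<in> bergman \<xi>"
    and l: "((\<lambda>t. (bergman_norm \<xi> (\<lambda>z. v t z - w z))\<^sup>2) \<longlongrightarrow> 0) F"
      "((\<lambda>t. (bergman_norm \<xi> (\<lambda>z. v' t z - w' z))\<^sup>2) \<longlongrightarrow> 0) F"
    using assms(2,3) unfolding bergman_tendsto_iff[OF assms(1)] by auto
  let ?n = "\<lambda>t. (bergman_norm \<xi> (\<lambda>z. (\<alpha> * v t z + \<beta> * v' t z) - (\<alpha> * w z + \<beta> * w' z)))\<^sup>2"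
  let ?b = "\<lambda>t. 2 * (cmod \<alpha>)\<^sup>2 * (bergman_norm \<xi> (\<lambda>z. v t z - w z))\<^sup>2 + 2 * (cmod \<beta>)\<^sup>2 * (bergman_norm \<xi> (\<lambda>z. v' t z - w' z))\<^sup>2"
  have "\<forall>\<^sub>F t in F. ?n t \<le> ?b t"
    using v
  proof eventually_elim
    case (elim t)
    have "(\<lambda>z. (\<alpha> * v t z + \<beta> * v' t z) - (\<alpha> * w z + \<beta> * w' z))
      = (\<lambda>z. \<alpha> * (v t z - w z) + \<beta> * (v' t z - w' z))"
      by (simp add: algebra_simps)
    then show ?case
      using bergman_lincomb(2)[OF assms(1) bergman_diff(1)[OF assms(1) elim(1) w(1)]
         bergman_diff(1)[OF assms(1) elim(2) w(2)]] by simp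
  qed
  moreover have "(?b \<longlongrightarrow> 0) F"
    using tendsto_add[OF tendsto_mult_left[OF l(1), of "2 * (cmod \<alpha>)\<^sup>2"] tendsto_mult_left[OF l(2), of "2 * (cmod \<beta>)\<^sup>2"]] by simp
  ultimately have "(?n \<longlongrightarrow> 0) F"
    by (rule tendsto_sandwich[OF always_eventually _ tendsto_const, rotated]) auto
  moreover have "\<forall>\<^sub>F t in F. (\<lambda>z. \<alpha> * v t z + \<beta> * v' t z) \<in> bergman \<xi>"
    using v by eventually_elim (rule bergman_lincomb(1)[OF assms(1)])
  ultimately show ?thesis
    using bergman_lincomb(1)[OF assms(1) w] by (simp add: bergman_tendsto_iff[OF assms(1)])
qed

lemma taylor_poly_disc:
  "on_disc (poly p) \<in> hol_disc" "taylor (on_disc (poly p)) k = coeff p k"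
proof -
  have s: "(\<lambda>k. coeff p k * z ^ k) sums on_disc (poly p) z" if "z \<in> unit_disc" for z
    using that sums_finite[of "{..degree p}" "\<lambda>k. coeff p k * z ^ k"]
    by (simp add: on_disc_def poly_altdef coeff_eq_0)
  then show h: "on_disc (poly p) \<in> hol_disc"
    by (rule hol_disc_of_sums) (simp_all add: on_disc_def)
  show "taylor (on_disc (poly p)) k = coeff p k"
    using s h by (rule taylor_unique)
qed

lemma poly_disc_hol_disc: "f \<in> poly_disc \<Longrightarrow> f \<in> hol_disc"
  by (auto simp: poly_disc_def taylor_poly_disc)

lemma poly_disc_taylor_finite:
  assumes "f \<in> poly_disc"
  shows "\<exists>N. \<forall>k\<ge>N. taylor f k = 0"
proof -
  obtain p where "f = on_disc (poly p)" using assms by (auto simp: poly_disc_def)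
  then have "\<forall>k\<ge>Suc (degree p). taylor f k = 0"
    by (simp add: taylor_poly_disc coeff_eq_0)
  then show ?thesis ..
qed

lemma ex_poly_disc_taylor:
  assumes "\<And>k. k \<ge> N \<Longrightarrow> a k = 0"
  shows "\<exists>f\<in>poly_disc. \<forall>k. taylor f k = a k"
proof
  have "coeff (\<Sum>j<N. monom (a j) j) k = a k" for k
    using assms[of k] by (simp add: coeff_sum not_less)
  then show "\<forall>k. taylor (on_disc (poly (\<Sum>j<N. monom (a j) j))) k = a k"
    by (simp add: taylor_poly_disc)
  show "on_disc (poly (\<Sum>j<N. monom (a j) j)) \<in> poly_disc"
    unfolding poly_disc_def by blast
qed

lemma poly_disc_bergman:
  assumes "\<xi> > -1" "f \<in> poly_disc"
  shows "f \<in> bergman \<xi>"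
proof -
  obtain N where N: "\<And>k. k \<ge> N \<Longrightarrow> taylor f k = 0"
    using poly_disc_taylor_finite[OF assms(2)] by blast
  show ?thesis
    unfolding bergman_iff_summable[OF assms(1) poly_disc_hol_disc[OF assms(2)]]
    by (rule summable_finite[of "{..<N}"]) (auto simp: N not_less)
qed

lemma bergman_norm_power:
  assumes "\<xi> > -1"
  shows "(bergman_norm \<xi> (on_disc (\<lambda>z. z ^ k)))\<^sup>2 = weight \<xi> k"
proof -
  have e: "on_disc (\<lambda>z. z ^ k) = on_disc (poly (monom 1 k))" by (rule ext) (simp add: on_disc_def poly_monom)
  have "on_disc (\<lambda>z. z ^ k) \<in> bergman \<xi>"
    unfolding e by (rule poly_disc_bergman[OF assms]) (auto simp: poly_disc_def)
  from bergman_norm_sums(1)[OF assms this]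
  have "(\<lambda>j. (cmod (if k = j then 1 else 0))\<^sup>2 * weight \<xi> j) sums (bergman_norm \<xi> (on_disc (\<lambda>z. z ^ k)))\<^sup>2"
    unfolding e taylor_poly_disc by simp
  moreover have "(\<lambda>j. (cmod (if k = j then 1 else 0))\<^sup>2 * weight \<xi> j) = (\<lambda>j. if j = k then weight \<xi> j else 0)"
    by auto
  ultimately show ?thesis
    using sums_single[of k "weight \<xi>"] sums_unique2 by metis
qed

lemma bergman_bounded:
  assumes "\<xi> > -1" "f \<in> hol_disc" "\<And>z. z \<in> unit_disc \<Longrightarrow> cmod (f z) \<le> e"
  shows "f \<in> bergman \<xi>" "bergman_norm \<xi> f \<le> e * sqrt (weight \<xi> 0)"
proof -
  note [measurable] = borel_measurable_hol_disc[OF assms(2)]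
  interpret finite_measure "disc_measure \<xi>" by (rule finite_measure_disc_measure) fact
  have e: "e \<ge> 0" using assms(3)[of 0] norm_ge_zero[of "f 0"] by (simp del: norm_ge_zero)
  have b: "(cmod (f z))\<^sup>2 \<le> e\<^sup>2" if "z \<in> unit_disc" for z
    using assms(3)[OF that] by (intro power_mono) auto
  have i: "integrable (disc_measure \<xi>) (\<lambda>z. (cmod (f z))\<^sup>2)"
    using b by (intro integrable_disc_measure_bounded[OF assms(1), where C="e\<^sup>2"]) auto
  then show "f \<in> bergman \<xi>" using assms(2) by (simp add: bergman_def)
  have "(LINT z|disc_measure \<xi>. (cmod (f z))\<^sup>2) \<le> (LINT z|disc_measure \<xi>. e\<^sup>2)"
    using b by (intro integral_mono i) auto
  also have "\<dots> = weight \<xi> 0 * e\<^sup>2"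
    using weight_pos[OF assms(1), of 0] by (simp add: measure_def emeasure_disc_measure[OF assms(1)])
  finally have "bergman_norm \<xi> f \<le> sqrt (weight \<xi> 0 * e\<^sup>2)"
    unfolding bergman_norm_def by (rule real_sqrt_le_mono)
  also have "\<dots> = e * sqrt (weight \<xi> 0)"
    using e by (simp add: real_sqrt_mult)
  finally show "bergman_norm \<xi> f \<le> e * sqrt (weight \<xi> 0)" .
qed

section \<open>The Jacobi matrix of the differential operator\<close>

definition diff_expr :: "real \<Rightarrow> real \<Rightarrow> real \<Rightarrow> complex \<Rightarrow> (complex \<Rightarrow> complex) \<Rightarrow> complex \<Rightarrow> complex" where
  "diff_expr \<xi> a b c f = on_disc (\<lambda>z. (c * z\<^sup>2 + of_real a * z + cnj c) * deriv f z
                       + (of_real (\<xi> + 2) * c * z + of_real b) * f z)"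

text \<open>
  The tridiagonal matrix by which the differential expression acts on Taylor coefficients; the
  term below the diagonal is absent in row 0.
\<close>

definition jacobi :: "real \<Rightarrow> real \<Rightarrow> real \<Rightarrow> complex \<Rightarrow> (nat \<Rightarrow> complex) \<Rightarrow> nat \<Rightarrow> complex" where
  "jacobi \<xi> a b c x k = c * of_real (real k + \<xi> + 1) * (if k = 0 then 0 else x (k - 1))
     + of_real (a * real k + b) * x k + cnj c * of_real (real k + 1) * x (Suc k)"

lemma sums_shift:
  fixes z :: complex
  assumes "(\<lambda>k. x k * z ^ k) sums s"
  shows "(\<lambda>k. (if k = 0 then 0 else x (k - 1)) * z ^ k) sums (z * s)"
  using sums_Suc[of "\<lambda>k. (if k = 0 then 0 else x (k - 1)) * z ^ k" "z * s"] sums_mult[OF assms, of z]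
  by (simp add: mult_ac)

lemma deriv_taylor_sums:
  assumes "f \<in> hol_disc" "z \<in> unit_disc"
  shows "(\<lambda>k. of_nat (Suc k) * taylor f (Suc k) * z ^ k) sums deriv f z"
proof -
  have "deriv f holomorphic_on ball 0 1"
    using assms(1) by (intro holomorphic_deriv) (auto simp: hol_disc_def)
  from holomorphic_power_series[OF this, of z]
  have "(\<lambda>k. (deriv ^^ k) (deriv f) 0 / fact k * z ^ k) sums deriv f z"
    using assms(2) by simp
  moreover have "(deriv ^^ k) (deriv f) 0 / fact k = of_nat (Suc k) * taylor f (Suc k)" for k
    by (simp add: taylor_def funpow_Suc_right del: funpow.simps of_nat_Suc)
  ultimately show ?thesis by simp
qed

lemma diff_expr_hol_disc:
  assumes "f \<in> hol_disc"
  shows "diff_expr \<xi> a b c f \<in> hol_disc"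
proof -
  have "(\<lambda>z. (c * z\<^sup>2 + of_real a * z + cnj c) * deriv f z
                       + (of_real (\<xi> + 2) * c * z + of_real b) * f z) holomorphic_on unit_disc"
    using assms by (intro holomorphic_intros holomorphic_deriv) (auto simp: hol_disc_def)
  then have "diff_expr \<xi> a b c f holomorphic_on unit_disc"
    by (rule holomorphic_transform) (simp add: diff_expr_def on_disc_def)
  then show ?thesis
    by (simp add: hol_disc_def diff_expr_def on_disc_def)
qed

lemma taylor_diff_expr:
  assumes "f \<in> hol_disc"
  shows "taylor (diff_expr \<xi> a b c f) k = jacobi \<xi> a b c (taylor f) k"
proof (rule taylor_unique[OF _ diff_expr_hol_disc[OF assms]])
  fix z assume z: "z \<in> unit_disc"
  define x d where "x = taylor f" and "d k = of_nat (Suc k) * x (Suc k)" for k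
  have x: "(\<lambda>k. x k * z ^ k) sums f z"
    unfolding x_def by (rule taylor_sums[OF assms z])
  have d: "(\<lambda>k. d k * z ^ k) sums deriv f z"
    unfolding x_def d_def by (rule deriv_taylor_sums[OF assms z])
  let ?s = "\<lambda>x k. if k = 0 then 0 else x (k - 1 :: nat) :: complex"
  have "(\<lambda>k. c * (?s (?s d) k * z ^ k) + of_real a * (?s d k * z ^ k) + cnj c * (d k * z ^ k)
      + (of_real (\<xi> + 2) * c) * (?s x k * z ^ k) + of_real b * (x k * z ^ k))
    sums (c * (z * (z * deriv f z)) + of_real a * (z * deriv f z) + cnj c * deriv f z
      + (of_real (\<xi> + 2) * c) * (z * f z) + of_real b * f z)"
    by (intro sums_add sums_mult sums_shift x d)
  also have "(\<lambda>k. c * (?s (?s d) k * z ^ k) + of_real a * (?s d k * z ^ k) + cnj c * (d k * z ^ k)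
      + (of_real (\<xi> + 2) * c) * (?s x k * z ^ k) + of_real b * (x k * z ^ k))
    = (\<lambda>k. jacobi \<xi> a b c x k * z ^ k)"
  proof
    fix k
    have 1: "?s d k = of_nat k * x k" by (cases k) (simp_all add: d_def)
    have 2: "?s (?s d) k = of_nat (k - 1) * ?s x k"
    proof (cases k)
      case (Suc j) then show ?thesis by (cases j) (simp_all add: d_def)
    qed simp
    show "c * (?s (?s d) k * z ^ k) + of_real a * (?s d k * z ^ k) + cnj c * (d k * z ^ k)
      + (of_real (\<xi> + 2) * c) * (?s x k * z ^ k) + of_real b * (x k * z ^ k)
      = jacobi \<xi> a b c x k * z ^ k"
      unfolding 1 2 jacobi_def d_def by (cases k) (simp_all add: algebra_simps)
  qed
  also have "c * (z * (z * deriv f z)) + of_real a * (z * deriv f z) + cnj c * deriv f z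
      + (of_real (\<xi> + 2) * c) * (z * f z) + of_real b * f z = diff_expr \<xi> a b c f z"
    using z by (simp add: diff_expr_def on_disc_def power2_eq_square algebra_simps)
  finally show "(\<lambda>k. jacobi \<xi> a b c (taylor f) k * z ^ k) sums diff_expr \<xi> a b c f z"
    by (simp only: x_def)
qed

text \<open>
  After a shift of the index, the entry above the diagonal in one sum meets the entry below the diagonal in
  the other, and the factors \<open>(k + \<xi> + 2) w\<^sub>k\<^sub>+\<^sub>1\<close> and \<open>(k + 1) w\<^sub>k\<close> agree by the recursion of the weights.
\<close>

lemma jacobi_symmetric:
  assumes "\<xi> > -1" and x: "\<And>k. k \<ge> N \<Longrightarrow> x k = 0"
  shows "(\<Sum>k<Suc N. jacobi \<xi> a b c x k * cnj (y k) * of_real (weight \<xi> k))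
    = (\<Sum>k<Suc N. x k * cnj (jacobi \<xi> a b c y k) * of_real (weight \<xi> k))"
proof -
  let ?w = "\<lambda>k. complex_of_real (weight \<xi> k)"
  have w: "of_real (real k + \<xi> + 2) * ?w (Suc k) = of_real (real k + 1) * ?w k" for k
    using weight_Suc[OF assms(1), of k] by (simp only: of_real_mult[symmetric])
  have up: "(\<Sum>k<Suc N. (c * of_real (real k + \<xi> + 1) * (if k = 0 then 0 else x (k - 1))) * cnj (y k) * ?w k)
    = (\<Sum>k<Suc N. x k * (c * of_real (real k + 1) * cnj (y (Suc k))) * ?w k)"
  proof -
    have "(\<Sum>k<Suc N. (c * of_real (real k + \<xi> + 1) * (if k = 0 then 0 else x (k - 1))) * cnj (y k) * ?w k)
      = (\<Sum>k<N. c * x k * cnj (y (Suc k)) * (of_real (real k + \<xi> + 2) * ?w (Suc k)))"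
      by (subst sum.lessThan_Suc_shift) (simp add: algebra_simps)
    also have "\<dots> = (\<Sum>k<Suc N. x k * (c * of_real (real k + 1) * cnj (y (Suc k))) * ?w k)"
      unfolding w by (simp add: x algebra_simps)
    finally show ?thesis .
  qed
  have down: "(\<Sum>k<Suc N. (cnj c * of_real (real k + 1) * x (Suc k)) * cnj (y k) * ?w k)
    = (\<Sum>k<Suc N. x k * (cnj c * of_real (real k + \<xi> + 1) * (if k = 0 then 0 else cnj (y (k - 1)))) * ?w k)"
  proof -
    have "(\<Sum>k<Suc N. x k * (cnj c * of_real (real k + \<xi> + 1) * (if k = 0 then 0 else cnj (y (k - 1)))) * ?w k)
      = (\<Sum>k<N. cnj c * x (Suc k) * cnj (y k) * (of_real (real k + \<xi> + 2) * ?w (Suc k)))"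
      by (subst sum.lessThan_Suc_shift) (simp add: algebra_simps)
    also have "\<dots> = (\<Sum>k<Suc N. (cnj c * of_real (real k + 1) * x (Suc k)) * cnj (y k) * ?w k)"
      unfolding w by (simp add: x algebra_simps)
    finally show ?thesis by simp
  qed
  have "(\<Sum>k<Suc N. jacobi \<xi> a b c x k * cnj (y k) * ?w k)
    = (\<Sum>k<Suc N. (c * of_real (real k + \<xi> + 1) * (if k = 0 then 0 else x (k - 1))) * cnj (y k) * ?w k)
      + (\<Sum>k<Suc N. of_real (a * real k + b) * x k * cnj (y k) * ?w k)
      + (\<Sum>k<Suc N. (cnj c * of_real (real k + 1) * x (Suc k)) * cnj (y k) * ?w k)"
    unfolding jacobi_def by (simp only: distrib_right sum.distrib)
  also have "\<dots> = (\<Sum>k<Suc N. x k * (c * of_real (real k + 1) * cnj (y (Suc k))) * ?w k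
      + of_real (a * real k + b) * x k * cnj (y k) * ?w k
      + x k * (cnj c * of_real (real k + \<xi> + 1) * (if k = 0 then 0 else cnj (y (k - 1)))) * ?w k)"
    unfolding up down by (simp only: sum.distrib)
  also have "\<dots> = (\<Sum>k<Suc N. x k * cnj (jacobi \<xi> a b c y k) * ?w k)"
  proof (rule sum.cong[OF refl])
    fix k
    show "x k * (c * of_real (real k + 1) * cnj (y (Suc k))) * ?w k
      + of_real (a * real k + b) * x k * cnj (y k) * ?w k
      + x k * (cnj c * of_real (real k + \<xi> + 1) * (if k = 0 then 0 else cnj (y (k - 1)))) * ?w k
      = x k * cnj (jacobi \<xi> a b c y k) * ?w k"
      unfolding jacobi_def by (cases k) (simp_all add: algebra_simps)
  qed
  finally show ?thesis .
qed

text \<open>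
  The maximal operator of the Jacobi matrix: its domain consists of all \<open>g\<close> whose formal image is
  again the Taylor series of a Bergman function. It turns out to be the closure.
\<close>

definition max_op :: "real \<Rightarrow> real \<Rightarrow> real \<Rightarrow> complex \<Rightarrow> operator" where
  "max_op \<xi> a b c = {(g, h). g \<in> bergman \<xi> \<and> h \<in> bergman \<xi> \<and> (\<forall>k. taylor h k = jacobi \<xi> a b c (taylor g) k)}"

lemma diff_op_eq:
  assumes "\<xi> > -1"
  shows "diff_op \<xi> a b c = {(f, g) \<in> max_op \<xi> a b c. f \<in> poly_disc}"
proof (intro set_eqI iffI; clarify)
  fix f g assume "(f, g) \<in> diff_op \<xi> a b c"
  then have f: "f \<in> poly_disc" and g: "g = diff_expr \<xi> a b c f"
    by (auto simp: diff_op_def diff_expr_def)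
  note h = poly_disc_hol_disc[OF f]
  obtain N where N: "\<forall>k\<ge>N. taylor f k = 0"
    using poly_disc_taylor_finite[OF f] by blast
  have "g \<in> bergman \<xi>"
    unfolding g bergman_iff_summable[OF assms diff_expr_hol_disc[OF h]] taylor_diff_expr[OF h]
    by (rule summable_finite[of "{..N}"]) (use N in \<open>auto simp: jacobi_def not_le\<close>)
  then show "(f, g) \<in> max_op \<xi> a b c \<and> f \<in> poly_disc"
    using f poly_disc_bergman[OF assms f] taylor_diff_expr[OF h] by (auto simp: max_op_def g)
next
  fix f g assume m: "(f, g) \<in> max_op \<xi> a b c" and f: "f \<in> poly_disc"
  note h = poly_disc_hol_disc[OF f]
  have "g = diff_expr \<xi> a b c f"
    using m taylor_diff_expr[OF h] by (intro hol_disc_eqI diff_expr_hol_disc[OF h]) (auto simp: max_op_def bergman_hol_disc)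
  then show "(f, g) \<in> diff_op \<xi> a b c"
    using f by (auto simp: diff_op_def diff_expr_def)
qed

lemma bergman_inner_finite:
  assumes "\<xi> > -1" "f \<in> bergman \<xi>" "g \<in> bergman \<xi>" and N: "\<And>k. k \<ge> N \<Longrightarrow> taylor f k * cnj (taylor g k) = 0"
  shows "bergman_inner \<xi> f g = (\<Sum>k<N. taylor f k * cnj (taylor g k) * of_real (weight \<xi> k))"
  by (rule sums_unique2[OF bergman_inner_sums[OF assms(1-3)]], rule sums_finite) (auto simp: N not_less)

text \<open>
  The formal image of \<open>g\<close> under the matrix may fail to be a Bergman function, but against a
  polynomial all sums are finite. This is the situation of a vector \<open>g\<close> in the domain of the adjoint.
\<close>

lemma max_op_symmetric_poly:
  assumes "\<xi> > -1" and f: "(f, f') \<in> max_op \<xi> a b c" "f \<in> poly_disc" and g: "g \<in> bergman \<xi>"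
  shows "\<exists>N. (\<forall>k\<ge>N. taylor f k = 0) \<and>
    bergman_inner \<xi> f' g = (\<Sum>k<N. taylor f k * cnj (jacobi \<xi> a b c (taylor g) k) * of_real (weight \<xi> k))"
proof -
  obtain N where N: "\<forall>k\<ge>N. taylor f k = 0"
    using poly_disc_taylor_finite[OF f(2)] by blast
  have "bergman_inner \<xi> f' g = (\<Sum>k<Suc N. jacobi \<xi> a b c (taylor f) k * cnj (taylor g k) * of_real (weight \<xi> k))"
    using f(1) g N bergman_inner_finite[OF assms(1), of f' g "Suc N"] by (auto simp: max_op_def jacobi_def)
  also have "\<dots> = (\<Sum>k<Suc N. taylor f k * cnj (jacobi \<xi> a b c (taylor g) k) * of_real (weight \<xi> k))"
    using N by (intro jacobi_symmetric assms(1)) auto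
  finally show ?thesis
    using N by (intro exI[of _ "Suc N"]) auto
qed

lemma diff_op_symmetric:
  assumes "\<xi> > -1" and f: "(f, f') \<in> diff_op \<xi> a b c" and g: "(g, h) \<in> max_op \<xi> a b c"
  shows "bergman_inner \<xi> f' g = bergman_inner \<xi> f h"
proof -
  have f: "(f, f') \<in> max_op \<xi> a b c" "f \<in> poly_disc" using f unfolding diff_op_eq[OF assms(1)] by auto
  have gh: "g \<in> bergman \<xi>" "h \<in> bergman \<xi>" "f \<in> bergman \<xi>" "\<And>k. taylor h k = jacobi \<xi> a b c (taylor g) k"
    using g f by (auto simp: max_op_def)
  obtain N where N: "\<forall>k\<ge>N. taylor f k = 0"
    "bergman_inner \<xi> f' g = (\<Sum>k<N. taylor f k * cnj (taylor h k) * of_real (weight \<xi> k))"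
    using max_op_symmetric_poly[OF assms(1) f gh(1)] unfolding gh(4)[symmetric] by blast
  show ?thesis
    unfolding N(2) using N(1) by (intro bergman_inner_finite[symmetric] assms(1) gh) simp
qed

text \<open>
  Testing the adjoint relation against the monomial \<open>z\<^sup>j\<close> yields row \<open>j\<close> of the Jacobi matrix.
\<close>

lemma adjoint_diff_op_subset:
  assumes "\<xi> > -1"
  shows "adjoint_operator \<xi> (diff_op \<xi> a b c) \<subseteq> max_op \<xi> a b c"
proof clarify
  fix g h assume "(g, h) \<in> adjoint_operator \<xi> (diff_op \<xi> a b c)"
  then have gh: "g \<in> bergman \<xi>" "h \<in> bergman \<xi>"
    and adj: "\<And>f f'. (f, f') \<in> diff_op \<xi> a b c \<Longrightarrow> bergman_inner \<xi> f' g = bergman_inner \<xi> f h"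
    by (auto simp: adjoint_operator_def)
  have "taylor h j = jacobi \<xi> a b c (taylor g) j" for j
  proof -
    obtain f where f: "f \<in> poly_disc" "\<forall>k. taylor f k = (if k = j then 1 else 0)"
      using ex_poly_disc_taylor[of "Suc j" "\<lambda>k. if k = j then 1 else 0"] by auto
    define f' where "f' = diff_expr \<xi> a b c f"
    have L: "(f, f') \<in> diff_op \<xi> a b c"
      using f(1) by (auto simp: f'_def diff_op_def diff_expr_def)
    then have "(f, f') \<in> max_op \<xi> a b c" unfolding diff_op_eq[OF assms] by auto
    from max_op_symmetric_poly[OF assms this f(1) gh(1)] obtain N where
      N: "\<forall>k\<ge>N. taylor f k = 0"
      "bergman_inner \<xi> f' g = (\<Sum>k<N. taylor f k * cnj (jacobi \<xi> a b c (taylor g) k) * of_real (weight \<xi> k))" by blast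
    have j: "j < N" using N(1) f(2) by (metis not_less zero_neq_one)
    have "bergman_inner \<xi> f h = (\<Sum>k<N. taylor f k * cnj (taylor h k) * of_real (weight \<xi> k))"
      using N(1) by (intro bergman_inner_finite assms gh poly_disc_bergman f(1)) auto
    with adj[OF L] have "cnj (jacobi \<xi> a b c (taylor g) j) * of_real (weight \<xi> j) = cnj (taylor h j) * of_real (weight \<xi> j)"
      unfolding N(2) using j f(2) by (simp add: if_distrib[of "\<lambda>x. x * _"] cong: if_cong)
    then show ?thesis using weight_pos[OF assms, of j] by simp
  qed
  then show "(g, h) \<in> max_op \<xi> a b c" using gh by (simp add: max_op_def)
qed

section \<open>Essential self-adjointness\<close>

text \<open>
  The weights of Fejer's means. Their slope in \<open>k\<close> is \<open>1 / (n + 1)\<close> and they vanish for \<open>k > n\<close>, so the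
  slope times \<open>k + 1\<close> is at most 1; this balances the linear growth of the matrix entries.
\<close>

definition fejer :: "nat \<Rightarrow> nat \<Rightarrow> real" where
  "fejer n k = max 0 (1 - real k / real (Suc n))"

lemma fejer_bounds: "0 \<le> fejer n k" "fejer n k \<le> 1"
  by (auto simp: fejer_def)

lemma fejer_eq_0: "k \<ge> Suc n \<Longrightarrow> fejer n k = 0"
  by (simp add: fejer_def max_def field_simps)

lemma fejer_tendsto: "(\<lambda>n. fejer n k) \<longlonglongrightarrow> 1"
proof -
  have "(\<lambda>n. max 0 (1 - real k * (1 / real (Suc n)))) \<longlonglongrightarrow> max 0 (1 - real k * 0)"
    by (intro tendsto_intros LIMSEQ_Suc[OF lim_1_over_n])
  then show ?thesis by (simp add: fejer_def)
qed

lemma fejer_slope: "(real k + 1) * \<bar>fejer n (Suc k) - fejer n k\<bar> \<le> 1"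
proof (cases "k \<ge> Suc n")
  case True
  then show ?thesis by (simp add: fejer_eq_0)
next
  case False
  have eq: "fejer n j = 1 - real j / real (Suc n)" if "j \<le> Suc n" for j
    using that by (simp add: fejer_def max_def)
  have "fejer n (Suc k) - fejer n k = - (1 / real (Suc n))"
    using False eq[of k] eq[of "Suc k"] by (simp add: add_divide_distrib)
  then have "\<bar>fejer n (Suc k) - fejer n k\<bar> = 1 / real (Suc n)"
    by simp
  then show ?thesis using False by simp
qed

text \<open>
  Dominated convergence (Tannery's theorem) for the series of the squared norm.
\<close>

lemma bergman_tendsto_taylor_series:
  assumes "\<xi> > -1" "g \<in> bergman \<xi>" "\<And>n. v n \<in> bergman \<xi>" "summable M"
    and bound: "\<And>n k. (cmod (taylor (v n) k - taylor g k))\<^sup>2 * weight \<xi> k \<le> M k"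
    and lim: "\<And>k. (\<lambda>n. taylor (v n) k) \<longlonglongrightarrow> taylor g k"
  shows "bergman_tendsto \<xi> v g sequentially"
proof -
  have "(\<lambda>n. \<Sum>k. (cmod (taylor (v n) k - taylor g k))\<^sup>2 * weight \<xi> k) \<longlonglongrightarrow> (\<Sum>k. 0)"
  proof (rule tannerys_theorem[THEN conjunct2, THEN conjunct2])
    show "(\<lambda>n. (cmod (taylor (v n) k - taylor g k))\<^sup>2 * weight \<xi> k) \<longlonglongrightarrow> 0" for k
    proof -
      have "(\<lambda>n. (cmod (taylor (v n) k - taylor g k))\<^sup>2 * weight \<xi> k) \<longlonglongrightarrow> (cmod (taylor g k - taylor g k))\<^sup>2 * weight \<xi> k"
        by (intro tendsto_intros lim)
      then show ?thesis by simp
    qed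
    show "\<forall>\<^sub>F (k, n) in sequentially \<times>\<^sub>F sequentially. norm ((cmod (taylor (v n) k - taylor g k))\<^sup>2 * weight \<xi> k) \<le> M k"
      using bound weight_pos[OF assms(1)] by (intro always_eventually) (auto simp: less_imp_le)
  qed (use assms in auto)
  moreover have "(\<Sum>k. (cmod (taylor (v n) k - taylor g k))\<^sup>2 * weight \<xi> k) = (bergman_norm \<xi> (\<lambda>z. v n z - g z))\<^sup>2" for n
    using sums_unique[OF bergman_norm_sums(1)[OF assms(1) bergman_diff(1)[OF assms(1) assms(3) assms(2)]]]
      bergman_diff(2)[OF assms(1) assms(3) assms(2)] by simp
  ultimately show ?thesis
    using assms by (simp add: bergman_tendsto_iff[OF assms(1)])
qed

lemma norm_sum3_square_le:
  fixes x y z :: complex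
  shows "(cmod (x + y + z))\<^sup>2 \<le> 3 * ((cmod x)\<^sup>2 + (cmod y)\<^sup>2 + (cmod z)\<^sup>2)"
proof -
  have "cmod (x + y + z) \<le> cmod x + cmod y + cmod z"
    by (meson add_right_mono norm_triangle_ineq norm_triangle_le order_trans)
  then have "(cmod (x + y + z))\<^sup>2 \<le> (cmod x + cmod y + cmod z)\<^sup>2"
    by (rule power_mono) simp
  also have "\<dots> \<le> 3 * ((cmod x)\<^sup>2 + (cmod y)\<^sup>2 + (cmod z)\<^sup>2)"
    using sum_squares_bound[of "cmod x" "cmod y"] sum_squares_bound[of "cmod x" "cmod z"]
      sum_squares_bound[of "cmod y" "cmod z"] by (simp add: power2_sum algebra_simps power2_eq_square)
  finally show ?thesis .
qed

text \<open>
  The approximants are the polynomials \<open>v\<^sub>n\<close> with coefficients \<open>\<chi>\<^sub>n(k) x\<^sub>k\<close>, where \<open>\<chi>\<^sub>n\<close> are Fejer's weights.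
  Applying the Jacobi matrix gives \<open>\<chi>\<^sub>n(k)\<close> times the image of \<open>x\<close> plus the commutator of the matrix with
  \<open>\<chi>\<^sub>n\<close>, whose entries are off-diagonal entries of size \<open>O(k)\<close> times differences of \<open>\<chi>\<^sub>n\<close>. By the slope bound they
  are bounded uniformly in \<open>n\<close> and tend to 0 for fixed \<open>k\<close>, so Tannery's theorem applies. This is the
  step where linear growth of the entries, an instance of Carleman's condition, enters.
\<close>

lemma max_op_approx:
  assumes "\<xi> > -1" "(g, h) \<in> max_op \<xi> a b c"
  shows "\<exists>v w. (\<forall>n. (v n, w n) \<in> diff_op \<xi> a b c) \<and>
    bergman_tendsto \<xi> v g sequentially \<and> bergman_tendsto \<xi> w h sequentially"
proof -
  define x y where "x = taylor g" and "y = taylor h"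
  have gh: "g \<in> bergman \<xi>" "h \<in> bergman \<xi>" and y: "\<And>k. y k = jacobi \<xi> a b c x k"
    using assms(2) by (auto simp: max_op_def x_def y_def)
  have "\<exists>f\<in>poly_disc. \<forall>k. taylor f k = of_real (fejer n k) * x k" for n
    by (rule ex_poly_disc_taylor[of "Suc n"]) (simp add: fejer_eq_0)
  then obtain v where v: "\<And>n. v n \<in> poly_disc" "\<And>n k. taylor (v n) k = of_real (fejer n k) * x k"
    by metis
  define w where "w n = diff_expr \<xi> a b c (v n)" for n
  have L: "(v n, w n) \<in> diff_op \<xi> a b c" for n
    using v(1) by (auto simp: w_def diff_op_def diff_expr_def)
  then have mo: "(v n, w n) \<in> max_op \<xi> a b c" for n
    unfolding diff_op_eq[OF assms(1)] by auto
  have wb: "w n \<in> bergman \<xi>" "v n \<in> bergman \<xi>"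
    and tw: "taylor (w n) k = jacobi \<xi> a b c (\<lambda>k. of_real (fejer n k) * x k) k" for n k
    using mo[of n] v(2)[of n] by (auto simp: max_op_def fun_eq_iff jacobi_def)
  note pos = weight_pos[OF assms(1)]
  define G H where "G k = (cmod (x k))\<^sup>2 * weight \<xi> k" and "H k = (cmod (y k))\<^sup>2 * weight \<xi> k" for k
  have G: "summable G" and H: "summable H"
    using bergman_iff_summable[OF assms(1) bergman_hol_disc[OF gh(1)]]
      bergman_iff_summable[OF assms(1) bergman_hol_disc[OF gh(2)]] gh
    unfolding G_def H_def x_def y_def by simp_all
  have G0: "G k \<ge> 0" for k using pos[of k] by (simp add: G_def)
  have 1: "bergman_tendsto \<xi> v g sequentially"
  proof (rule bergman_tendsto_taylor_series[OF assms(1) gh(1) wb(2) G])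
    fix n k
    have "cmod (taylor (v n) k - taylor g k) = \<bar>fejer n k - 1\<bar> * cmod (x k)"
    proof -
      have "taylor (v n) k - taylor g k = of_real (fejer n k - 1) * x k"
        by (simp add: v x_def algebra_simps)
      then show ?thesis by (simp only: norm_mult norm_of_real)
    qed
    also have "\<dots> \<le> 1 * cmod (x k)"
      using fejer_bounds[of n k] by (intro mult_right_mono) auto
    finally show "(cmod (taylor (v n) k - taylor g k))\<^sup>2 * weight \<xi> k \<le> G k"
      unfolding G_def using pos[of k] by (intro mult_right_mono power_mono) auto
    show "(\<lambda>n. taylor (v n) k) \<longlonglongrightarrow> taylor g k"
      unfolding v using tendsto_mult[OF tendsto_of_real[OF fejer_tendsto[of k]] tendsto_const[of "x k"]]
      by (simp add: x_def)
  qed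
  define K where "K = (cmod c)\<^sup>2 * (\<xi> + 2)"
  define M where "M k = 3 * (H k + K * (if k = 0 then 0 else G (k - 1)) + K * G (Suc k))" for k
  have "summable (\<lambda>k. if k = 0 then 0 else G (k - 1))"
    using G by (subst summable_Suc_iff[symmetric]) simp
  moreover have "summable (\<lambda>k. G (Suc k))"
    using G by (subst summable_Suc_iff)
  ultimately have M: "summable M"
    unfolding M_def by (intro summable_mult summable_add H)
  \<comment> \<open>one factor of \<open>k\<close> is absorbed by each of the two slopes; the recursion of the weights moves the weight to the index of the coefficient\<close>
  have up: "(cmod (c * of_real ((real k + \<xi> + 2) * (fejer n k - fejer n (Suc k))) * x k))\<^sup>2 * weight \<xi> (Suc k) \<le> K * G k" for n k
  proof -
    define \<delta> where "\<delta> = \<bar>fejer n (Suc k) - fejer n k\<bar>"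
    have "cmod (c * of_real ((real k + \<xi> + 2) * (fejer n k - fejer n (Suc k))) * x k)
      = cmod c * ((real k + \<xi> + 2) * \<delta>) * cmod (x k)"
      using assms(1) unfolding norm_mult norm_of_real abs_mult \<delta>_def by (simp add: abs_minus_commute)
    then have "(cmod (c * of_real ((real k + \<xi> + 2) * (fejer n k - fejer n (Suc k))) * x k))\<^sup>2 * weight \<xi> (Suc k)
      = (cmod c)\<^sup>2 * (cmod (x k))\<^sup>2 * (real k + \<xi> + 2) * \<delta>\<^sup>2 * ((real k + \<xi> + 2) * weight \<xi> (Suc k))"
      by (simp add: power2_eq_square algebra_simps)
    also have "\<dots> = (cmod c)\<^sup>2 * G k * (((real k + \<xi> + 2) * \<delta>) * ((real k + 1) * \<delta>))"
      unfolding weight_Suc[OF assms(1)] G_def by (simp add: power2_eq_square algebra_simps)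
    also have "\<dots> \<le> (cmod c)\<^sup>2 * G k * ((\<xi> + 2) * 1)"
    proof (intro mult_left_mono mult_mono)
      have "(real k + \<xi> + 2) * \<delta> \<le> ((\<xi> + 2) * (real k + 1)) * \<delta>"
        using assms(1) mult_nonneg_nonneg[of "real k" "\<xi> + 1"] by (intro mult_right_mono) (auto simp: \<delta>_def algebra_simps)
      also have "\<dots> \<le> \<xi> + 2"
        using fejer_slope[of k n] assms(1) mult_left_mono[of "(real k + 1) * \<delta>" 1 "\<xi> + 2"] by (simp add: \<delta>_def mult_ac)
      finally show "(real k + \<xi> + 2) * \<delta> \<le> \<xi> + 2" .
      show "(real k + 1) * \<delta> \<le> 1" using fejer_slope[of k n] by (simp add: \<delta>_def)
    qed (use G0 assms(1) in \<open>auto simp: \<delta>_def\<close>)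
    finally show ?thesis by (simp add: K_def mult_ac)
  qed
  have down: "(cmod (cnj c * of_real ((real k + 1) * (fejer n (Suc k) - fejer n k)) * x (Suc k)))\<^sup>2 * weight \<xi> k \<le> K * G (Suc k)" for n k
  proof -
    define \<delta> where "\<delta> = \<bar>fejer n (Suc k) - fejer n k\<bar>"
    have s: "(real k + 1) * \<delta> \<le> 1" using fejer_slope[of k n] by (simp add: \<delta>_def)
    have "cmod (cnj c * of_real ((real k + 1) * (fejer n (Suc k) - fejer n k)) * x (Suc k))
      = cmod c * ((real k + 1) * \<delta>) * cmod (x (Suc k))"
      unfolding norm_mult norm_of_real abs_mult \<delta>_def by simp
    then have "(cmod (cnj c * of_real ((real k + 1) * (fejer n (Suc k) - fejer n k)) * x (Suc k)))\<^sup>2 * weight \<xi> k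
      = (cmod c)\<^sup>2 * (cmod (x (Suc k)))\<^sup>2 * (((real k + 1) * \<delta>) * \<delta>) * ((real k + 1) * weight \<xi> k)"
      by (simp add: power2_eq_square algebra_simps)
    also have "\<dots> = (cmod c)\<^sup>2 * G (Suc k) * (((real k + 1) * \<delta>) * ((real k + \<xi> + 2) * \<delta>))"
      unfolding weight_Suc[OF assms(1), symmetric] G_def by (simp add: power2_eq_square algebra_simps)
    also have "\<dots> \<le> (cmod c)\<^sup>2 * G (Suc k) * (1 * (\<xi> + 2))"
    proof (intro mult_left_mono mult_mono s)
      have "(real k + \<xi> + 2) * \<delta> \<le> ((\<xi> + 2) * (real k + 1)) * \<delta>"
        using assms(1) mult_nonneg_nonneg[of "real k" "\<xi> + 1"] by (intro mult_right_mono) (auto simp: \<delta>_def algebra_simps)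
      also have "\<dots> \<le> \<xi> + 2"
        using s assms(1) mult_left_mono[of "(real k + 1) * \<delta>" 1 "\<xi> + 2"] by (simp add: mult_ac)
      finally show "(real k + \<xi> + 2) * \<delta> \<le> \<xi> + 2" .
    qed (use G0 assms(1) in \<open>auto simp: \<delta>_def\<close>)
    finally show ?thesis by (simp add: K_def mult_ac)
  qed
  have 2: "bergman_tendsto \<xi> w h sequentially"
  proof (rule bergman_tendsto_taylor_series[OF assms(1) gh(2) wb(1) M])
    fix n k
    \<comment> \<open>\<open>?A\<close> and \<open>?B\<close> are the two off-diagonal terms of the commutator\<close>
    let ?A = "c * of_real (real k + \<xi> + 1) * (if k = 0 then 0 else of_real (fejer n (k - 1) - fejer n k) * x (k - 1))"
    let ?B = "cnj c * of_real ((real k + 1) * (fejer n (Suc k) - fejer n k)) * x (Suc k)"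
    have d: "taylor (w n) k - taylor h k = of_real (fejer n k - 1) * y k + ?A + ?B"
      unfolding tw y_def[symmetric] y jacobi_def by (cases k) (simp_all add: algebra_simps)
    have q1: "(cmod (of_real (fejer n k - 1) * y k))\<^sup>2 * weight \<xi> k \<le> H k"
    proof -
      have "cmod (of_real (fejer n k - 1) * y k) \<le> 1 * cmod (y k)"
        unfolding norm_mult norm_of_real using fejer_bounds[of n k] by (intro mult_right_mono) auto
      then show ?thesis
        unfolding H_def using pos[of k] by (intro mult_right_mono power_mono) auto
    qed
    have q2: "(cmod ?A)\<^sup>2 * weight \<xi> k \<le> K * (if k = 0 then 0 else G (k - 1))"
    proof (cases k)
      case (Suc j)
      then show ?thesis using up[of j n] by (simp add: mult_ac add_ac)
    qed simp
    have q3: "(cmod (of_real (fejer n k - 1) * y k + ?A + ?B))\<^sup>2 * weight \<xi> k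
       \<le> 3 * ((cmod (of_real (fejer n k - 1) * y k))\<^sup>2 + (cmod ?A)\<^sup>2 + (cmod ?B)\<^sup>2) * weight \<xi> k"
      using pos[of k] by (intro mult_right_mono norm_sum3_square_le) auto
    have "t \<le> 3 * (h + p + q)"
      if "x * w \<le> h" "y * w \<le> p" "z * w \<le> q" "t \<le> 3 * (x + y + z) * w" for x y z w h p q t :: real
      using that by (simp add: algebra_simps)
    from this[OF q1 q2 down[of k n] q3]
    show "(cmod (taylor (w n) k - taylor h k))\<^sup>2 * weight \<xi> k \<le> M k"
      unfolding d M_def .
    have lim: "(\<lambda>n. of_real (fejer n k) * x k) \<longlonglongrightarrow> x k" for k
      using tendsto_mult[OF tendsto_of_real[OF fejer_tendsto[of k]] tendsto_const[of "x k"]] by simp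
    have "(\<lambda>n. jacobi \<xi> a b c (\<lambda>k. of_real (fejer n k) * x k) k) \<longlonglongrightarrow> jacobi \<xi> a b c x k"
      unfolding jacobi_def by (cases k; simp; intro tendsto_intros lim)
    then show "(\<lambda>n. taylor (w n) k) \<longlonglongrightarrow> taylor h k"
      unfolding tw y_def[symmetric] y .
  qed
  from L 1 2 show ?thesis by blast
qed

text \<open>
  Each row of the matrix involves only three coefficients, and coefficients are continuous for norm
  convergence.
\<close>

lemma max_op_closed:
  assumes "\<xi> > -1" "\<And>n. (v n, w n) \<in> max_op \<xi> a b c"
    "bergman_tendsto \<xi> v g sequentially" "bergman_tendsto \<xi> w h sequentially"
  shows "(g, h) \<in> max_op \<xi> a b c"
proof -
  have "taylor h k = jacobi \<xi> a b c (taylor g) k" for k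
  proof (rule LIMSEQ_unique)
    show "(\<lambda>n. taylor (w n) k) \<longlonglongrightarrow> taylor h k"
      by (rule bergman_tendsto_taylor) fact+
    note lim = bergman_tendsto_taylor[OF assms(1,3)]
    have "(\<lambda>n. jacobi \<xi> a b c (taylor (v n)) k) \<longlonglongrightarrow> jacobi \<xi> a b c (taylor g) k"
      unfolding jacobi_def by (cases k; simp; intro tendsto_intros lim)
    moreover have "taylor (w n) k = jacobi \<xi> a b c (taylor (v n)) k" for n
      using assms(2)[of n] by (simp add: max_op_def)
    ultimately show "(\<lambda>n. taylor (w n) k) \<longlonglongrightarrow> jacobi \<xi> a b c (taylor g) k" by simp
  qed
  then show ?thesis using assms(3,4) by (simp add: max_op_def bergman_tendsto_def)
qed

lemma closure_diff_op:
  assumes "\<xi> > -1"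
  shows "closure_operator \<xi> (diff_op \<xi> a b c) = max_op \<xi> a b c"
proof (intro set_eqI iffI; clarify)
  fix g h assume "(g, h) \<in> closure_operator \<xi> (diff_op \<xi> a b c)"
  then obtain v w where "\<And>n. (v n, w n) \<in> diff_op \<xi> a b c"
    "bergman_tendsto \<xi> v g sequentially" "bergman_tendsto \<xi> w h sequentially"
    by (auto simp: closure_operator_def)
  then show "(g, h) \<in> max_op \<xi> a b c"
    unfolding diff_op_eq[OF assms] using max_op_closed[OF assms, of v w] by simp
next
  fix g h assume "(g, h) \<in> max_op \<xi> a b c"
  from max_op_approx[OF assms this] show "(g, h) \<in> closure_operator \<xi> (diff_op \<xi> a b c)"
    unfolding closure_operator_def by blast
qed

lemma bergman_Cauchy_Schwarz:
  assumes "\<xi> > -1" "f \<in> bergman \<xi>" "g \<in> bergman \<xi>"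
  shows "cmod (bergman_inner \<xi> f g) \<le> bergman_norm \<xi> f * bergman_norm \<xi> g"
proof (rule LIMSEQ_le_const2)
  let ?p = "\<lambda>n. \<Sum>k<n. taylor f k * cnj (taylor g k) * of_real (weight \<xi> k)"
  show "(\<lambda>n. cmod (?p n)) \<longlonglongrightarrow> cmod (bergman_inner \<xi> f g)"
    using bergman_inner_sums[OF assms] by (intro tendsto_norm) (simp add: sums_def)
  have pos: "weight \<xi> k \<ge> 0" for k using weight_pos[OF assms(1), of k] by simp
  have e: "(p * sqrt (weight \<xi> k)) * (q * sqrt (weight \<xi> k)) = p * q * weight \<xi> k" for p q k
  proof -
    have "(p * sqrt (weight \<xi> k)) * (q * sqrt (weight \<xi> k)) = p * q * (sqrt (weight \<xi> k) * sqrt (weight \<xi> k))"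
      by (simp only: mult_ac)
    then show ?thesis using pos by simp
  qed
  have part: "(\<Sum>k<n. (cmod (taylor f k) * sqrt (weight \<xi> k))\<^sup>2) \<le> (bergman_norm \<xi> f)\<^sup>2" if "f \<in> bergman \<xi>" for f n
    using sum_le_suminf[OF sums_summable[OF bergman_norm_sums(1)[OF assms(1) that]], of "{..<n}"]
    unfolding sums_unique[OF bergman_norm_sums(1)[OF assms(1) that], symmetric]
    by (simp add: power_mult_distrib pos)
  have "cmod (?p n) \<le> bergman_norm \<xi> f * bergman_norm \<xi> g" for n
  proof (rule power2_le_imp_le)
    have "cmod (?p n) \<le> (\<Sum>k<n. (cmod (taylor f k) * sqrt (weight \<xi> k)) * (cmod (taylor g k) * sqrt (weight \<xi> k)))"
      unfolding e using pos by (intro sum_norm_le) (simp add: norm_mult)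
    then have "(cmod (?p n))\<^sup>2 \<le> (\<Sum>k<n. (cmod (taylor f k) * sqrt (weight \<xi> k)) * (cmod (taylor g k) * sqrt (weight \<xi> k)))\<^sup>2"
      by (rule power_mono) simp
    also have "\<dots> \<le> (\<Sum>k<n. (cmod (taylor f k) * sqrt (weight \<xi> k))\<^sup>2) * (\<Sum>k<n. (cmod (taylor g k) * sqrt (weight \<xi> k))\<^sup>2)"
      by (rule Cauchy_Schwarz_ineq_sum)
    also have "\<dots> \<le> (bergman_norm \<xi> f)\<^sup>2 * (bergman_norm \<xi> g)\<^sup>2"
      by (intro mult_mono part assms sum_nonneg) auto
    finally show "(cmod (?p n))\<^sup>2 \<le> (bergman_norm \<xi> f * bergman_norm \<xi> g)\<^sup>2"
      by (simp add: power_mult_distrib)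
  qed simp
  then show "\<exists>N. \<forall>n\<ge>N. cmod (?p n) \<le> bergman_norm \<xi> f * bergman_norm \<xi> g" by blast
qed

lemma bergman_inner_tendsto:
  assumes "\<xi> > -1" "bergman_tendsto \<xi> v f F" "g \<in> bergman \<xi>"
  shows "((\<lambda>t. bergman_inner \<xi> (v t) g) \<longlongrightarrow> bergman_inner \<xi> f g) F"
proof -
  have f: "f \<in> bergman \<xi>" and v: "\<forall>\<^sub>F t in F. v t \<in> bergman \<xi>"
    and l: "((\<lambda>t. bergman_norm \<xi> (\<lambda>z. v t z - f z)) \<longlongrightarrow> 0) F"
    using assms(2) by (auto simp: bergman_tendsto_def)
  have "\<forall>\<^sub>F t in F. norm (bergman_inner \<xi> (v t) g - bergman_inner \<xi> f g) \<le> norm (bergman_norm \<xi> (\<lambda>z. v t z - f z)) * bergman_norm \<xi> g"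
    using v
  proof eventually_elim
    case (elim t)
    note d = bergman_diff[OF assms(1) elim f]
    have "bergman_inner \<xi> (\<lambda>z. v t z - f z) g = bergman_inner \<xi> (v t) g - bergman_inner \<xi> f g"
      using sums_diff[OF bergman_inner_sums[OF assms(1) elim assms(3)] bergman_inner_sums[OF assms(1) f assms(3)]]
        bergman_inner_sums[OF assms(1) d(1) assms(3)] sums_unique2
      unfolding d(2) by (fastforce simp: algebra_simps)
    then show ?case
      using bergman_Cauchy_Schwarz[OF assms(1) d(1) assms(3)] by simp
  qed
  from tendsto_0_le[OF l this] show ?thesis
    by (rule LIM_zero_cancel)
qed

text \<open>
  Approximate the first pair by polynomials, for which the identity is a finite summation by parts, and
  pass to the limit in the inner products.
\<close>

lemma max_op_symmetric:
  assumes "\<xi> > -1" and f: "(f, f') \<in> max_op \<xi> a b c" and g: "(g, h) \<in> max_op \<xi> a b c"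
  shows "bergman_inner \<xi> f' g = bergman_inner \<xi> f h"
proof -
  from max_op_approx[OF assms(1) f] obtain v w where v: "\<And>n. (v n, w n) \<in> diff_op \<xi> a b c"
    "bergman_tendsto \<xi> v f sequentially" "bergman_tendsto \<xi> w f' sequentially" by blast
  have gh: "g \<in> bergman \<xi>" "h \<in> bergman \<xi>" using g by (auto simp: max_op_def)
  have "(\<lambda>n. bergman_inner \<xi> (w n) g) \<longlonglongrightarrow> bergman_inner \<xi> f' g"
    by (rule bergman_inner_tendsto[OF assms(1) v(3) gh(1)])
  moreover have "bergman_inner \<xi> (w n) g = bergman_inner \<xi> (v n) h" for n
    by (rule diff_op_symmetric[OF assms(1) v(1) g])
  ultimately show ?thesis
    using bergman_inner_tendsto[OF assms(1) v(2) gh(2)] LIMSEQ_unique by auto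
qed

text \<open>
  A larger operator has a smaller adjoint, so the adjoint of the maximal operator lies in the adjoint
  of the operator on polynomials, hence in the maximal operator. The reverse inclusion is symmetry.
\<close>

lemma adjoint_max_op:
  assumes "\<xi> > -1"
  shows "adjoint_operator \<xi> (max_op \<xi> a b c) = max_op \<xi> a b c"
proof
  have "adjoint_operator \<xi> (max_op \<xi> a b c) \<subseteq> adjoint_operator \<xi> (diff_op \<xi> a b c)"
    unfolding adjoint_operator_def diff_op_eq[OF assms] by blast
  then show "adjoint_operator \<xi> (max_op \<xi> a b c) \<subseteq> max_op \<xi> a b c"
    using adjoint_diff_op_subset[OF assms] by blast
  show "max_op \<xi> a b c \<subseteq> adjoint_operator \<xi> (max_op \<xi> a b c)"
  proof clarify
    fix g h assume gh: "(g, h) \<in> max_op \<xi> a b c"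
    have "g \<in> bergman \<xi>" "h \<in> bergman \<xi>" using gh by (auto simp: max_op_def)
    then show "(g, h) \<in> adjoint_operator \<xi> (max_op \<xi> a b c)"
      using max_op_symmetric[OF assms _ gh] unfolding adjoint_operator_def by blast
  qed
qed

lemma jacobi_lincomb:
  "jacobi \<xi> a b c (\<lambda>k. \<alpha> * x k + \<beta> * y k) k = \<alpha> * jacobi \<xi> a b c x k + \<beta> * jacobi \<xi> a b c y k"
  by (cases k) (simp_all add: jacobi_def algebra_simps)

lemma max_op_lincomb:
  assumes "\<xi> > -1" "(f, f') \<in> max_op \<xi> a b c" "(g, g') \<in> max_op \<xi> a b c"
  shows "((\<lambda>z. \<alpha> * f z + \<beta> * g z), (\<lambda>z. \<alpha> * f' z + \<beta> * g' z)) \<in> max_op \<xi> a b c"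
proof -
  have h: "f \<in> bergman \<xi>" "f' \<in> bergman \<xi>" "g \<in> bergman \<xi>" "g' \<in> bergman \<xi>"
    "\<And>k. taylor f' k = jacobi \<xi> a b c (taylor f) k" "\<And>k. taylor g' k = jacobi \<xi> a b c (taylor g) k"
    using assms by (auto simp: max_op_def)
  have t: "taylor (\<lambda>z. \<alpha> * f z + \<beta> * g z) = (\<lambda>k. \<alpha> * taylor f k + \<beta> * taylor g k)"
    by (rule ext) (rule taylor_lincomb[OF h(1,3)[THEN bergman_hol_disc]])
  show ?thesis
    using h unfolding max_op_def
    by (simp add: t jacobi_lincomb taylor_lincomb[OF h(2,4)[THEN bergman_hol_disc]] bergman_lincomb(1)[OF assms(1)])
qed

lemma zero_poly_disc: "(\<lambda>_. 0) \<in> poly_disc"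
proof -
  have "(\<lambda>_. 0) = on_disc (poly 0)" by (rule ext) (simp add: on_disc_def)
  then show ?thesis unfolding poly_disc_def by blast
qed

lemma poly_disc_lincomb:
  assumes "f \<in> poly_disc" "g \<in> poly_disc"
  shows "(\<lambda>z. \<alpha> * f z + \<beta> * g z) \<in> poly_disc"
proof -
  obtain p q where "f = on_disc (poly p)" "g = on_disc (poly q)"
    using assms by (auto simp: poly_disc_def)
  then have "(\<lambda>z. \<alpha> * f z + \<beta> * g z) = on_disc (poly (smult \<alpha> p + smult \<beta> q))"
    by (intro ext) (simp add: on_disc_def)
  then show ?thesis unfolding poly_disc_def by blast
qed

lemma zero_max_op:
  assumes "\<xi> > -1"
  shows "((\<lambda>_. 0), (\<lambda>_. 0)) \<in> max_op \<xi> a b c"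
proof -
  have b: "(\<lambda>_. 0) \<in> bergman \<xi>" by (rule poly_disc_bergman[OF assms zero_poly_disc])
  have "taylor (\<lambda>_. 0) k = 0" for k
    using taylor_poly_disc(2)[of 0 k] by (simp add: on_disc_def cong: if_cong)
  then show ?thesis using b by (simp add: max_op_def jacobi_def)
qed

text \<open>
  The domain restriction is kept general so that it covers the maximal operator and the operator on
  polynomials alike.
\<close>

lemma linear_max_op:
  assumes "\<xi> > -1" and D: "(\<lambda>_. 0) \<in> D" "\<And>f g \<alpha> \<beta>. f \<in> D \<Longrightarrow> g \<in> D \<Longrightarrow> (\<lambda>z. \<alpha> * f z + \<beta> * g z) \<in> D"
  shows "linear_operator \<xi> {(f, g) \<in> max_op \<xi> a b c. f \<in> D}"
  unfolding linear_operator_def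
proof (intro conjI)
  show "{(f, g) \<in> max_op \<xi> a b c. f \<in> D} \<subseteq> bergman \<xi> \<times> bergman \<xi>"
    by (auto simp: max_op_def)
  show "single_valued {(f, g) \<in> max_op \<xi> a b c. f \<in> D}"
    by (rule single_valuedI, rule hol_disc_eqI) (auto simp: max_op_def bergman_hol_disc)
  show "((\<lambda>_. 0), (\<lambda>_. 0)) \<in> {(f, g) \<in> max_op \<xi> a b c. f \<in> D}"
    using zero_max_op[OF assms(1)] D(1) by simp
  show "\<forall>(f, f') \<in> {(f, g) \<in> max_op \<xi> a b c. f \<in> D}. \<forall>(g, g') \<in> {(f, g) \<in> max_op \<xi> a b c. f \<in> D}.
      ((\<lambda>z. f z + g z), (\<lambda>z. f' z + g' z)) \<in> {(f, g) \<in> max_op \<xi> a b c. f \<in> D}"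
    using max_op_lincomb[OF assms(1), where \<alpha>=1 and \<beta>=1] D(2)[where \<alpha>=1 and \<beta>=1] by auto
  show "\<forall>(f, f') \<in> {(f, g) \<in> max_op \<xi> a b c. f \<in> D}. \<forall>r.
      ((\<lambda>z. r * f z), (\<lambda>z. r * f' z)) \<in> {(f, g) \<in> max_op \<xi> a b c. f \<in> D}"
    using max_op_lincomb[OF assms(1), where \<beta>=0] D(2)[where \<beta>=0] by auto
qed

lemma densely_defined_poly:
  assumes "\<xi> > -1" "poly_disc \<subseteq> Domain A"
  shows "densely_defined \<xi> A"
  unfolding densely_defined_def
proof
  fix f assume f: "f \<in> bergman \<xi>"
  have "\<exists>p\<in>poly_disc. \<forall>k. taylor p k = (if k < n then taylor f k else 0)" for n
    by (rule ex_poly_disc_taylor[of n]) simp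
  then obtain v where v: "\<And>n. v n \<in> poly_disc" "\<And>n k. taylor (v n) k = (if k < n then taylor f k else 0)"
    by metis
  have "bergman_tendsto \<xi> v f sequentially"
  proof (rule bergman_tendsto_taylor_series[OF assms(1) f])
    show "v n \<in> bergman \<xi>" for n by (rule poly_disc_bergman[OF assms(1) v(1)])
    show "summable (\<lambda>k. (cmod (taylor f k))\<^sup>2 * weight \<xi> k)"
      using f bergman_iff_summable[OF assms(1) bergman_hol_disc[OF f]] by simp
    show "(cmod (taylor (v n) k - taylor f k))\<^sup>2 * weight \<xi> k \<le> (cmod (taylor f k))\<^sup>2 * weight \<xi> k" for n k
      using weight_pos[OF assms(1), of k] by (simp add: v)
    show "(\<lambda>n. taylor (v n) k) \<longlonglongrightarrow> taylor f k" for k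
      unfolding v by (rule tendsto_eventually) (use eventually_gt_at_top[of k] in eventually_elim, simp)
  qed
  then show "\<exists>v. (\<forall>n. v n \<in> Domain A) \<and> bergman_tendsto \<xi> v f sequentially"
    using v(1) assms(2) by blast
qed

lemma poly_disc_Domain_diff_op: "poly_disc \<subseteq> Domain (diff_op \<xi> a b c)"
  unfolding diff_op_def by blast

lemma symmetric_diff_op:
  assumes "\<xi> > -1"
  shows "symmetric_operator \<xi> (diff_op \<xi> a b c)"
  unfolding symmetric_operator_def
proof (intro conjI)
  show "linear_operator \<xi> (diff_op \<xi> a b c)"
    unfolding diff_op_eq[OF assms] by (rule linear_max_op[OF assms zero_poly_disc poly_disc_lincomb])
  show "densely_defined \<xi> (diff_op \<xi> a b c)"
    by (rule densely_defined_poly[OF assms poly_disc_Domain_diff_op])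
  show "\<forall>(f, f') \<in> diff_op \<xi> a b c. \<forall>(g, g') \<in> diff_op \<xi> a b c. bergman_inner \<xi> f' g = bergman_inner \<xi> f g'"
    using max_op_symmetric[OF assms] unfolding diff_op_eq[OF assms] by blast
qed

lemma self_adjoint_max_op:
  assumes "\<xi> > -1"
  shows "self_adjoint_operator \<xi> (max_op \<xi> a b c)"
  unfolding self_adjoint_operator_def
proof (intro conjI)
  show "linear_operator \<xi> (max_op \<xi> a b c)"
    using linear_max_op[OF assms, of UNIV a b c] by simp
  show "densely_defined \<xi> (max_op \<xi> a b c)"
    using poly_disc_Domain_diff_op[of \<xi> a b c] unfolding diff_op_eq[OF assms]
    by (intro densely_defined_poly[OF assms]) blast
  show "adjoint_operator \<xi> (max_op \<xi> a b c) = max_op \<xi> a b c"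
    by (rule adjoint_max_op[OF assms])
qed

section \<open>Smooth vectors\<close>

text \<open>
  The weights decay at most polynomially: by Bernoulli's inequality
  \<open>((k + 2) / (k + 1))\<^sup>M \<ge> 1 + M / (k + 1)\<close>, which dominates the factor \<open>(k + \<xi> + 2) / (k + 1)\<close> lost in each step.
\<close>

lemma weight_ge:
  assumes "\<xi> > -1" "real M \<ge> \<xi> + 1"
  shows "weight \<xi> 0 \<le> weight \<xi> k * (real k + 1) ^ M"
proof (induction k)
  case (Suc k)
  have "(1 + real M * (1 / (real k + 1))) \<le> (1 + 1 / (real k + 1)) ^ M"
    by (rule Bernoulli_inequality) (simp add: field_simps)
  also have "(1 + 1 / (real k + 1)) = (real k + 2) / (real k + 1)"
    by (simp add: field_simps)
  finally have "(real k + 1) ^ M * (1 + real M / (real k + 1)) \<le> (real k + 2) ^ M"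
    by (simp add: power_divide field_simps)
  moreover have "1 + real M / (real k + 1) \<ge> (real k + \<xi> + 2) / (real k + 1)"
  proof -
    have "(real k + \<xi> + 2) / (real k + 1) = 1 + (\<xi> + 1) / (real k + 1)"
      by (simp add: field_simps)
    then show ?thesis using assms(2) by (simp add: divide_right_mono)
  qed
  ultimately have "(real k + 1) ^ M * ((real k + \<xi> + 2) / (real k + 1)) \<le> (real k + 2) ^ M"
    by (meson mult_left_mono order_trans zero_le_power of_nat_0_le_iff add_nonneg_nonneg zero_le_one)
  then have *: "(real k + 1) ^ M * (real k + \<xi> + 2) \<le> (real k + 2) ^ M * (real k + 1)"
    by (simp add: field_simps)
  have p: "real k + \<xi> + 2 > 0" using assms(1) by linarith
  have "(weight \<xi> k * (real k + 1) ^ M) * (real k + \<xi> + 2) \<le> weight \<xi> k * ((real k + 2) ^ M * (real k + 1))"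
    using mult_left_mono[OF * less_imp_le[OF weight_pos[OF assms(1), of k]]] by (simp add: mult_ac)
  also have "\<dots> = ((real k + \<xi> + 2) * weight \<xi> (Suc k)) * (real k + 2) ^ M"
    unfolding weight_Suc[OF assms(1)] by (simp add: mult_ac)
  finally have "(weight \<xi> k * (real k + 1) ^ M) * (real k + \<xi> + 2) \<le> (weight \<xi> (Suc k) * (real k + 2) ^ M) * (real k + \<xi> + 2)"
    by (simp add: mult_ac)
  then have "weight \<xi> k * (real k + 1) ^ M \<le> weight \<xi> (Suc k) * (real k + 2) ^ M"
    using p by (rule mult_right_le_imp_le)
  then show ?case using Suc.IH by (simp add: add_ac)
qed simp

lemma smooth_vectors_iff:
  assumes "\<xi> > -1"
  shows "f \<in> smooth_vectors \<xi> \<longleftrightarrow> f \<in> hol_disc \<and>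
    (\<forall>m. summable (\<lambda>k. (cmod (taylor f k))\<^sup>2 * weight \<xi> k * (\<xi> * (\<xi> + 2) + 2 * real k) ^ (2 * m)))"
proof
  assume "f \<in> smooth_vectors \<xi>"
  then obtain a where f: "f \<in> hol_disc" and a: "\<And>z. z \<in> unit_disc \<Longrightarrow> (\<lambda>k. a k * z ^ k) sums f z"
    and s: "\<And>m. summable (\<lambda>k. (cmod (a k))\<^sup>2 * weight \<xi> k * (\<xi> * (\<xi> + 2) + 2 * real k) ^ (2 * m))"
    unfolding smooth_vectors_def bergman_norm_power[OF assms] by blast
  have "taylor f k = a k" for k using a f by (rule taylor_unique)
  then show "f \<in> hol_disc \<and>
    (\<forall>m. summable (\<lambda>k. (cmod (taylor f k))\<^sup>2 * weight \<xi> k * (\<xi> * (\<xi> + 2) + 2 * real k) ^ (2 * m)))"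
    using f s by simp
next
  assume "f \<in> hol_disc \<and>
    (\<forall>m. summable (\<lambda>k. (cmod (taylor f k))\<^sup>2 * weight \<xi> k * (\<xi> * (\<xi> + 2) + 2 * real k) ^ (2 * m)))"
  then show "f \<in> smooth_vectors \<xi>"
    unfolding smooth_vectors_def bergman_norm_power[OF assms] using taylor_sums by blast
qed

lemma poly_disc_smooth:
  assumes "\<xi> > -1" "f \<in> poly_disc"
  shows "f \<in> smooth_vectors \<xi>"
proof -
  obtain N where N: "\<forall>k\<ge>N. taylor f k = 0"
    using poly_disc_taylor_finite[OF assms(2)] by blast
  have "summable (\<lambda>k. (cmod (taylor f k))\<^sup>2 * weight \<xi> k * (\<xi> * (\<xi> + 2) + 2 * real k) ^ (2 * m))" for m
    by (rule summable_finite[of "{..<N}"]) (use N in \<open>auto simp: not_less\<close>)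
  then show ?thesis
    using smooth_vectors_iff[OF assms(1)] poly_disc_hol_disc[OF assms(2)] by blast
qed

lemma smooth_vectors_bergman:
  assumes "\<xi> > -1" "f \<in> smooth_vectors \<xi>"
  shows "f \<in> bergman \<xi>"
proof -
  have f: "f \<in> hol_disc" and s: "\<And>m. summable (\<lambda>k. (cmod (taylor f k))\<^sup>2 * weight \<xi> k * (\<xi> * (\<xi> + 2) + 2 * real k) ^ (2 * m))"
    using assms(2) smooth_vectors_iff[OF assms(1)] by blast+
  show ?thesis using s[of 0] bergman_iff_summable[OF assms(1) f] by simp
qed

text \<open>
  The coefficients stay square summable against every power of \<open>k\<close> while the weights decay only
  polynomially, so the coefficients decay faster than any power. The factor \<open>k + 1\<close> is what the series of the derivative costs.
\<close>

lemma smooth_vectors_taylor_summable: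
  assumes "\<xi> > -1" "f \<in> smooth_vectors \<xi>"
  shows "summable (\<lambda>k. cmod (taylor f k) * (real k + 1))"
proof -
  obtain M :: nat where M: "real M \<ge> \<xi> + 1" using real_arch_simple by blast
  \<comment> \<open>the exponent \<open>2M + 6\<close> outweighs the decay of the weight, of order at most \<open>M\<close>, and leaves for the coefficients a decay of order \<open>k\<^sup>-\<^sup>3\<close>\<close>
  let ?t = "\<lambda>k. (cmod (taylor f k))\<^sup>2 * weight \<xi> k * (\<xi> * (\<xi> + 2) + 2 * real k) ^ (2 * (M + 3))"
  have "summable ?t"
    using assms smooth_vectors_iff by blast
  then have "\<forall>\<^sub>F k in sequentially. ?t k < weight \<xi> 0"
    using weight_pos[OF assms(1), of 0] by (intro order_tendstoD(2)[OF summable_LIMSEQ_zero])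
  then have "\<forall>\<^sub>F k in sequentially. norm (cmod (taylor f k) * (real k + 1)) \<le> inverse (real (Suc k) ^ 2)"
    using eventually_ge_at_top[of 2]
  proof eventually_elim
    case (elim k)
    define q where "q = real k + 1"
    have q: "q \<ge> 1" by (simp add: q_def)
    \<comment> \<open>the base of the power can be negative for small \<open>k\<close>, but it is at least \<open>k + 1\<close> once \<open>k \<ge> 2\<close>\<close>
    have "\<xi> * (\<xi> + 2) = (\<xi> + 1)\<^sup>2 - 1" by (simp add: power2_eq_square algebra_simps)
    moreover have "real k \<ge> 2" "0 \<le> (\<xi> + 1)\<^sup>2"
      using elim(2) by simp_all
    ultimately have "q \<le> \<xi> * (\<xi> + 2) + 2 * real k"
      unfolding q_def by linarith
    then have pw: "q ^ (2 * (M + 3)) \<le> (\<xi> * (\<xi> + 2) + 2 * real k) ^ (2 * (M + 3))"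
      using q by (intro power_mono) auto
    have "(cmod (taylor f k))\<^sup>2 * q ^ 6 * weight \<xi> 0 \<le> (cmod (taylor f k))\<^sup>2 * q ^ 6 * (weight \<xi> k * q ^ M)"
      using weight_ge[OF assms(1) M, of k] q by (intro mult_left_mono) (auto simp: q_def)
    also have "\<dots> \<le> (cmod (taylor f k))\<^sup>2 * q ^ 6 * (weight \<xi> k * q ^ (2 * M))"
      using q weight_pos[OF assms(1), of k] by (intro mult_left_mono power_increasing) auto
    also have "\<dots> = (cmod (taylor f k))\<^sup>2 * weight \<xi> k * q ^ (2 * (M + 3))"
      by (simp add: power_add algebra_simps)
    also have "\<dots> \<le> ?t k"
      using pw weight_pos[OF assms(1), of k] by (intro mult_left_mono) auto
    also have "\<dots> \<le> 1 * weight \<xi> 0" using elim(1) by simp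
    finally have "(cmod (taylor f k))\<^sup>2 * q ^ 6 \<le> 1"
      using weight_pos[OF assms(1), of 0] by simp
    moreover have "(cmod (taylor f k))\<^sup>2 * q ^ 6 = (cmod (taylor f k) * q ^ 3)\<^sup>2"
      by (simp add: power_mult_distrib flip: power_mult)
    ultimately have "cmod (taylor f k) * q ^ 3 \<le> 1"
      using power2_le_imp_le[of "cmod (taylor f k) * q ^ 3" 1] by simp
    then have "cmod (taylor f k) * q \<le> inverse (q ^ 2)"
      using q by (simp add: field_simps power2_eq_square power3_eq_cube)
    then show ?case using q by (simp add: q_def add_ac)
  qed
  moreover have "summable (\<lambda>k. inverse (real (Suc k) ^ 2))"
    using inverse_power_summable[of 2, where 'a=real] by (subst summable_Suc_iff) simp
  ultimately show ?thesis by (rule summable_comparison_test_ev)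
qed

lemma continuous_on_powser_cball:
  fixes x :: "nat \<Rightarrow> complex"
  assumes "summable (\<lambda>k. cmod (x k))"
  shows "continuous_on (cball 0 1) (\<lambda>z. \<Sum>k. x k * z ^ k)"
proof (rule uniform_limit_theorem)
  show "uniform_limit (cball 0 1) (\<lambda>n z. \<Sum>k<n. x k * z ^ k) (\<lambda>z. \<Sum>k. x k * z ^ k) sequentially"
    using assms
    by (intro Weierstrass_m_test) (auto simp: norm_mult norm_power intro!: mult_left_le power_le_one)
  show "\<forall>\<^sub>F n in sequentially. continuous_on (cball 0 1) (\<lambda>z. \<Sum>k<n. x k * z ^ k)"
    by (intro always_eventually allI continuous_intros)
qed simp

text \<open>
  Smooth vectors and their derivatives extend continuously to the closed disc. Compactness then upgrades
  the pointwise derivative of the representation to a uniform one.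
\<close>

lemma smooth_vectors_extend:
  assumes "\<xi> > -1" "f \<in> smooth_vectors \<xi>"
  shows "\<exists>V V'. continuous_on (cball 0 1) V \<and> continuous_on (cball 0 1) V' \<and>
    (\<forall>z\<in>unit_disc. V z = f z \<and> V' z = deriv f z)"
proof -
  have f: "f \<in> hol_disc" using smooth_vectors_iff[OF assms(1)] assms(2) by blast
  have s: "summable (\<lambda>k. cmod (taylor f k) * (real k + 1))"
    by (rule smooth_vectors_taylor_summable[OF assms])
  have 1: "summable (\<lambda>k. cmod (taylor f k))"
    by (rule summable_comparison_test'[OF s, of 0]) (simp add: mult_le_cancel_left1 algebra_simps)
  have 2: "summable (\<lambda>k. cmod (of_nat (Suc k) * taylor f (Suc k)))"
  proof (rule summable_comparison_test'[OF summable_ignore_initial_segment[OF s, of 1], of 0])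
    fix k :: nat
    show "norm (cmod (of_nat (Suc k) * taylor f (Suc k))) \<le> cmod (taylor f (k + 1)) * (real (k + 1) + 1)"
      by (simp add: norm_mult algebra_simps del: of_nat_Suc)
  qed
  have "(\<Sum>k. taylor f k * z ^ k) = f z" "(\<Sum>k. of_nat (Suc k) * taylor f (Suc k) * z ^ k) = deriv f z" if "z \<in> unit_disc" for z
    using taylor_sums[OF f that] deriv_taylor_sums[OF f that] by (simp_all add: sums_iff)
  then show ?thesis
    using continuous_on_powser_cball[OF 1] continuous_on_powser_cball[OF 2] by blast
qed

section \<open>One-parameter groups in SU(1,1)\<close>

definition su11_matrix :: "complex \<Rightarrow> complex \<Rightarrow> complex^2^2" where
  "su11_matrix p q = vector [vector [p, q], vector [cnj q, cnj p]]"

lemma su11_matrix_mult: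
  "su11_matrix p q ** su11_matrix p' q' = su11_matrix (p * p' + q * cnj q') (p * q' + q * cnj p')"
  by (simp add: su11_matrix_def matrix_matrix_mult_def vec_eq_iff forall_2 sum_2 algebra_simps)

lemma su11_matrix_scaleR: "r *\<^sub>R su11_matrix p q = su11_matrix (of_real r * p) (of_real r * q)"
  by (simp add: su11_matrix_def vec_eq_iff forall_2, simp add: scaleR_conv_of_real)

lemma su11_matrix_sums:
  assumes "p sums P" "q sums Q"
  shows "(\<lambda>k. su11_matrix (p k) (q k)) sums su11_matrix P Q"
  unfolding sums_def
proof (intro vec_tendstoI)
  fix i j :: 2
  have "\<forall>i j. (\<lambda>k. su11_matrix (p k) (q k) $ i $ j) sums (su11_matrix P Q $ i $ j)"
    using assms by (simp add: forall_2 su11_matrix_def sums_cnj)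
  then show "(\<lambda>n. (\<Sum>k<n. su11_matrix (p k) (q k)) $ i $ j) \<longlonglongrightarrow> su11_matrix P Q $ i $ j"
    by (simp add: sums_def)
qed

text \<open>
  The first row of the \<open>k\<close>-th power of the generator; the second row is determined by it, because
  matrices of the given form are closed under products.
\<close>

fun gen_powers :: "real \<Rightarrow> complex \<Rightarrow> nat \<Rightarrow> complex \<times> complex" where
  "gen_powers s u 0 = (1, 0)"
| "gen_powers s u (Suc k) = (case gen_powers s u k of (p, q) \<Rightarrow>
     (\<i> * of_real s * p + u * cnj q, \<i> * of_real s * q + u * cnj p))"

lemma gen_powers_bound:
  "cmod (fst (gen_powers s u k)) \<le> (\<bar>s\<bar> + cmod u) ^ k \<and> cmod (snd (gen_powers s u k)) \<le> (\<bar>s\<bar> + cmod u) ^ k"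
proof (induction k)
  case (Suc k)
  have b: "cmod (\<i> * of_real s * x + u * y) \<le> (\<bar>s\<bar> + cmod u) * r" if "cmod x \<le> r" "cmod y \<le> r" for x y r
  proof -
    have "cmod (\<i> * of_real s * x + u * y) \<le> \<bar>s\<bar> * cmod x + cmod u * cmod y"
      using norm_triangle_ineq[of "\<i> * of_real s * x" "u * y"] by (simp add: norm_mult)
    also have "\<dots> \<le> \<bar>s\<bar> * r + cmod u * r"
      using that by (intro add_mono mult_left_mono) auto
    finally show ?thesis by (simp add: algebra_simps)
  qed
  show ?case using Suc by (auto simp: split_beta intro!: b)
qed simp

lemma gen_powers_matrix:
  "(((**) (t *\<^sub>R su11_matrix (\<i> * of_real s) u)) ^^ k) (mat 1)
     = su11_matrix (fst (gen_powers s u k) * of_real t ^ k) (snd (gen_powers s u k) * of_real t ^ k)"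
proof (induction k)
  case 0
  show ?case by (simp add: su11_matrix_def mat_def vec_eq_iff forall_2)
next
  case (Suc k)
  show ?case
    unfolding funpow.simps o_apply Suc unfolding su11_matrix_scaleR su11_matrix_mult
    by (simp add: split_beta algebra_simps)
qed

lemma powser_fact_everywhere:
  fixes x :: "nat \<Rightarrow> complex"
  assumes "\<And>k. cmod (x k) \<le> r ^ k"
  shows "summable (\<lambda>k. x k / fact k * z ^ k)"
proof (rule summable_comparison_test'[of _ 0])
  show "summable (\<lambda>k. inverse (fact k) * (r * cmod z) ^ k)"
    by (rule summable_exp)
  show "norm (x k / fact k * z ^ k) \<le> inverse (fact k) * (r * cmod z) ^ k" for k
    using mult_right_mono[OF assms[of k], of "cmod z ^ k"]
    by (simp add: norm_mult norm_divide norm_power power_mult_distrib field_simps)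
qed

text \<open>
  The exponential series is summed entrywise: multiplying by the generator shifts the coefficients of the
  two entry series, so termwise differentiation gives the linear system for the first row.
\<close>

lemma matrix_exp_su11:
  obtains \<alpha> \<beta> :: "real \<Rightarrow> complex" where
    "\<And>t. matrix_exp (t *\<^sub>R su11_matrix (\<i> * of_real s) u) = su11_matrix (\<alpha> t) (\<beta> t)"
    "\<alpha> 0 = 1" "\<beta> 0 = 0"
    "\<And>t. (\<alpha> has_vector_derivative \<i> * of_real s * \<alpha> t + u * cnj (\<beta> t)) (at t)"
    "\<And>t. (\<beta> has_vector_derivative \<i> * of_real s * \<beta> t + u * cnj (\<alpha> t)) (at t)"
proof -
  define p q where "p k = fst (gen_powers s u k)" and "q k = snd (gen_powers s u k)" for k
  have b: "cmod (p k) \<le> (\<bar>s\<bar> + cmod u) ^ k" "cmod (q k) \<le> (\<bar>s\<bar> + cmod u) ^ k" for k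
    using gen_powers_bound[of s u k] by (auto simp: p_def q_def)
  have S: "p (Suc k) = \<i> * of_real s * p k + u * cnj (q k)" "q (Suc k) = \<i> * of_real s * q k + u * cnj (p k)" for k
    by (simp_all add: p_def q_def split_beta)
  note sp = powser_fact_everywhere[of p, OF b(1)] and sq = powser_fact_everywhere[of q, OF b(2)]
  define A B where "A z = (\<Sum>k. p k / fact k * z ^ k)" and "B z = (\<Sum>k. q k / fact k * z ^ k)" for z
  have sA: "(\<lambda>k. p k / fact k * z ^ k) sums A z" and sB: "(\<lambda>k. q k / fact k * z ^ k) sums B z" for z
    unfolding A_def B_def by (intro summable_sums sp sq)+
  have dA: "(A has_field_derivative (\<Sum>k. p (Suc k) / fact k * z ^ k)) (at z)"
    and dB: "(B has_field_derivative (\<Sum>k. q (Suc k) / fact k * z ^ k)) (at z)" for z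
  proof -
    have d: "diffs (\<lambda>k. x k / fact k) = (\<lambda>k. x (Suc k) / fact k)" for x :: "nat \<Rightarrow> complex"
      by (simp add: diffs_def fun_eq_iff field_simps del: of_nat_Suc)
    show "(A has_field_derivative (\<Sum>k. p (Suc k) / fact k * z ^ k)) (at z)"
      using termdiffs_strong_converges_everywhere[OF sp, of z] unfolding d A_def[abs_def] .
    show "(B has_field_derivative (\<Sum>k. q (Suc k) / fact k * z ^ k)) (at z)"
      using termdiffs_strong_converges_everywhere[OF sq, of z] unfolding d B_def[abs_def] .
  qed
  have comb: "(\<Sum>k. (\<i> * of_real s * x k + u * cnj (y k)) / fact k * of_real t ^ k) = \<i> * of_real s * X + u * cnj Y"
    if "(\<lambda>k. x k / fact k * of_real t ^ k) sums X" "(\<lambda>k. y k / fact k * of_real t ^ k) sums Y"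
    for x y :: "nat \<Rightarrow> complex" and X Y and t :: real
  proof -
    have "(\<lambda>k. cnj (y k / fact k * of_real t ^ k)) sums cnj Y"
      using that(2) by (simp only: sums_cnj)
    from sums_add[OF sums_mult[OF that(1), of "\<i> * of_real s"] sums_mult[OF this, of u]] show ?thesis
      by (intro sums_unique[symmetric]) (simp add: algebra_simps add_divide_distrib)
  qed
  show ?thesis
  proof (rule that[of "\<lambda>t. A (of_real t)" "\<lambda>t. B (of_real t)"])
    fix t :: real
    show "((\<lambda>t. A (of_real t)) has_vector_derivative \<i> * of_real s * A (of_real t) + u * cnj (B (of_real t))) (at t)"
      using has_vector_derivative_real_field[OF dA, of t UNIV] unfolding S comb[OF sA sB] .
    show "((\<lambda>t. B (of_real t)) has_vector_derivative \<i> * of_real s * B (of_real t) + u * cnj (A (of_real t))) (at t)"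
      using has_vector_derivative_real_field[OF dB, of t UNIV] unfolding S comb[OF sB sA] .
    have "(\<lambda>k. (1 / fact k) *\<^sub>R (((**) (t *\<^sub>R su11_matrix (\<i> * of_real s) u)) ^^ k) (mat 1)) sums su11_matrix (A (of_real t)) (B (of_real t))"
      unfolding gen_powers_matrix unfolding su11_matrix_scaleR p_def[symmetric] q_def[symmetric]
      using su11_matrix_sums[OF sA sB, of "of_real t" "of_real t"] by simp
    then show "matrix_exp (t *\<^sub>R su11_matrix (\<i> * of_real s) u) = su11_matrix (A (of_real t)) (B (of_real t))"
      unfolding matrix_exp_def by (rule sums_unique[symmetric])
  next
    show "A (of_real 0) = 1" "B (of_real 0) = 0"
      using sA[of 0, unfolded powser_sums_zero_iff] sB[of 0, unfolded powser_sums_zero_iff]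
      by (simp_all add: p_def q_def)
  qed
qed

text \<open>
  The determinant is constant along the flow: the derivative of \<open>\<bar>\<alpha>\<bar>\<^sup>2 - \<bar>\<beta>\<bar>\<^sup>2\<close> cancels.
\<close>

lemma su11_norm_preserved:
  assumes "\<alpha> 0 = 1" "\<beta> 0 = 0"
    "\<And>t. (\<alpha> has_vector_derivative \<i> * of_real s * \<alpha> t + u * cnj (\<beta> t)) (at t)"
    "\<And>t. (\<beta> has_vector_derivative \<i> * of_real s * \<beta> t + u * cnj (\<alpha> t)) (at t)"
  shows "(cmod (\<alpha> t))\<^sup>2 - (cmod (\<beta> t))\<^sup>2 = 1"
proof -
  define N where "N t = \<alpha> t * cnj (\<alpha> t) - \<beta> t * cnj (\<beta> t)" for t
  have "(N has_vector_derivative 0) (at t)" for t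
  proof -
    let ?\<alpha>' = "\<i> * of_real s * \<alpha> t + u * cnj (\<beta> t)" and ?\<beta>' = "\<i> * of_real s * \<beta> t + u * cnj (\<alpha> t)"
    have "(N has_vector_derivative (\<alpha> t * cnj ?\<alpha>' + ?\<alpha>' * cnj (\<alpha> t)) - (\<beta> t * cnj ?\<beta>' + ?\<beta>' * cnj (\<beta> t))) (at t)"
      unfolding N_def
      by (intro has_vector_derivative_diff has_vector_derivative_mult has_vector_derivative_cnj assms)
    then show ?thesis by (simp add: algebra_simps)
  qed
  then have "\<exists>c. \<forall>t\<in>UNIV. N t = c"
    by (intro has_derivative_zero_constant) (auto simp: has_vector_derivative_def)
  then have "N t = N 0" by auto
  also have "\<dots> = 1" by (simp add: N_def assms)
  finally have "complex_of_real ((cmod (\<alpha> t))\<^sup>2 - (cmod (\<beta> t))\<^sup>2) = 1"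
    by (simp only: N_def of_real_diff complex_norm_square)
  then show ?thesis by (simp only: of_real_eq_1_iff)
qed

text \<open>
  The difference of two logarithms of the same function takes values in \<open>2\<pi>\<i>\<int>\<close>, a discrete set, so it
  is constant on connected sets.
\<close>

lemma continuous_logs_eq:
  fixes l l' :: "'a :: topological_space \<Rightarrow> complex"
  assumes "connected S" "continuous_on S l" "continuous_on S l'" "\<And>x. x \<in> S \<Longrightarrow> exp (l x) = exp (l' x)"
    "x0 \<in> S" "l x0 = l' x0" "x \<in> S"
  shows "l x = l' x"
proof -
  define d where "d x = l x - l' x" for x
  have e: "exp (d x) = 1" if "x \<in> S" for x
    using assms(4)[OF that] by (simp add: d_def exp_diff)
  have "d constant_on S"
  proof (rule continuous_discrete_range_constant[OF assms(1)])
    show "continuous_on S d" unfolding d_def by (intro continuous_intros assms)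
    show "\<exists>e>0. \<forall>y. y \<in> S \<and> d y \<noteq> d x \<longrightarrow> e \<le> norm (d y - d x)" if "x \<in> S" for x
    proof (intro exI[of _ "2 * pi"] conjI allI impI)
      fix y assume y: "y \<in> S \<and> d y \<noteq> d x"
      show "2 * pi \<le> norm (d y - d x)"
        using exp_complex_eqI[of "d y" "d x"] e[OF that] e[of y] y abs_Im_le_cmod[of "d y - d x"] by force
    qed simp
  qed
  then have "d x = d x0" using assms by (auto simp: constant_on_def)
  then show ?thesis using assms(6) by (simp add: d_def)
qed

text \<open>
  The branch that is continuous along the whole line agrees with the principal branch for as long as the
  path has not met the negative axis. Near \<open>t = 0\<close> this makes the cocycle of the representation explicit.
\<close>

lemma continuous_log_eq_Ln:
  assumes \<gamma>: "continuous_on UNIV \<gamma>" "\<And>t. \<gamma> t \<noteq> 0" "\<gamma> 0 = 1"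
    and \<epsilon>: "\<And>t. \<bar>t\<bar> \<le> \<epsilon> \<Longrightarrow> \<gamma> t \<notin> \<real>\<^sub>\<le>\<^sub>0" and t: "\<bar>t\<bar> \<le> \<epsilon>"
  shows "continuous_log \<gamma> t = Ln (\<gamma> t)"
proof -
  obtain g where g: "continuous_on UNIV g" "\<And>t. \<gamma> t = exp (g t)"
    using continuous_logarithm_on_contractible[OF \<gamma>(1) contractible_UNIV \<gamma>(2)] by auto
  define l where "l t = g t - g 0" for t
  have l: "continuous_on UNIV l \<and> l 0 = 0 \<and> (\<forall>t. exp (l t) = \<gamma> t)"
    using g \<gamma>(3) unfolding l_def by (auto intro!: continuous_intros simp: exp_diff)
  have "continuous_log \<gamma> = l"
    unfolding continuous_log_def
  proof (rule the_equality[of _ l])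
    fix l' assume l': "continuous_on UNIV l' \<and> l' 0 = 0 \<and> (\<forall>t. exp (l' t) = \<gamma> t)"
    show "l' = l"
    proof
      fix t show "l' t = l t"
        by (rule continuous_logs_eq[of UNIV l' l 0]) (use l l' in auto)
    qed
  qed (rule l)
  moreover have "l t = Ln (\<gamma> t)"
  proof (rule continuous_logs_eq[of "{-\<epsilon>..\<epsilon>}" l "\<lambda>t. Ln (\<gamma> t)" 0])
    show "continuous_on {-\<epsilon>..\<epsilon>} (\<lambda>t. Ln (\<gamma> t))"
      using \<epsilon> by (intro continuous_on_Ln' continuous_on_subset[OF \<gamma>(1)]) auto
    show "continuous_on {-\<epsilon>..\<epsilon>} l" using l continuous_on_subset by blast
  qed (use l \<gamma> t in \<open>auto simp: exp_Ln\<close>)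
  ultimately show ?thesis by simp
qed

section \<open>The derived representation\<close>

definition rep_expr :: "real \<Rightarrow> real \<Rightarrow> complex \<Rightarrow> (complex \<Rightarrow> complex) \<Rightarrow> complex \<Rightarrow> complex" where
  "rep_expr \<xi> s u f = on_disc (\<lambda>z. (cnj u * z\<^sup>2 - 2 * \<i> * of_real s * z - u) * deriv f z
     + of_real (\<xi> + 2) * (cnj u * z - \<i> * of_real s) * f z)"

text \<open>
  Comparing coefficients determines the generator and the additive constant: \<open>a = 2s\<close>, \<open>c = \<i>u\<^sup>*\<close> with
  \<open>u\<^sup>*\<close> the conjugate of \<open>u\<close>, and \<open>d = b - (\<xi> + 2)s\<close>.
\<close>

lemma diff_expr_eq_rep_expr:
  "diff_expr \<xi> (2 * s) b (\<i> * cnj u) f z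
    = \<i> * rep_expr \<xi> s u f z + of_real (b - (\<xi> + 2) * s) * on_disc f z"
  by (simp add: diff_expr_def rep_expr_def on_disc_def algebra_simps)

lemma on_disc_hol_disc: "f \<in> hol_disc \<Longrightarrow> on_disc f = f"
  by (auto simp: on_disc_def hol_disc_def fun_eq_iff)

lemma rep_expr_hol_disc:
  assumes "f \<in> hol_disc"
  shows "rep_expr \<xi> s u f \<in> hol_disc"
proof -
  have "(\<lambda>z. (cnj u * z\<^sup>2 - 2 * \<i> * of_real s * z - u) * deriv f z
     + of_real (\<xi> + 2) * (cnj u * z - \<i> * of_real s) * f z) holomorphic_on unit_disc"
    using assms by (intro holomorphic_intros holomorphic_deriv) (auto simp: hol_disc_def)
  then have "rep_expr \<xi> s u f holomorphic_on unit_disc"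
    by (rule holomorphic_transform) (simp add: rep_expr_def on_disc_def)
  then show ?thesis by (simp add: hol_disc_def rep_expr_def on_disc_def)
qed

text \<open>
  The matrix preserves the indefinite form \<open>\<bar>z\<^sub>1\<bar>\<^sup>2 - \<bar>z\<^sub>2\<bar>\<^sup>2\<close>; this is why its Moebius map preserves the disc.
\<close>

lemma mobius_norm_identity:
  fixes \<alpha> \<beta> z :: complex
  assumes "(cmod \<alpha>)\<^sup>2 - (cmod \<beta>)\<^sup>2 = 1"
  shows "(cmod (- cnj \<beta> * z + \<alpha>))\<^sup>2 - (cmod (cnj \<alpha> * z - \<beta>))\<^sup>2 = 1 - (cmod z)\<^sup>2"
proof -
  have "complex_of_real ((cmod (- cnj \<beta> * z + \<alpha>))\<^sup>2 - (cmod (cnj \<alpha> * z - \<beta>))\<^sup>2)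
    = complex_of_real (((cmod \<alpha>)\<^sup>2 - (cmod \<beta>)\<^sup>2) * (1 - (cmod z)\<^sup>2))"
    by (simp only: of_real_diff of_real_mult of_real_1 complex_norm_square) (simp add: algebra_simps)
  then show ?thesis unfolding of_real_eq_iff assms by simp
qed

lemma mobius_denom_nonzero:
  fixes \<alpha> \<beta> z :: complex
  assumes "(cmod \<alpha>)\<^sup>2 - (cmod \<beta>)\<^sup>2 = 1" "cmod z \<le> 1"
  shows "- cnj \<beta> * z + \<alpha> \<noteq> 0"
proof
  assume "- cnj \<beta> * z + \<alpha> = 0"
  then have "\<alpha> = cnj \<beta> * z" by (simp add: algebra_simps)
  then have "cmod \<alpha> \<le> cmod \<beta>"
    using assms(2) by (simp add: norm_mult mult_left_le)
  then have "(cmod \<alpha>)\<^sup>2 \<le> (cmod \<beta>)\<^sup>2" by (rule power_mono) simp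
  then show False using assms(1) by linarith
qed

lemma mobius_maps_disc:
  fixes \<alpha> \<beta> z :: complex
  assumes "(cmod \<alpha>)\<^sup>2 - (cmod \<beta>)\<^sup>2 = 1"
  shows "cmod z \<le> 1 \<Longrightarrow> cmod ((cnj \<alpha> * z - \<beta>) / (- cnj \<beta> * z + \<alpha>)) \<le> 1"
    and "cmod z < 1 \<Longrightarrow> cmod ((cnj \<alpha> * z - \<beta>) / (- cnj \<beta> * z + \<alpha>)) < 1"
proof -
  assume z: "cmod z \<le> 1"
  have "(cmod (cnj \<alpha> * z - \<beta>))\<^sup>2 \<le> (cmod (- cnj \<beta> * z + \<alpha>))\<^sup>2"
    using mobius_norm_identity[OF assms, of z] power_le_one[OF norm_ge_zero z, of 2] by linarith
  then have "cmod (cnj \<alpha> * z - \<beta>) \<le> cmod (- cnj \<beta> * z + \<alpha>)"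
    by (rule power2_le_imp_le) simp
  then show "cmod ((cnj \<alpha> * z - \<beta>) / (- cnj \<beta> * z + \<alpha>)) \<le> 1"
    using mobius_denom_nonzero[OF assms z] unfolding norm_divide by (subst divide_le_eq_1_pos) auto
next
  assume z: "cmod z < 1"
  have "(cmod z)\<^sup>2 < 1" using z by (simp add: abs_square_less_1)
  then have "(cmod (cnj \<alpha> * z - \<beta>))\<^sup>2 < (cmod (- cnj \<beta> * z + \<alpha>))\<^sup>2"
    using mobius_norm_identity[OF assms, of z] by linarith
  then have "cmod (cnj \<alpha> * z - \<beta>) < cmod (- cnj \<beta> * z + \<alpha>)"
    by (rule power2_less_imp_less) simp
  then show "cmod ((cnj \<alpha> * z - \<beta>) / (- cnj \<beta> * z + \<alpha>)) < 1"
    using mobius_denom_nonzero[OF assms, of z] z unfolding norm_divide by (subst divide_less_eq_1_pos) auto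
qed

lemma near_one_not_nonpos:
  assumes "cmod (w - 1) < 1"
  shows "w \<notin> \<real>\<^sub>\<le>\<^sub>0"
  using assms abs_Re_le_cmod[of "w - 1"] by (auto simp: complex_nonpos_Reals_iff)

text \<open>
  For small \<open>t\<close> the function \<open>t \<mapsto> \<pi>(exp(tX))f(z)\<close> is explicit and has derivative \<open>H(t,z)\<close>. Since \<open>f\<close> and its
  derivative extend continuously to the closed disc, \<open>H\<close> is continuous, hence uniformly continuous, on the
  compact set of all \<open>t\<close> in \<open>[-\<epsilon>,\<epsilon>]\<close> and \<open>z\<close> in the closed disc. So \<open>H(t,z)\<close> is close to \<open>H(0,z)\<close> uniformly in \<open>z\<close>, and the mean value
  inequality bounds the error of the difference quotient uniformly on the disc.
\<close>

lemma discrete_series_uniform_derivative: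
  assumes "\<xi> > -1" "f \<in> smooth_vectors \<xi>" "e > 0"
  shows "\<exists>d>0. \<forall>t. t \<noteq> 0 \<and> \<bar>t\<bar> < d \<longrightarrow>
    discrete_series \<xi> (su11_matrix (\<i> * of_real s) u) t f \<in> hol_disc \<and>
    (\<forall>z\<in>unit_disc. cmod ((discrete_series \<xi> (su11_matrix (\<i> * of_real s) u) t f z - f z) / of_real t
       - rep_expr \<xi> s u f z) \<le> e)"
proof -
  define X where "X = su11_matrix (\<i> * of_real s) u"
  have f: "f \<in> hol_disc" using assms(2) smooth_vectors_iff[OF assms(1)] by blast
  obtain V V' where V: "continuous_on (cball 0 1) V" "continuous_on (cball 0 1) V'"
    "\<And>z. z \<in> unit_disc \<Longrightarrow> V z = f z" "\<And>z. z \<in> unit_disc \<Longrightarrow> V' z = deriv f z"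
    using smooth_vectors_extend[OF assms(1,2)] by blast
  obtain \<alpha> \<beta> :: "real \<Rightarrow> complex" where
    E: "\<And>t. matrix_exp (t *\<^sub>R X) = su11_matrix (\<alpha> t) (\<beta> t)" and init: "\<alpha> 0 = 1" "\<beta> 0 = 0"
    and d\<alpha>: "\<And>t. (\<alpha> has_vector_derivative \<i> * of_real s * \<alpha> t + u * cnj (\<beta> t)) (at t)"
    and d\<beta>: "\<And>t. (\<beta> has_vector_derivative \<i> * of_real s * \<beta> t + u * cnj (\<alpha> t)) (at t)"
    unfolding X_def using matrix_exp_su11[of s u] by blast
  define \<alpha>' \<beta>' where "\<alpha>' t = \<i> * of_real s * \<alpha> t + u * cnj (\<beta> t)"
    and "\<beta>' t = \<i> * of_real s * \<beta> t + u * cnj (\<alpha> t)" for t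
  note d\<alpha>' = d\<alpha>[folded \<alpha>'_def] and d\<beta>' = d\<beta>[folded \<beta>'_def]
  note unit = su11_norm_preserved[OF init d\<alpha> d\<beta>]
  have cont: "continuous_on S \<alpha>" "continuous_on S \<beta>" for S
    by (auto intro!: continuous_at_imp_continuous_on has_vector_derivative_continuous[OF d\<alpha>]
        has_vector_derivative_continuous[OF d\<beta>])
  have cont': "continuous_on S \<alpha>'" "continuous_on S \<beta>'" for S
    unfolding \<alpha>'_def \<beta>'_def by (intro continuous_intros cont)+
  define \<delta> \<mu> where "\<delta> t z = - cnj (\<beta> t) * z + \<alpha> t" and "\<mu> t z = (cnj (\<alpha> t) * z - \<beta> t) / \<delta> t z" for t z
  define \<delta>' \<mu>' where "\<delta>' t z = - cnj (\<beta>' t) * z + \<alpha>' t"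
    and "\<mu>' t z = ((cnj (\<alpha>' t) * z - \<beta>' t) * \<delta> t z - (cnj (\<alpha> t) * z - \<beta> t) * \<delta>' t z) / (\<delta> t z * \<delta> t z)" for t z
  have \<delta>0: "\<delta> t z \<noteq> 0" if "cmod z \<le> 1" for t z
    unfolding \<delta>_def by (rule mobius_denom_nonzero[OF unit that])
  have \<mu>1: "cmod (\<mu> t z) \<le> 1" if "cmod z \<le> 1" for t z
    unfolding \<mu>_def \<delta>_def by (rule mobius_maps_disc(1)[OF unit that])
  have \<mu>2: "cmod (\<mu> t z) < 1" if "cmod z < 1" for t z
    unfolding \<mu>_def \<delta>_def by (rule mobius_maps_disc(2)[OF unit that])
  \<comment> \<open>for such \<open>t\<close> the denominator stays within distance 1 of the value 1 for all \<open>z\<close> in the closed disc, away from the cut of \<open>Ln\<close>\<close>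
  obtain \<epsilon> where \<epsilon>: "\<epsilon> > 0" "\<And>t. \<bar>t\<bar> \<le> \<epsilon> \<Longrightarrow> cmod (\<alpha> t - 1) + cmod (\<beta> t) < 1"
  proof -
    have "isCont (\<lambda>t. cmod (\<alpha> t - 1) + cmod (\<beta> t)) 0"
      using cont[of UNIV] by (intro continuous_intros) (auto simp: continuous_on_eq_continuous_at)
    then have "((\<lambda>t. cmod (\<alpha> t - 1) + cmod (\<beta> t)) \<longlongrightarrow> 0) (at 0)"
      using init by (simp add: isCont_def)
    then have "\<forall>\<^sub>F t in at 0. cmod (\<alpha> t - 1) + cmod (\<beta> t) < 1"
      by (rule order_tendstoD) simp
    then obtain d where "d > 0" "\<And>t. t \<noteq> 0 \<Longrightarrow> \<bar>t\<bar> < d \<Longrightarrow> cmod (\<alpha> t - 1) + cmod (\<beta> t) < 1"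
      by (auto simp: eventually_at dist_real_def)
    then have "cmod (\<alpha> t - 1) + cmod (\<beta> t) < 1" if "\<bar>t\<bar> \<le> d / 2" for t
      using that init by (cases "t = 0") auto
    then show ?thesis using that[of "d / 2"] \<open>d > 0\<close> by simp
  qed
  have \<delta>R: "\<delta> t z \<notin> \<real>\<^sub>\<le>\<^sub>0" if "\<bar>t\<bar> \<le> \<epsilon>" "cmod z \<le> 1" for t z
  proof (rule near_one_not_nonpos)
    have "cmod (\<delta> t z - 1) \<le> cmod (\<alpha> t - 1) + cmod (\<beta> t) * cmod z"
      using norm_triangle_ineq4[of "\<alpha> t - 1" "cnj (\<beta> t) * z"] by (simp add: \<delta>_def norm_mult algebra_simps)
    also have "\<dots> \<le> cmod (\<alpha> t - 1) + cmod (\<beta> t)"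
      using that(2) by (simp add: mult_left_le)
    also have "\<dots> < 1" by (rule \<epsilon>(2)[OF that(1)])
    finally show "cmod (\<delta> t z - 1) < 1" .
  qed
  define G where "G t z = exp (- of_real (\<xi> + 2) * Ln (\<delta> t z))" for t z
  have ds: "discrete_series \<xi> X t f z = G t z * f (\<mu> t z)" if "\<bar>t\<bar> \<le> \<epsilon>" "z \<in> unit_disc" for t z
  proof -
    have md: "mobius_denom (matrix_exp (t *\<^sub>R X)) z = \<delta> t z" for t
      by (simp add: E mobius_denom_def su11_matrix_def \<delta>_def)
    have m: "mobius (matrix_exp (t *\<^sub>R X)) z = \<mu> t z"
      unfolding mobius_def md by (simp add: E su11_matrix_def \<mu>_def)
    have "continuous_log (\<lambda>t. \<delta> t z) t = Ln (\<delta> t z)"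
    proof (rule continuous_log_eq_Ln[OF _ _ _ _ that(1)])
      show "continuous_on UNIV (\<lambda>t. \<delta> t z)"
        unfolding \<delta>_def by (intro continuous_intros cont)
      show "\<delta> t z \<noteq> 0" for t using \<delta>0[of z t] that(2) by simp
      show "\<delta> 0 z = 1" by (simp add: \<delta>_def init)
      show "\<delta> t z \<notin> \<real>\<^sub>\<le>\<^sub>0" if "\<bar>t\<bar> \<le> \<epsilon>" for t using \<delta>R[OF that, of z] \<open>z \<in> unit_disc\<close> by simp
    qed
    then show ?thesis
      using that(2) by (simp add: discrete_series_def on_disc_def md m G_def)
  qed
  define H where "H t z = G t z * (- of_real (\<xi> + 2) * (\<delta>' t z / \<delta> t z) * V (\<mu> t z) + V' (\<mu> t z) * \<mu>' t z)" for t z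
  have H0: "H 0 z = rep_expr \<xi> s u f z" if "z \<in> unit_disc" for z
    using that V(3,4) by (simp add: H_def G_def rep_expr_def on_disc_def \<delta>_def \<delta>'_def \<mu>_def \<mu>'_def \<alpha>'_def \<beta>'_def init
        power2_eq_square algebra_simps)
  have deriv: "((\<lambda>t. G t z * f (\<mu> t z)) has_vector_derivative H t z) (at t within S)" if "\<bar>t\<bar> \<le> \<epsilon>" "z \<in> unit_disc" for t z S
  proof -
    have z: "cmod z \<le> 1" "cmod z < 1" using that(2) by auto
    have D: "((\<lambda>t. \<delta> t z) has_vector_derivative \<delta>' t z) (at t)"
    proof -
      have "((\<lambda>t. - cnj (\<beta> t) * z + \<alpha> t) has_vector_derivative (- cnj (\<beta> t) * 0 + - cnj (\<beta>' t) * z) + \<alpha>' t) (at t)"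
        by (intro has_vector_derivative_add has_vector_derivative_mult has_vector_derivative_minus
            has_vector_derivative_cnj has_vector_derivative_const d\<alpha>' d\<beta>')
      then show ?thesis by (simp add: \<delta>_def \<delta>'_def)
    qed
    have N: "((\<lambda>t. cnj (\<alpha> t) * z - \<beta> t) has_vector_derivative (cnj (\<alpha>' t) * z - \<beta>' t)) (at t)"
    proof -
      have "((\<lambda>t. cnj (\<alpha> t) * z - \<beta> t) has_vector_derivative (cnj (\<alpha> t) * 0 + cnj (\<alpha>' t) * z) - \<beta>' t) (at t)"
        by (intro has_vector_derivative_diff has_vector_derivative_mult
            has_vector_derivative_cnj has_vector_derivative_const d\<alpha>' d\<beta>')
      then show ?thesis by simp
    qed
    have inv: "((\<lambda>t. inverse (\<delta> t z)) has_vector_derivative \<delta>' t z * (- (inverse (\<delta> t z) * inverse (\<delta> t z)))) (at t)"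
      using field_vector_diff_chain_at[OF D DERIV_inverse[OF \<delta>0[OF z(1)]]] by (simp add: o_def power2_eq_square)
    have M: "((\<lambda>t. \<mu> t z) has_vector_derivative \<mu>' t z) (at t)"
    proof -
      have "((\<lambda>t. (cnj (\<alpha> t) * z - \<beta> t) * inverse (\<delta> t z)) has_vector_derivative
        (cnj (\<alpha> t) * z - \<beta> t) * (\<delta>' t z * (- (inverse (\<delta> t z) * inverse (\<delta> t z)))) + (cnj (\<alpha>' t) * z - \<beta>' t) * inverse (\<delta> t z)) (at t)"
        by (intro has_vector_derivative_mult N inv)
      moreover have "(cnj (\<alpha> t) * z - \<beta> t) * (\<delta>' t z * (- (inverse (\<delta> t z) * inverse (\<delta> t z)))) + (cnj (\<alpha>' t) * z - \<beta>' t) * inverse (\<delta> t z) = \<mu>' t z"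
        using \<delta>0[OF z(1), of t] by (simp add: \<mu>'_def field_simps)
      ultimately show ?thesis by (simp add: \<mu>_def divide_inverse)
    qed
    have Gd: "((\<lambda>t. G t z) has_vector_derivative \<delta>' t z * (G t z * (- of_real (\<xi> + 2) * inverse (\<delta> t z)))) (at t)"
    proof -
      have "((\<lambda>w. exp (- of_real (\<xi> + 2) * Ln w)) has_field_derivative G t z * (- of_real (\<xi> + 2) * inverse (\<delta> t z))) (at (\<delta> t z))"
        unfolding G_def by (rule DERIV_chain'[OF DERIV_cmult[OF has_field_derivative_Ln[OF \<delta>R[OF that(1) z(1)]]] DERIV_exp, THEN DERIV_cong])
         (simp add: mult_ac)
      from field_vector_diff_chain_at[OF D this] show ?thesis by (simp add: o_def G_def)
    qed
    have fd: "(f has_field_derivative V' (\<mu> t z)) (at (\<mu> t z))"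
      using \<mu>2[OF z(2), of t] f unfolding V(4)[of "\<mu> t z", simplified, OF \<mu>2[OF z(2)]]
      by (intro holomorphic_derivI[of f unit_disc]) (auto simp: hol_disc_def)
    have F: "((\<lambda>t. f (\<mu> t z)) has_vector_derivative \<mu>' t z * V' (\<mu> t z)) (at t)"
      using field_vector_diff_chain_at[OF M fd] by (simp add: o_def)
    have "((\<lambda>t. G t z * f (\<mu> t z)) has_vector_derivative
       G t z * (\<mu>' t z * V' (\<mu> t z)) + \<delta>' t z * (G t z * (- of_real (\<xi> + 2) * inverse (\<delta> t z))) * f (\<mu> t z)) (at t)"
      by (intro has_vector_derivative_mult Gd F)
    moreover have "G t z * (\<mu>' t z * V' (\<mu> t z)) + \<delta>' t z * (G t z * (- of_real (\<xi> + 2) * inverse (\<delta> t z))) * f (\<mu> t z) = H t z"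
      unfolding H_def using V(3)[of "\<mu> t z"] \<mu>2[OF z(2), of t] by (simp add: divide_inverse algebra_simps)
    ultimately show ?thesis by (simp add: has_vector_derivative_at_within)
  qed
  define K where "K = {-\<epsilon>..\<epsilon>} \<times> cball (0 :: complex) 1"
  have "continuous_on K (\<lambda>p. H (fst p) (snd p))"
  proof -
    have c1: "continuous_on K (\<lambda>p. g (fst p))" if "\<And>S. continuous_on S g" for g :: "real \<Rightarrow> complex"
      by (rule continuous_on_compose2[OF that[of UNIV]]) (auto intro: continuous_intros)
    note cs = c1[OF cont(1)] c1[OF cont(2)] c1[OF cont'(1)] c1[OF cont'(2)]
    have d: "continuous_on K (\<lambda>p. \<delta> (fst p) (snd p))" "continuous_on K (\<lambda>p. \<delta>' (fst p) (snd p))"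
      unfolding \<delta>_def \<delta>'_def by (intro continuous_intros cs)+
    have d0: "\<delta> (fst p) (snd p) \<noteq> 0" "\<delta> (fst p) (snd p) \<notin> \<real>\<^sub>\<le>\<^sub>0" if "p \<in> K" for p
      using that \<delta>0 \<delta>R by (auto simp: K_def abs_le_iff)
    have m: "continuous_on K (\<lambda>p. \<mu> (fst p) (snd p))" "continuous_on K (\<lambda>p. \<mu>' (fst p) (snd p))"
      unfolding \<mu>_def \<mu>'_def using d0 by (intro continuous_intros cs d; simp)+
    have v: "continuous_on K (\<lambda>p. W (\<mu> (fst p) (snd p)))" if "continuous_on (cball 0 1) W" for W :: "complex \<Rightarrow> complex"
      by (rule continuous_on_compose2[OF that m(1)]) (use \<mu>1 in \<open>auto simp: K_def\<close>)
    show ?thesis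
      unfolding H_def G_def using d0 by (intro continuous_intros v V(1,2) d m; simp)
  qed
  moreover have "compact K" unfolding K_def by (intro compact_Times) auto
  ultimately have "uniformly_continuous_on K (\<lambda>p. H (fst p) (snd p))"
    by (rule compact_uniformly_continuous)
  then obtain \<eta> where \<eta>: "\<eta> > 0"
    "\<And>p q. p \<in> K \<Longrightarrow> q \<in> K \<Longrightarrow> dist q p < \<eta> \<Longrightarrow> dist (H (fst q) (snd q)) (H (fst p) (snd p)) < e"
    unfolding uniformly_continuous_on_def using assms(3) by metis
  show ?thesis
    unfolding X_def[symmetric]
  proof (intro exI[of _ "min \<eta> \<epsilon>"] conjI allI impI ballI)
    show "min \<eta> \<epsilon> > 0" using \<eta>(1) \<epsilon>(1) by simp
    fix t assume "t \<noteq> 0 \<and> \<bar>t\<bar> < min \<eta> \<epsilon>"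
    then have t: "t \<noteq> 0" "\<bar>t\<bar> < \<eta>" "\<bar>t\<bar> \<le> \<epsilon>" by auto
    have "(\<lambda>z. G t z * f (\<mu> t z)) holomorphic_on unit_disc"
    proof -
      have hd: "\<delta> t holomorphic_on unit_disc" unfolding \<delta>_def[abs_def] by (intro holomorphic_intros)
      have hm: "\<mu> t holomorphic_on unit_disc"
        unfolding \<mu>_def[abs_def] using \<delta>0 by (intro holomorphic_intros hd) auto
      have "(f \<circ> \<mu> t) holomorphic_on unit_disc"
        by (rule holomorphic_on_compose_gen[OF hm]) (use f \<mu>2 in \<open>auto simp: hol_disc_def\<close>)
      then show ?thesis
        unfolding G_def o_def using \<delta>R[OF t(3)] by (intro holomorphic_intros hd) auto
    qed
    then have "discrete_series \<xi> X t f holomorphic_on unit_disc"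
      by (rule holomorphic_transform) (simp add: ds[OF t(3)])
    then show "discrete_series \<xi> X t f \<in> hol_disc"
      by (simp add: hol_disc_def discrete_series_def on_disc_def)
    fix z assume z: "z \<in> unit_disc"
    have sub: "\<bar>x\<bar> \<le> \<epsilon>" "\<bar>x\<bar> < \<eta>" if "x \<in> closed_segment 0 t" for x
      using that t by (auto simp: closed_segment_eq_real_ivl split: if_splits)
    have "norm (G t z * f (\<mu> t z) - G 0 z * f (\<mu> 0 z) - (t - 0) *\<^sub>R H 0 z) \<le> norm (t - 0) * e"
    proof (rule vector_differentiable_bound_linearization[where S="closed_segment 0 t"])
      show "((\<lambda>t. G t z * f (\<mu> t z)) has_vector_derivative H x z) (at x within closed_segment 0 t)"
        if "x \<in> closed_segment 0 t" for x
        by (rule deriv[OF sub(1)[OF that] z])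
      show "norm (H x z - H 0 z) \<le> e" if "x \<in> closed_segment 0 t" for x
        using \<eta>(2)[of "(0, z)" "(x, z)"] sub[OF that] z \<epsilon>(1)
        by (simp add: K_def dist_norm abs_le_iff)
    qed auto
    moreover have "G 0 z * f (\<mu> 0 z) = f z"
      by (simp add: G_def \<mu>_def \<delta>_def init)
    ultimately have "cmod (discrete_series \<xi> X t f z - f z - of_real t * rep_expr \<xi> s u f z) \<le> \<bar>t\<bar> * e"
      by (simp add: ds[OF t(3) z] H0[OF z] scaleR_conv_of_real)
    moreover have "(discrete_series \<xi> X t f z - f z) / of_real t - rep_expr \<xi> s u f z
      = (discrete_series \<xi> X t f z - f z - of_real t * rep_expr \<xi> s u f z) / of_real t"
      using t(1) by (simp add: field_simps)
    ultimately show "cmod ((discrete_series \<xi> X t f z - f z) / of_real t - rep_expr \<xi> s u f z) \<le> e"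
      using t(1) by (simp add: norm_divide divide_le_eq mult.commute)
  qed
qed

lemma rep_expr_bergman:
  assumes "\<xi> > -1" "f \<in> smooth_vectors \<xi>"
  shows "rep_expr \<xi> s u f \<in> bergman \<xi>"
proof -
  have f: "f \<in> hol_disc" using assms(2) smooth_vectors_iff[OF assms(1)] by blast
  obtain V V' where V: "continuous_on (cball 0 1) V" "continuous_on (cball 0 1) V'"
    "\<And>z. z \<in> unit_disc \<Longrightarrow> V z = f z" "\<And>z. z \<in> unit_disc \<Longrightarrow> V' z = deriv f z"
    using smooth_vectors_extend[OF assms] by blast
  have "compact ((\<lambda>z. (cnj u * z\<^sup>2 - 2 * \<i> * of_real s * z - u) * V' z
     + of_real (\<xi> + 2) * (cnj u * z - \<i> * of_real s) * V z) ` cball 0 1)"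
    by (intro compact_continuous_image continuous_intros V) simp
  then obtain C where C: "\<forall>z\<in>cball 0 1. cmod ((cnj u * z\<^sup>2 - 2 * \<i> * of_real s * z - u) * V' z
     + of_real (\<xi> + 2) * (cnj u * z - \<i> * of_real s) * V z) \<le> C"
    by (auto dest!: compact_imp_bounded simp: bounded_iff)
  show ?thesis
  proof (rule bergman_bounded(1)[OF assms(1) rep_expr_hol_disc[OF f]])
    fix z :: complex assume z: "z \<in> unit_disc"
    then show "cmod (rep_expr \<xi> s u f z) \<le> C"
      using bspec[OF C, of z] V(3,4)[OF z] by (simp add: rep_expr_def on_disc_def)
  qed
qed

text \<open>
  Uniform convergence on the disc implies norm convergence because the measure is finite.
\<close>

lemma discrete_series_has_derivative:
  assumes "\<xi> > -1" "f \<in> smooth_vectors \<xi>"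
  shows "bergman_tendsto \<xi> (\<lambda>(t::real) z. (discrete_series \<xi> (su11_matrix (\<i> * of_real s) u) t f z - f z) / of_real t)
    (rep_expr \<xi> s u f) (at 0)"
proof -
  define X where "X = su11_matrix (\<i> * of_real s) u"
  define Q where "Q t z = (discrete_series \<xi> X t f z - f z) / of_real t" for t :: real and z
  define w where "w = rep_expr \<xi> s u f"
  have f: "f \<in> hol_disc" using assms(2) smooth_vectors_iff[OF assms(1)] by blast
  have w: "w \<in> bergman \<xi>" unfolding w_def by (rule rep_expr_bergman[OF assms])
  have key: "\<forall>\<^sub>F t in at 0. (\<lambda>z. Q t z - w z) \<in> bergman \<xi> \<and> bergman_norm \<xi> (\<lambda>z. Q t z - w z) \<le> e * sqrt (weight \<xi> 0)"
    if e: "e > 0" for e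
  proof -
    obtain d where d: "d > 0" "\<And>t. t \<noteq> 0 \<Longrightarrow> \<bar>t\<bar> < d \<Longrightarrow> discrete_series \<xi> X t f \<in> hol_disc"
      "\<And>t z. t \<noteq> 0 \<Longrightarrow> \<bar>t\<bar> < d \<Longrightarrow> z \<in> unit_disc \<Longrightarrow> cmod (Q t z - w z) \<le> e"
      using discrete_series_uniform_derivative[OF assms e, of s u] unfolding Q_def w_def X_def by blast
    have "(\<lambda>z. Q t z - w z) \<in> bergman \<xi> \<and> bergman_norm \<xi> (\<lambda>z. Q t z - w z) \<le> e * sqrt (weight \<xi> 0)"
      if t: "t \<noteq> 0" "\<bar>t\<bar> < d" for t
    proof -
      have "(\<lambda>z. 1 * (1 / of_real t * discrete_series \<xi> X t f z + (- 1 / of_real t) * f z) + (-1) * w z) \<in> hol_disc"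
        by (intro hol_disc_lincomb d(2) t f bergman_hol_disc[OF w])
      then have "(\<lambda>z. Q t z - w z) \<in> hol_disc"
        by (simp add: Q_def diff_divide_distrib)
      then show ?thesis
        using bergman_bounded[OF assms(1), of "\<lambda>z. Q t z - w z" e] d(3)[OF t] by blast
    qed
    then show ?thesis
      unfolding eventually_at using d(1) by (auto simp: dist_real_def)
  qed
  have "((\<lambda>t. bergman_norm \<xi> (\<lambda>z. Q t z - w z)) \<longlongrightarrow> 0) (at 0)"
  proof (rule tendstoI)
    fix e :: real assume e: "e > 0"
    define e' where "e' = e / (2 * sqrt (weight \<xi> 0))"
    have p: "sqrt (weight \<xi> 0) > 0" using weight_pos[OF assms(1)] by simp
    have "e' > 0" "e' * sqrt (weight \<xi> 0) < e" using e p by (simp_all add: e'_def)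
    with key[OF this(1)] show "\<forall>\<^sub>F t in at 0. dist (bergman_norm \<xi> (\<lambda>z. Q t z - w z)) 0 < e"
      by (auto elim!: eventually_mono)
  qed
  moreover have "\<forall>\<^sub>F t in at 0. Q t \<in> bergman \<xi>"
    using key[OF zero_less_one]
  proof eventually_elim
    case (elim t)
    then have "(\<lambda>z. 1 * (Q t z - w z) + 1 * w z) \<in> bergman \<xi>"
      by (intro bergman_lincomb(1) assms(1) w) simp
    then show ?case by simp
  qed
  ultimately show ?thesis
    using w unfolding bergman_tendsto_def Q_def[abs_def] w_def X_def by blast
qed

lemma derived_rep_eq:
  assumes "\<xi> > -1"
  shows "derived_rep \<xi> (su11_matrix (\<i> * of_real s) u) = (\<lambda>f. (f, rep_expr \<xi> s u f)) ` smooth_vectors \<xi>"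
proof (intro set_eqI iffI; clarify)
  fix f g assume "(f, g) \<in> derived_rep \<xi> (su11_matrix (\<i> * of_real s) u)"
  then have f: "f \<in> smooth_vectors \<xi>"
    and g: "bergman_tendsto \<xi> (\<lambda>(t::real) z. (discrete_series \<xi> (su11_matrix (\<i> * of_real s) u) t f z - f z) / of_real t) g (at 0)"
    by (auto simp: derived_rep_def)
  have "g = rep_expr \<xi> s u f"
    by (rule bergman_tendsto_unique[OF assms at_neq_bot g discrete_series_has_derivative[OF assms f]])
  then show "(f, g) \<in> (\<lambda>f. (f, rep_expr \<xi> s u f)) ` smooth_vectors \<xi>"
    using f by simp
next
  fix f assume "f \<in> smooth_vectors \<xi>"
  then show "(f, rep_expr \<xi> s u f) \<in> derived_rep \<xi> (su11_matrix (\<i> * of_real s) u)"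
    using discrete_series_has_derivative[OF assms] by (simp add: derived_rep_def)
qed

lemma i_times_plus_derived_rep:
  assumes "\<xi> > -1"
  shows "i_times_plus (derived_rep \<xi> (su11_matrix (\<i> * of_real s) u)) (b - (\<xi> + 2) * s)
    = (\<lambda>f. (f, diff_expr \<xi> (2 * s) b (\<i> * cnj u) f)) ` smooth_vectors \<xi>"
proof -
  have e: "diff_expr \<xi> (2 * s) b (\<i> * cnj u) f
    = (\<lambda>z. \<i> * rep_expr \<xi> s u f z + of_real (b - (\<xi> + 2) * s) * f z)" if "f \<in> smooth_vectors \<xi>" for f
    using that on_disc_hol_disc[of f] smooth_vectors_iff[OF assms] by (simp add: fun_eq_iff diff_expr_eq_rep_expr)
  have "i_times_plus (derived_rep \<xi> (su11_matrix (\<i> * of_real s) u)) (b - (\<xi> + 2) * s)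
    = (\<lambda>f. (f, (\<lambda>z. \<i> * rep_expr \<xi> s u f z + of_real (b - (\<xi> + 2) * s) * f z))) ` smooth_vectors \<xi>"
    unfolding i_times_plus_def derived_rep_eq[OF assms] by blast
  also have "\<dots> = (\<lambda>f. (f, diff_expr \<xi> (2 * s) b (\<i> * cnj u) f)) ` smooth_vectors \<xi>"
    by (rule image_cong) (simp_all only: e)
  finally show ?thesis .
qed

lemma smooth_diff_expr_max_op:
  assumes "\<xi> > -1" "f \<in> smooth_vectors \<xi>"
  shows "(f, diff_expr \<xi> (2 * s) b (\<i> * cnj u) f) \<in> max_op \<xi> (2 * s) b (\<i> * cnj u)"
proof -
  have f: "f \<in> hol_disc" using assms(2) smooth_vectors_iff[OF assms(1)] by blast
  have "diff_expr \<xi> (2 * s) b (\<i> * cnj u) f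
    = (\<lambda>z. \<i> * rep_expr \<xi> s u f z + of_real (b - (\<xi> + 2) * s) * f z)"
    using on_disc_hol_disc[OF f] by (simp add: fun_eq_iff diff_expr_eq_rep_expr)
  then have "diff_expr \<xi> (2 * s) b (\<i> * cnj u) f \<in> bergman \<xi>"
    using bergman_lincomb(1)[OF assms(1) rep_expr_bergman[OF assms] smooth_vectors_bergman[OF assms]] by simp
  then show ?thesis
    using smooth_vectors_bergman[OF assms] taylor_diff_expr[OF f] by (simp add: max_op_def)
qed

section \<open>Closures\<close>

lemma closure_operatorI:
  assumes "\<And>n. (v n, w n) \<in> A" "bergman_tendsto \<xi> v f sequentially" "bergman_tendsto \<xi> w g sequentially"
  shows "(f, g) \<in> closure_operator \<xi> A"
  using assms unfolding closure_operator_def by auto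

lemma closure_operatorE:
  assumes "(f, g) \<in> closure_operator \<xi> A"
  obtains v w where "\<And>n. (v n, w n) \<in> A" "bergman_tendsto \<xi> v f sequentially" "bergman_tendsto \<xi> w g sequentially"
  using assms unfolding closure_operator_def by auto

lemma i_times_plusI:
  assumes "(f, h) \<in> A" "g = (\<lambda>z. \<i> * h z + of_real d * f z)"
  shows "(f, g) \<in> i_times_plus A d"
  using assms unfolding i_times_plus_def by auto

text \<open>
  The map \<open>(v, h) \<mapsto> (v, \<i>h + dv)\<close> on graphs is continuous, with continuous inverse
  \<open>(v, w) \<mapsto> (v, -\<i>w + \<i>dv)\<close>.
\<close>

lemma closure_i_times_plus:
  assumes "\<xi> > -1"
  shows "closure_operator \<xi> (i_times_plus A d) = i_times_plus (closure_operator \<xi> A) d"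
proof (intro set_eqI iffI; clarify)
  fix f g assume "(f, g) \<in> closure_operator \<xi> (i_times_plus A d)"
  then obtain v w where vw: "\<And>n. (v n, w n) \<in> i_times_plus A d"
    and v: "bergman_tendsto \<xi> v f sequentially" and w: "bergman_tendsto \<xi> w g sequentially"
    by (rule closure_operatorE) blast
  define h where "h n z = (- \<i>) * w n z + (\<i> * of_real d) * v n z" for n z
  have "(v n, h n) \<in> A" for n
  proof -
    obtain k where k: "(v n, k) \<in> A" "w n = (\<lambda>z. \<i> * k z + of_real d * v n z)"
      using vw[of n] unfolding i_times_plus_def by auto
    have "h n = k" by (simp add: h_def k(2) fun_eq_iff algebra_simps)
    then show ?thesis using k(1) by simp
  qed
  moreover have "bergman_tendsto \<xi> h (\<lambda>z. (- \<i>) * g z + (\<i> * of_real d) * f z) sequentially"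
    unfolding h_def[abs_def] by (rule bergman_tendsto_lincomb[OF assms w v])
  ultimately have "(f, (\<lambda>z. (- \<i>) * g z + (\<i> * of_real d) * f z)) \<in> closure_operator \<xi> A"
    by (intro closure_operatorI[OF _ v])
  then show "(f, g) \<in> i_times_plus (closure_operator \<xi> A) d"
    by (rule i_times_plusI) (simp add: fun_eq_iff algebra_simps)
next
  fix f g assume "(f, g) \<in> i_times_plus (closure_operator \<xi> A) d"
  then obtain h where h: "(f, h) \<in> closure_operator \<xi> A" and g: "g = (\<lambda>z. \<i> * h z + of_real d * f z)"
    unfolding i_times_plus_def by auto
  obtain v w where vw: "\<And>n. (v n, w n) \<in> A"
    and v: "bergman_tendsto \<xi> v f sequentially" and w: "bergman_tendsto \<xi> w h sequentially"
    using h by (rule closure_operatorE) blast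
  show "(f, g) \<in> closure_operator \<xi> (i_times_plus A d)"
    unfolding g by (rule closure_operatorI[OF i_times_plusI[OF vw refl] v bergman_tendsto_lincomb[OF assms w v]])
qed

theorem theorem9:
  fixes \<xi> a b :: real and c :: complex
  assumes "\<xi> > -1"
  defines "L \<equiv> diff_op \<xi> a b c"
  shows "symmetric_operator \<xi> L \<and>
    (\<exists>(d::real) X. X \<in> su11 \<and>
       Domain (i_times_plus (derived_rep \<xi> X) d) = smooth_vectors \<xi> \<and>
       L = restrict_operator (i_times_plus (derived_rep \<xi> X) d) poly_disc \<and>
       closure_operator \<xi> L = i_times_plus (closure_operator \<xi> (derived_rep \<xi> X)) d \<and>
       self_adjoint_operator \<xi> (closure_operator \<xi> L))"
proof -
  \<comment> \<open>these values come from comparing the coefficients of the two differential expressions\<close>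
  define s u X d where "s = a / 2" and "u = \<i> * cnj c" and "X = su11_matrix (\<i> * of_real s) u"
    and "d = b - (\<xi> + 2) * s"
  have ac: "2 * s = a" "\<i> * cnj u = c" by (simp_all add: s_def u_def)
  have S: "i_times_plus (derived_rep \<xi> X) d = (\<lambda>f. (f, diff_expr \<xi> a b c f)) ` smooth_vectors \<xi>"
    unfolding X_def d_def using i_times_plus_derived_rep[OF assms(1), of s u b] by (simp only: ac)
  have S_max: "i_times_plus (derived_rep \<xi> X) d \<subseteq> max_op \<xi> a b c"
    unfolding S using smooth_diff_expr_max_op[OF assms(1), of _ s b u] unfolding ac by blast
  have restr: "L = restrict_operator (i_times_plus (derived_rep \<xi> X) d) poly_disc"
    unfolding S L_def restrict_operator_def diff_op_def diff_expr_def
    using poly_disc_smooth[OF assms(1)] by blast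
  then have L_sub: "L \<subseteq> i_times_plus (derived_rep \<xi> X) d"
    unfolding restrict_operator_def by blast
  have cl: "closure_operator \<xi> L = max_op \<xi> a b c"
    unfolding L_def by (rule closure_diff_op[OF assms(1)])
  have "closure_operator \<xi> (i_times_plus (derived_rep \<xi> X) d) = max_op \<xi> a b c"
  proof
    show "max_op \<xi> a b c \<subseteq> closure_operator \<xi> (i_times_plus (derived_rep \<xi> X) d)"
      using L_sub unfolding cl[symmetric] closure_operator_def by blast
    show "closure_operator \<xi> (i_times_plus (derived_rep \<xi> X) d) \<subseteq> max_op \<xi> a b c"
    proof clarify
      fix g h assume "(g, h) \<in> closure_operator \<xi> (i_times_plus (derived_rep \<xi> X) d)"
      then obtain v w where "\<And>n. (v n, w n) \<in> i_times_plus (derived_rep \<xi> X) d"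
        "bergman_tendsto \<xi> v g sequentially" "bergman_tendsto \<xi> w h sequentially"
        by (rule closure_operatorE) blast
      then show "(g, h) \<in> max_op \<xi> a b c"
        using max_op_closed[OF assms(1), of v w] S_max by blast
    qed
  qed
  then have "closure_operator \<xi> L = i_times_plus (closure_operator \<xi> (derived_rep \<xi> X)) d"
    unfolding cl closure_i_times_plus[OF assms(1)] by simp
  moreover have "X \<in> su11"
    unfolding su11_def X_def su11_matrix_def by auto
  moreover have "Domain (i_times_plus (derived_rep \<xi> X) d) = smooth_vectors \<xi>"
    unfolding S by force
  moreover have "self_adjoint_operator \<xi> (closure_operator \<xi> L)"
    unfolding cl by (rule self_adjoint_max_op[OF assms(1)])
  moreover have "symmetric_operator \<xi> L"
    unfolding L_def by (rule symmetric_diff_op[OF assms(1)])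
  ultimately show ?thesis using restr by blast
qed

end
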